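(* Let $d\ge1$ and $n\ge d+1$, let $\tau_1,\ldots,\tau_n>0$, and let $g_1,\ldots,g_n$ be independent $\mathbb R^d$-valued standard Gaussian random vectors. Then, for $k\in\{0,\ldots,d-1\}$, $$\mathbb E f_k\Bigl(\Bigl[\frac{g_1}{\tau_1},\ldots,\frac{g_n}{\tau_n}\Bigr]\Bigr)=2\sum_{s=0}^\infty\ \sum_{1\le i_1<\cdots<i_{d-2s}\le n}\mathbf g_{n-d+2s}\bigl(\tau_{i_1}^2+\cdots+\tau_{i_{d-2s}}^2;\ \tau_{j_1}^2,\ldots,\tau_{j_{n-d+2s}}^2\bigr)$$ $$\qquad\times\sum_{1\le m_1<\cdots<m_{d-2s-k-1}\le d-2s}\mathbf g_{d-2s-1-k}\bigl(-\tau_{i_1}^2-\cdots-\tau_{i_{d-2s}}^2;\ \tau_{i_{m_1}}^2,\ldots,\tau_{i_{m_{d-2s-k-1}}}^2\bigr),$$ where, in the second sum, $j_1,\ldots,j_{n-d+2s}$ are defined via $\{i_1,\ldots,i_{d-2s}\}\cup\{j_1,\ldots,j_{n-d+2s}\}=\{1,\ldots,n\}$.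
   Context: $[\ldots]$ denotes the convex hull and $f_k(P)$ is the number of $k$-dimensional faces of a polytope $P$. In the sum over $s$, only terms with $d-2s\ge k+1$ contribute; all others are $0$ (so the sum is finite). If $d-2s-k-1=0$, the innermost sum consists of the single term $\mathbf g_0=1$. Function $\mathbf g_m$ (all signs equal to $+1$): for $m\in\mathbb N$, $\lambda_1,\ldots,\lambda_m>0$ and $\lambda_0\in\mathbb R$ with either $\lambda_0>0$ or $\lambda_0<-(\lambda_1+\cdots+\lambda_m)$, $\mathbf g_m(\lambda_0;\lambda_1,\ldots,\lambda_m):=\mathbf g_m(\lambda_0;\lambda_1,\ldots,\lambda_m;1,\ldots,1):=\mathbb P[\eta_1<0,\ldots,\eta_m<0]$, where $(\eta_1,\ldots,\eta_m)$ is a centered Gaussian vector with covariance matrix $\bigl(\frac1{\lambda_0}+\frac{\delta_{ij}}{\lambda_i}\bigr)_{i,j=1}^m$. Also $\mathbf g_0(\lambda_0):=1$ for all $\lambda_0\in\mathbb R$. *)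

theory Defs
  imports "HOL-Probability.Probability"
begin

text \<open>
  A random vector \<open>(\<eta> i)\<close>, \<open>i \<in> I\<close>, is centered Gaussian with covariance matrix \<open>C\<close> if its
  characteristic function is \<open>t \<mapsto> exp (- t\<^sup>T C t / 2)\<close>.
\<close>

definition centered_gaussian_vector ::
  "'w measure \<Rightarrow> 'i set \<Rightarrow> ('i \<Rightarrow> 'w \<Rightarrow> real) \<Rightarrow> ('i \<Rightarrow> 'i \<Rightarrow> real) \<Rightarrow> bool"
  where "centered_gaussian_vector M I \<eta> C \<longleftrightarrow>
    prob_space M \<and> finite I \<and> (\<forall>i\<in>I. \<eta> i \<in> borel_measurable M) \<and>
    (\<forall>t :: 'i \<Rightarrow> real.
       (CLINT \<omega>|M. iexp (\<Sum>i\<in>I. t i * \<eta> i \<omega>)) =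
       complex_of_real (exp (- (\<Sum>i\<in>I. \<Sum>j\<in>I. t i * C i j * t j) / 2)))"

text \<open>
  The components are indexed by a finite set \<open>J\<close> rather than by \<open>1, \<dots>, m\<close>: the value of
  \<open>gauss_orthant J a l\<close> is \<open>g\<^sub>m(a; l\<^sub>1, \<dots>, l\<^sub>m)\<close> with \<open>m = card J\<close>, where
  \<open>l\<^sub>1, \<dots>, l\<^sub>m\<close> enumerate \<open>(l j)\<close>, \<open>j \<in> J\<close>, in any order.  It is meaningful when \<open>l j > 0\<close> for
  all \<open>j \<in> J\<close> and either \<open>a > 0\<close> or \<open>a < - (\<Sum>j\<in>J. l j)\<close>; the covariance matrix is then
  positive definite, also in the second case.  A vector with given covariance matrix has a
  unique law, so the description determines exactly one \<open>p\<close>; the sample space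
  \<open>nat \<Rightarrow> real\<close> is large enough to carry such a vector.
\<close>

definition gauss_orthant :: "nat set \<Rightarrow> real \<Rightarrow> (nat \<Rightarrow> real) \<Rightarrow> real"
  where "gauss_orthant J a l =
    (if J = {} then 1
     else THE p. \<exists>(M :: (nat \<Rightarrow> real) measure) \<eta>.
       centered_gaussian_vector M J \<eta> (\<lambda>i j. 1 / a + (if i = j then 1 / l i else 0)) \<and>
       p = measure M {\<omega> \<in> space M. \<forall>j\<in>J. \<eta> j \<omega> < 0})"

definition standard_gaussian_vector :: "'w measure \<Rightarrow> ('w \<Rightarrow> 'a::euclidean_space) \<Rightarrow> bool"
  where "standard_gaussian_vector M X \<longleftrightarrow>
    distributed M lborel X (\<lambda>x. ennreal (\<Prod>b\<in>Basis. std_normal_density (x \<bullet> b)))"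

definition face_number :: "nat \<Rightarrow> 'a::euclidean_space set \<Rightarrow> nat"
  where "face_number k P = card {F. F face_of P \<and> aff_dim F = int k}"

end

theory Submission
  imports Defs
begin

text \<open>
  Write \<open>a i 0 = \<tau> i\<close> and let \<open>a i r\<close> be the \<open>r\<close>-th coordinate of \<open>g i\<close>.  A set \<open>A\<close> of points spans a
  proper face of the projection of the polytope to the first \<open>m\<close> coordinates iff some combination of
  the columns \<open>0, \<dots>, m\<close> of \<open>a\<close> vanishes on the rows in \<open>A\<close> and is negative on all other rows.  Almost
  surely all faces are simplices, so the expected number of \<open>k\<close>-faces is the sum of these
  probabilities over all \<open>A\<close> with \<open>k + 1\<close> elements.

  The probabilities are computed by a recursion \<open>m - 2 \<leadsto> m\<close>.  If \<open>A\<close> spans a face for \<open>m\<close> coordinates but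
  not for \<open>m - 2\<close>, then the normal cone of this face projects, along the first \<open>m - 2\<close> coordinates, onto
  a pointed cone in the plane, and such a cone has exactly two edges.  The edges correspond to facets \<open>I\<close>
  containing \<open>A\<close> for which the linear dependency of the rows \<open>I\<close> in \<open>m - 2\<close> coordinates is positive
  outside \<open>A\<close> up to sign.  For a fixed \<open>I\<close> the event of being a facet and the sign event are independent:
  after splitting the rows in \<open>I\<close> along \<open>\<tau>\<close>, the dependency only involves the part orthogonal to \<open>\<tau>\<close>,
  and given this part the facet event is an orthant event of probability \<open>2 g(\<Sigma> \<tau>\<^sup>2; \<dots>)\<close>.  The dependency
  has a rotation invariant direction in the hyperplane orthogonal to \<open>\<tau>\<close>, so its sign event has
  probability \<open>2 g(- \<Sigma> \<tau>\<^sup>2; \<dots>)\<close>.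
\<close>

section \<open>Systems of linear equations and cones in general position\<close>

text \<open>An affine function evaluated at \<open>g i / \<tau> i\<close> and multiplied by
  \<open>\<tau> i > 0\<close> is a linear form in the row \<open>(\<tau> i, g i)\<close> with the
  same sign; this is why column 0 is \<open>\<tau>\<close> and why all random entries stay standard.
  Coordinates are added in pairs because in the plane, unlike in higher dimension, the number of
  edges of a pointed full-dimensional cone does not depend on the cone. A pair \<open>(I, A)\<close>
  occurs with probability 4 times a product of two orthant probabilities, and each new face is
  counted twice; hence the factor 2 and the step 2 in \<open>s\<close>. With \<open>T\<close> the
  sum of the squares of \<open>\<tau>\<close> over \<open>I\<close>, the constant matrix
  \<open>- 1 / T\<close> plus the diagonal \<open>1 / (\<tau> i)^2\<close> is the covariance of a
  standard Gaussian vector projected orthogonally to \<open>\<tau>\<close> and divided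
  coordinatewise by \<open>\<tau>\<close>; this explains the negative first argument. Two obstacles
  shape the proof. The events quantify over uncountably many coefficient vectors, so measurability
  is drawn from compactness. The direction of a dependency is fixed only up to sign; instead of a
  uniform law on a sphere, only invariance under reflections fixing \<open>\<tau>\<close> is
  used.\<close>

text \<open>Elimination: an equation with a nonzero coefficient at \<open>r0\<close> expresses that
  unknown through the others, which removes one equation and one unknown. Both index types are
  arbitrary since the unknowns are sometimes coefficients of columns and sometimes weights of
  rows.\<close>

lemma homogeneous_solution:
  fixes f :: "'p \<Rightarrow> 'r \<Rightarrow> real"
  assumes "finite P" "finite R" "card P < card R"
  shows "\<exists>c. (\<exists>r\<in>R. c r \<noteq> 0) \<and> (\<forall>p\<in>P. (\<Sum>r\<in>R. c r * f p r) = 0)"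
  using assms
proof (induction P arbitrary: R f rule: finite_induct)
  case empty
  then obtain r where "r \<in> R" by (metis card.empty ex_in_conv less_irrefl)
  then show ?case by (intro exI[of _ "\<lambda>_. 1"]) auto
next
  case (insert p P)
  show ?case
  proof (cases "\<forall>r\<in>R. f p r = 0")
    case True
    have "card P < card R" using insert by simp
    from insert.IH[OF insert.prems(1) this, of f] obtain c where
      "\<exists>r\<in>R. c r \<noteq> 0" "\<forall>p\<in>P. (\<Sum>r\<in>R. c r * f p r) = 0" by blast
    with True show ?thesis by (intro exI[of _ c]) auto
  next
    case False
    then obtain r0 where r0: "r0 \<in> R" "f p r0 \<noteq> 0" by blast
    define R' where "R' = R - {r0}"
    have R': "finite R'" "r0 \<notin> R'" "R = insert r0 R'"
      using insert.prems r0 by (auto simp: R'_def)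
    have cd: "card P < card R'" using insert R' by simp
    from insert.IH[OF R'(1) cd, of "\<lambda>q r. f q r - f q r0 * f p r / f p r0"] obtain c where
      c: "\<exists>r\<in>R'. c r \<noteq> 0" "\<And>q. q \<in> P \<Longrightarrow> (\<Sum>r\<in>R'. c r * (f q r - f q r0 * f p r / f p r0)) = 0"
      by blast
    define s where "s = (\<Sum>r\<in>R'. c r * f p r) / f p r0"
    define c' where "c' = c(r0 := - s)"
    have split: "(\<Sum>r\<in>R. c' r * f q r) = - s * f q r0 + (\<Sum>r\<in>R'. c r * f q r)" for q
    proof -
      have "(\<Sum>r\<in>R'. c' r * f q r) = (\<Sum>r\<in>R'. c r * f q r)"
        using R'(2) by (intro sum.cong) (auto simp: c'_def)
      then show ?thesis using R' by (simp add: c'_def)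
    qed
    have "(\<Sum>r\<in>R. c' r * f q r) = 0" if "q \<in> P" for q
    proof -
      have "0 = (\<Sum>r\<in>R'. c r * f q r) - (\<Sum>r\<in>R'. (c r * f p r) * (f q r0 / f p r0))"
        using c(2)[OF that] by (simp add: algebra_simps sum_subtractf)
      also have "\<dots> = (\<Sum>r\<in>R'. c r * f q r) - s * f q r0"
        by (simp add: s_def sum_distrib_right sum_divide_distrib)
      finally show ?thesis by (simp add: split)
    qed
    moreover have "(\<Sum>r\<in>R. c' r * f p r) = 0"
      using r0 by (simp add: split s_def)
    moreover have "\<exists>r\<in>R. c' r \<noteq> 0"
      using c(1) R' by (auto simp: c'_def)
    ultimately show ?thesis by (intro exI[of _ c']) auto
  qed
qed

text \<open>Homogenization: the extra unknown \<open>None\<close> has the column \<open>- t\<close>,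
  so a nontrivial solution exists by counting. The trivial kernel forces its value at
  \<open>None\<close> to be nonzero, and dividing by it solves the original system.\<close>

lemma square_system_solvable:
  fixes f :: "'p \<Rightarrow> 'r \<Rightarrow> real"
  assumes "finite P" "finite R" "card P = card R"
    and ker: "\<And>c. (\<And>p. p \<in> P \<Longrightarrow> (\<Sum>r\<in>R. c r * f p r) = 0) \<Longrightarrow> \<forall>r\<in>R. c r = 0"
  shows "\<exists>c. \<forall>p\<in>P. (\<Sum>r\<in>R. c r * f p r) = t p"
proof -
  define R' where "R' = insert None (Some ` R)"
  define f' where "f' p r = (case r of None \<Rightarrow> - t p | Some r \<Rightarrow> f p r)" for p r
  have "card P < card R'" "finite R'"
    using assms by (auto simp: R'_def card_image)
  from homogeneous_solution[OF assms(1) this(2) this(1), of f'] obtain c where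
    c: "\<exists>r\<in>R'. c r \<noteq> 0" "\<And>p. p \<in> P \<Longrightarrow> (\<Sum>r\<in>R'. c r * f' p r) = 0" by blast
  have split: "(\<Sum>r\<in>R'. c r * f' p r) = (\<Sum>r\<in>R. c (Some r) * f p r) - c None * t p" for p
    using assms(2) by (simp add: R'_def sum.reindex f'_def)
  have "c None \<noteq> 0"
  proof
    assume 0: "c None = 0"
    have "\<forall>r\<in>R. c (Some r) = 0"
      by (rule ker) (use c(2) split 0 in auto)
    with 0 c(1) show False by (auto simp: R'_def)
  qed
  then have "(\<Sum>r\<in>R. (c (Some r) / c None) * f p r) = t p" if "p \<in> P" for p
    using c(2)[OF that] unfolding split
    by (simp add: sum_divide_distrib[symmetric] divide_simps)
  then show ?thesis by (intro exI[of _ "\<lambda>r. c (Some r) / c None"]) auto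
qed

section \<open>Row combinations, general position and dependencies\<close>

definition comb :: "nat \<Rightarrow> (nat \<Rightarrow> nat \<Rightarrow> real) \<Rightarrow> (nat \<Rightarrow> real) \<Rightarrow> nat \<Rightarrow> real"
  where "comb m a c i = (\<Sum>r\<le>m. c r * a i r)"

definition feas :: "nat \<Rightarrow> (nat \<Rightarrow> nat \<Rightarrow> real) \<Rightarrow> nat set \<Rightarrow> nat set \<Rightarrow> bool"
  where "feas m a Z S \<longleftrightarrow> (\<exists>c. (\<forall>i\<in>Z. comb m a c i = 0) \<and> (\<forall>i\<in>S. comb m a c i < 0))"

text \<open>Homogenized affine independence of any \<open>m + 1\<close> of the points projected to
  \<open>m\<close> coordinates, stated through trivial kernels so that no determinants
  occur.\<close>

definition genpos :: "nat set \<Rightarrow> (nat \<Rightarrow> nat \<Rightarrow> real) \<Rightarrow> nat \<Rightarrow> bool"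
  where "genpos N a m \<longleftrightarrow> (\<forall>I c. I \<subseteq> N \<longrightarrow> card I = Suc m \<longrightarrow>
    (\<forall>i\<in>I. comb m a c i = 0) \<longrightarrow> (\<forall>r\<le>m. c r = 0))"

text \<open>A dual certificate in the sense of Farkas: pairing such a \<open>b\<close> with a
  functional that vanishes on \<open>A\<close> and is negative elsewhere gives a contradiction once
  \<open>I - A\<close> is nonempty. The signs on \<open>A\<close> are left free because such a
  functional does not see them.\<close>

definition possol :: "nat \<Rightarrow> (nat \<Rightarrow> nat \<Rightarrow> real) \<Rightarrow> nat set \<Rightarrow> nat set \<Rightarrow> bool"
  where "possol p a I A \<longleftrightarrow>
    (\<exists>b. (\<forall>r\<le>p. (\<Sum>i\<in>I. b i * a i r) = 0) \<and> (\<forall>i\<in>I - A. 0 < b i))"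

lemma comb_add: "comb m a (\<lambda>r. c r + c' r) i = comb m a c i + comb m a c' i"
  by (simp add: comb_def algebra_simps sum.distrib)

lemma comb_diff: "comb m a (\<lambda>r. c r - c' r) i = comb m a c i - comb m a c' i"
  by (simp add: comb_def algebra_simps sum_subtractf)

lemma comb_scale: "comb m a (\<lambda>r. s * c r) i = s * comb m a c i"
  by (simp add: comb_def algebra_simps sum_distrib_left)

lemma comb_nonzeroD: "comb m a c i \<noteq> 0 \<Longrightarrow> \<exists>r\<le>m. c r \<noteq> 0"
  unfolding comb_def by (metis (no_types, lifting) atMost_iff mult_eq_0_iff sum.neutral)

lemma comb_Suc2:
  "comb (Suc (Suc p)) a c i = comb p a c i + c (Suc p) * a i (Suc p) + c (Suc (Suc p)) * a i (Suc (Suc p))"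
  by (simp add: comb_def)

lemma sum_comb: "(\<Sum>i\<in>I. b i * comb m a c i) = (\<Sum>r\<le>m. c r * (\<Sum>i\<in>I. b i * a i r))"
proof -
  have "(\<Sum>i\<in>I. b i * comb m a c i) = (\<Sum>i\<in>I. \<Sum>r\<le>m. c r * (b i * a i r))"
    by (simp add: comb_def sum_distrib_left mult_ac)
  also have "\<dots> = (\<Sum>r\<le>m. \<Sum>i\<in>I. c r * (b i * a i r))" by (rule sum.swap)
  finally show ?thesis by (simp add: sum_distrib_left)
qed

lemma genpos_card_zeros:
  assumes "genpos N a m" "finite N" "Z \<subseteq> N" "\<And>i. i \<in> Z \<Longrightarrow> comb m a c i = 0" "r \<le> m" "c r \<noteq> 0"
  shows "card Z \<le> m"
proof (rule ccontr)
  assume "\<not> card Z \<le> m"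
  then obtain I where "I \<subseteq> Z" "card I = Suc m"
    by (metis not_less_eq_eq obtain_subset_with_card_n)
  with assms show False unfolding genpos_def by (meson subset_iff)
qed

text \<open>Enlarging \<open>Z\<close> to exactly \<open>m + 1\<close> rows makes the system square.
  All later perturbations of functionals are obtained from this freedom to prescribe values.\<close>

lemma genpos_interpolate:
  assumes "genpos N a m" "finite N" "Suc m \<le> card N" "Z \<subseteq> N" "card Z \<le> Suc m"
  shows "\<exists>c. \<forall>i\<in>Z. comb m a c i = t i"
proof -
  have "finite Z" using assms finite_subset by blast
  obtain I where I: "Z \<subseteq> I" "I \<subseteq> N" "card I = Suc m"
    using exists_subset_between[of Z "Suc m" N] assms by auto
  have "\<exists>c. \<forall>i\<in>I. (\<Sum>r\<in>{..m}. c r * a i r) = t i"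
  proof (rule square_system_solvable)
    show "finite I" using I assms(2) finite_subset by blast
    fix c assume "\<And>i. i \<in> I \<Longrightarrow> (\<Sum>r\<in>{..m}. c r * a i r) = 0"
    then show "\<forall>r\<in>{..m}. c r = 0"
      using assms(1) I unfolding genpos_def comb_def by auto
  qed (use I in auto)
  with I show ?thesis unfolding comb_def by blast
qed

text \<open>Independence of rows follows from interpolation: pairing \<open>b\<close> with the
  combination whose values on \<open>I\<close> are \<open>b\<close> itself shows that the sum of its
  squares is 0.\<close>

lemma genpos_orthogonal:
  assumes "genpos N a m" "finite N" "Suc m \<le> card N" "I \<subseteq> N" "card I \<le> Suc m"
    and "\<And>r. r \<le> m \<Longrightarrow> (\<Sum>i\<in>I. b i * a i r) = 0" and "i \<in> I"
  shows "b i = 0"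
proof -
  from genpos_interpolate[OF assms(1-5), of b] obtain c where
    c: "\<forall>i\<in>I. comb m a c i = b i" by blast
  have "(\<Sum>i\<in>I. b i * b i) = (\<Sum>i\<in>I. b i * comb m a c i)" using c by simp
  also have "\<dots> = 0" unfolding sum_comb using assms(6) by simp
  finally have "(\<Sum>i\<in>I. b i * b i) = 0" .
  moreover have "finite I" using assms finite_subset by blast
  ultimately show ?thesis using assms(7)
    by (subst (asm) sum_nonneg_eq_0_iff) auto
qed

lemma small_perturbation:
  fixes u v :: "'a \<Rightarrow> real"
  assumes "finite S" "\<And>i. i \<in> S \<Longrightarrow> u i < 0"
  shows "\<exists>e>0. \<forall>i\<in>S. u i + e * v i < 0"
proof -
  have "\<forall>\<^sub>F e in at_right 0. \<forall>i\<in>S. u i + e * v i < 0"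
  proof (rule eventually_ball_finite[OF assms(1)], rule ballI)
    fix i assume "i \<in> S"
    have "((\<lambda>e. u i + e * v i) \<longlongrightarrow> u i + 0 * v i) (at_right 0)"
      by (intro tendsto_intros)
    then show "\<forall>\<^sub>F e in at_right 0. u i + e * v i < 0"
      using assms(2)[OF \<open>i \<in> S\<close>] by (intro order_tendstoD) auto
  qed
  then have "\<forall>\<^sub>F e in at_right (0::real). e > 0 \<and> (\<forall>i\<in>S. u i + e * v i < 0)"
    using eventually_at_right_less[of 0] by eventually_elim auto
  then show ?thesis
    using eventually_happens' trivial_limit_at_right_real by blast
qed

text \<open>The normal cone at the points of \<open>A\<close>; the last clause removes the
  functionals that vanish on all of \<open>N\<close>.\<close>

definition in_cone :: "nat \<Rightarrow> (nat \<Rightarrow> nat \<Rightarrow> real) \<Rightarrow> nat set \<Rightarrow> nat set \<Rightarrow> (nat \<Rightarrow> real) \<Rightarrow> bool"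
  where "in_cone m a N A c \<longleftrightarrow> (\<forall>i\<in>A. comb m a c i = 0) \<and> (\<forall>i\<in>N. comb m a c i \<le> 0) \<and>
    (\<exists>i\<in>N. comb m a c i < 0)"

text \<open>A point of the cone with fewer than \<open>m\<close> zeros lies in the relative interior of a segment
  whose end points have more zeros, so the extreme rays generate the cone.\<close>

lemma in_cone_induct:
  assumes gp: "genpos N a m" and fin: "finite N" and cN: "m < card N" and AN: "A \<subseteq> N"
    and ray: "\<And>I c. A \<subseteq> I \<Longrightarrow> I \<subseteq> N \<Longrightarrow> card I = m \<Longrightarrow> (\<And>i. i \<in> I \<Longrightarrow> comb m a c i = 0) \<Longrightarrow>
        (\<And>i. i \<in> N - I \<Longrightarrow> comb m a c i < 0) \<Longrightarrow> Q c"
    and add: "\<And>c c' s. Q c \<Longrightarrow> Q c' \<Longrightarrow> s > 0 \<Longrightarrow> Q (\<lambda>r. s * (c r + c' r))"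
    and K: "in_cone m a N A c"
  shows "Q c"
  using K
proof (induction "m - card {i\<in>N. comb m a c i = 0}" arbitrary: c rule: less_induct)
  case less
  define Z where "Z = {i\<in>N. comb m a c i = 0}"
  have AZ: "A \<subseteq> Z" and ZN: "Z \<subseteq> N" using less.prems AN by (auto simp: Z_def in_cone_def)
  have finZ: "finite Z" using fin ZN finite_subset by blast
  obtain i0 where i0: "i0 \<in> N" "comb m a c i0 < 0" using less.prems by (auto simp: in_cone_def)
  have neg: "comb m a c i < 0" if "i \<in> N - Z" for i
    using that less.prems by (force simp: Z_def in_cone_def)
  have "\<exists>r\<le>m. c r \<noteq> 0" by (rule comb_nonzeroD[of m a c i0]) (use i0 in simp)
  then have cZ: "card Z \<le> m"
    using genpos_card_zeros[OF gp fin ZN, of c] by (auto simp: Z_def)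
  show ?case
  proof (cases "card Z = m")
    case True
    show ?thesis by (rule ray[OF AZ ZN True]) (use neg in \<open>auto simp: Z_def\<close>)
  next
    case False
    with cZ have cZ': "card Z < m" by simp
    have i0Z: "i0 \<notin> Z" using i0 by (simp add: Z_def)
    \<comment> \<open>The additional zero at \<open>i0\<close>, where \<open>c\<close> is negative,
      keeps \<open>c'\<close> from being a multiple of \<open>c\<close>.\<close>
    have "card (insert i0 Z) < card {..m}" using cZ' i0Z finZ by simp
    from homogeneous_solution[OF _ _ this, of a] finZ obtain c' where
      c': "\<exists>r\<le>m. c' r \<noteq> 0" "\<And>i. i \<in> insert i0 Z \<Longrightarrow> comb m a c' i = 0"
      unfolding comb_def by auto
    obtain i1 where i1: "i1 \<in> N" "comb m a c' i1 \<noteq> 0"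
    proof (rule ccontr)
      assume "\<not> thesis"
      with that have "\<And>i. i \<in> N \<Longrightarrow> comb m a c' i = 0" by blast
      with genpos_card_zeros[OF gp fin subset_refl] c'(1) have "card N \<le> m" by blast
      with cN show False by simp
    qed
    \<comment> \<open>On the line through \<open>c\<close> in direction \<open>c'\<close>, the rows
      with extreme ratio are the first ones to reach the value 0, one at each end.\<close>
    define \<rho> where "\<rho> i = comb m a c' i / comb m a c i" for i
    have S: "finite (N - Z)" "i0 \<in> N - Z" "i1 \<in> N - Z"
      using fin i0 i0Z i1 c'(2) by auto
    define hi where "hi = Max (\<rho> ` (N - Z))"
    define lo where "lo = Min (\<rho> ` (N - Z))"
    have hi: "\<rho> i \<le> hi" and lo: "lo \<le> \<rho> i" if "i \<in> N - Z" for i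
      using S that by (auto simp: hi_def lo_def)
    obtain ih where ih: "ih \<in> N - Z" "\<rho> ih = hi"
      using Max_in[of "\<rho> ` (N - Z)"] S unfolding hi_def by (metis empty_iff finite_imageI image_iff)
    obtain il where il: "il \<in> N - Z" "\<rho> il = lo"
      using Min_in[of "\<rho> ` (N - Z)"] S unfolding lo_def by (metis empty_iff finite_imageI image_iff)
    have \<rho>0: "\<rho> i0 = 0" using c'(2) by (simp add: \<rho>_def)
    have \<rho>1: "\<rho> i1 \<noteq> 0" using i1 neg[OF S(3)] by (simp add: \<rho>_def)
    have lohi: "lo < hi" using hi[OF S(2)] lo[OF S(2)] hi[OF S(3)] lo[OF S(3)] \<rho>0 \<rho>1 by linarith
    have c'\<rho>: "comb m a c' i = \<rho> i * comb m a c i" if "i \<in> N - Z" for i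
      using neg[OF that] by (simp add: \<rho>_def)
    \<comment> \<open>The two end points of the segment, up to scaling: \<open>c'\<close> cancels in
      their sum, which is \<open>(hi - lo)\<close> times \<open>c\<close>.\<close>
    define c1 where "c1 = (\<lambda>r. hi * c r - c' r)"
    define c2 where "c2 = (\<lambda>r. c' r - lo * c r)"
    have comb1: "comb m a c1 i = (hi - \<rho> i) * comb m a c i" 
      and comb2: "comb m a c2 i = (\<rho> i - lo) * comb m a c i" if "i \<in> N - Z" for i
      using c'\<rho>[OF that] by (auto simp: c1_def c2_def comb_diff comb_scale algebra_simps)
    have combZ: "comb m a c1 i = 0" "comb m a c2 i = 0" if "i \<in> Z" for i
      using c'(2) that by (auto simp: c1_def c2_def comb_diff comb_scale Z_def)
    have K1: "in_cone m a N A c1"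
      unfolding in_cone_def
    proof (intro conjI ballI)
      show "comb m a c1 i = 0" if "i \<in> A" for i using combZ that AZ by auto
      show "comb m a c1 i \<le> 0" if "i \<in> N" for i
        using combZ[of i] comb1[of i] hi[of i] neg[of i] that
        by (cases "i \<in> Z") (auto simp: mult_nonneg_nonpos)
      show "\<exists>i\<in>N. comb m a c1 i < 0"
        using comb1[OF il(1)] il lohi neg[OF il(1)] by (intro bexI[of _ il]) (auto simp: mult_pos_neg)
    qed
    have K2: "in_cone m a N A c2"
      unfolding in_cone_def
    proof (intro conjI ballI)
      show "comb m a c2 i = 0" if "i \<in> A" for i using combZ that AZ by auto
      show "comb m a c2 i \<le> 0" if "i \<in> N" for i
        using combZ[of i] comb2[of i] lo[of i] neg[of i] that
        by (cases "i \<in> Z") (auto simp: mult_nonneg_nonpos)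
      show "\<exists>i\<in>N. comb m a c2 i < 0"
        using comb2[OF ih(1)] ih lohi neg[OF ih(1)] by (intro bexI[of _ ih]) (auto simp: mult_pos_neg)
    qed
    have smaller: "m - card {i\<in>N. comb m a c'' i = 0} < m - card Z"
      if "\<And>i. i \<in> Z \<Longrightarrow> comb m a c'' i = 0" "j \<in> N - Z" "comb m a c'' j = 0" for c'' j
    proof -
      have "insert j Z \<subseteq> {i\<in>N. comb m a c'' i = 0}" using that ZN by auto
      then have "card (insert j Z) \<le> card {i\<in>N. comb m a c'' i = 0}"
        using fin by (intro card_mono) auto
      then show ?thesis using that finZ cZ' by auto
    qed
    have "Q c1"
      by (rule less.hyps[OF _ K1], fold Z_def, rule smaller[of _ ih]) (use combZ comb1 ih in auto)
    moreover have "Q c2"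
      by (rule less.hyps[OF _ K2], fold Z_def, rule smaller[of _ il]) (use combZ comb2 il in auto)
    ultimately have "Q (\<lambda>r. (1 / (hi - lo)) * (c1 r + c2 r))"
      using lohi by (intro add) auto
    also have "(\<lambda>r. (1 / (hi - lo)) * (c1 r + c2 r)) = c"
      using lohi by (auto simp: c1_def c2_def fun_eq_iff field_simps)
    finally show ?thesis .
  qed
qed

text \<open>Moving slightly towards an interpolant with value 0 on \<open>A\<close> and -1 at the
  other zeros of \<open>c\<close> makes those rows negative, while rows that are already negative
  stay so.\<close>

lemma in_cone_imp_feas:
  assumes gp: "genpos N a m" and fin: "finite N" and cN: "m < card N" and AN: "A \<subseteq> N"
    and K: "in_cone m a N A c"
  shows "feas m a A (N - A)"
proof -
  define Z where "Z = {i\<in>N. comb m a c i = 0}"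
  have AZ: "A \<subseteq> Z" and ZN: "Z \<subseteq> N" using K AN by (auto simp: Z_def in_cone_def)
  have neg: "comb m a c i < 0" if "i \<in> N - Z" for i
    using that K by (force simp: Z_def in_cone_def)
  obtain i0 where i0: "comb m a c i0 < 0" using K by (auto simp: in_cone_def)
  have "\<exists>r\<le>m. c r \<noteq> 0" by (rule comb_nonzeroD[of m a c i0]) (use i0 in simp)
  then have cZ: "card Z \<le> m"
    using genpos_card_zeros[OF gp fin ZN, of c] by (auto simp: Z_def)
  then obtain c' where c': "\<forall>i\<in>Z. comb m a c' i = (if i \<in> A then 0 else -1)"
    using genpos_interpolate[OF gp fin _ ZN, of "\<lambda>i. if i \<in> A then 0 else -1"] cN by auto
  have "finite (N - Z)" using fin by simp
  from small_perturbation[OF this, of "comb m a c" "comb m a c'"] neg obtain e where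
    e: "e > 0" "\<forall>i\<in>N - Z. comb m a c i + e * comb m a c' i < 0" by auto
  have comb: "comb m a (\<lambda>r. c r + e * c' r) i = comb m a c i + e * comb m a c' i" for i
    by (simp add: comb_add comb_scale)
  have "comb m a (\<lambda>r. c r + e * c' r) i = 0" if "i \<in> A" for i
    using c' AZ that by (auto simp: comb Z_def)
  moreover have "comb m a (\<lambda>r. c r + e * c' r) i < 0" if "i \<in> N - A" for i
    using c' e that by (cases "i \<in> Z") (auto simp: comb Z_def)
  ultimately show ?thesis unfolding feas_def by blast
qed

section \<open>Edges of the projected cone in the plane\<close>

text \<open>Insertion of one vector at a time. Any planar vectors satisfy
  \<open>det(I,J) L + det(J,L) I + det(L,I) J = 0\<close>. If \<open>L\<close> lies on the wrong
  side of the current extreme vector \<open>I\<close>, then \<open>L\<close> is itself extreme: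
  otherwise some \<open>J\<close> would make all three coefficients nonnegative and two of them
  positive, against pointedness. Exchanging \<open>u\<close> and \<open>v\<close> yields the
  opposite edge.\<close>

lemma planar_extreme:
  fixes u v :: "'a \<Rightarrow> real"
  assumes "finite F" "F \<noteq> {}"
    and pointed: "\<And>I J L x y z. I \<in> F \<Longrightarrow> J \<in> F \<Longrightarrow> L \<in> F \<Longrightarrow> 0 \<le> x \<Longrightarrow> 0 \<le> y \<Longrightarrow> 0 < z \<Longrightarrow>
      x * u I + y * u J + z * u L = 0 \<Longrightarrow> x * v I + y * v J + z * v L = 0 \<Longrightarrow> False"
  shows "\<exists>I\<in>F. \<forall>J\<in>F. 0 \<le> u I * v J - v I * u J"
  using assms
proof (induction F rule: finite_ne_induct)
  case (singleton x)
  then show ?case by simp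
next
  case (insert L F)
  have "\<exists>I\<in>F. \<forall>J\<in>F. 0 \<le> u I * v J - v I * u J"
    by (rule insert.IH) (use insert.prems in blast)
  then obtain I where I: "I \<in> F" "\<And>J. J \<in> F \<Longrightarrow> 0 \<le> u I * v J - v I * u J" by blast
  show ?case
  proof (cases "0 \<le> u I * v L - v I * u L")
    case True
    with I show ?thesis by (intro bexI[of _ I]) auto
  next
    case False
    have "0 \<le> u L * v J - v L * u J" if "J \<in> F" for J
    proof (rule ccontr)
      assume neg: "\<not> ?thesis"
      show False
        by (rule insert.prems[of L I J "u I * v J - v I * u J" "- (u L * v J - v L * u J)"
              "- (u I * v L - v I * u L)"])
          (use I that neg False in \<open>auto simp: algebra_simps\<close>)
    qed
    then show ?thesis by (intro bexI[of _ L]) auto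
  qed
qed

text \<open>A dependency in the first \<open>p\<close> coordinates pairs with functionals only
  through their last two coefficients, so it acts as a linear functional on the plane of the
  projected cone.\<close>

lemma pairing_Suc2:
  assumes "\<And>r. r \<le> p \<Longrightarrow> (\<Sum>i\<in>I. b i * a i r) = 0"
  shows "(\<Sum>i\<in>I. b i * comb (Suc (Suc p)) a c i) =
    c (Suc p) * (\<Sum>i\<in>I. b i * a i (Suc p)) + c (Suc (Suc p)) * (\<Sum>i\<in>I. b i * a i (Suc (Suc p)))"
  unfolding sum_comb using assms by simp

text \<open>Each counted \<open>I\<close> carries a linear functional on the plane of the last two coefficients; it
  vanishes at the direction of the ray of \<open>I\<close> and is negative at the directions of all other
  rays.  Three such directions cannot coexist.\<close>

lemma planar_three:
  fixes u1 u2 u3 v1 v2 v3 :: real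
  assumes "p1 * u1 + q1 * v1 = 0" "p1 * u2 + q1 * v2 < 0" "p1 * u3 + q1 * v3 < 0"
    and "p2 * u2 + q2 * v2 = 0" "p2 * u1 + q2 * v1 < 0" "p2 * u3 + q2 * v3 < 0"
    and "p3 * u3 + q3 * v3 = 0" "p3 * u1 + q3 * v1 < 0" "p3 * u2 + q3 * v2 < 0"
  shows False
proof -
  define x y z where "x = u1 * v2 - v1 * u2" and "y = u2 * v3 - v2 * u3" and "z = u3 * v1 - v3 * u1"
  have id: "y * (p * u1 + q * v1) + z * (p * u2 + q * v2) + x * (p * u3 + q * v3) = 0" for p q
    by (simp add: x_def y_def z_def algebra_simps)
  have x: "x \<noteq> 0"
  proof
    assume "x = 0"
    then have "u1 * (p1 * u2 + q1 * v2) = u2 * (p1 * u1 + q1 * v1)"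
      "v1 * (p1 * u2 + q1 * v2) = v2 * (p1 * u1 + q1 * v1)"
      by (simp_all add: x_def algebra_simps)
    then have "u1 = 0" "v1 = 0" using assms(1,2) by auto
    then show False using assms(5) by simp
  qed
  have z: "z * (p1 * u2 + q1 * v2) = - (x * (p1 * u3 + q1 * v3))"
    using id[of p1 q1] assms(1) by simp
  have y: "y * (p2 * u1 + q2 * v1) = - (x * (p2 * u3 + q2 * v3))"
    using id[of p2 q2] assms(4) by simp
  have yz: "y * (p3 * u1 + q3 * v1) = - (z * (p3 * u2 + q3 * v2))"
    using id[of p3 q3] assms(7) by simp
  \<comment> \<open>In the linear relation \<open>id\<close> among three planar vectors, each
    functional kills one term and is negative on the other two, so every two of \<open>x\<close>,
    \<open>y\<close>, \<open>z\<close> have opposite signs. The product of the three pairwise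
    products would then be negative, but it is a square.\<close>
  have opposite: "x' * z' < 0" if "z' * l = - (x' * l')" "l < 0" "l' < 0" "x' \<noteq> 0" for x' z' l l' :: real
  proof -
    have "(x' * z') * l = x' * (z' * l)" by simp
    also have "\<dots> = - ((x' * x') * l')" unfolding that(1) by simp
    finally have eq: "(x' * z') * l = - ((x' * x') * l')" .
    have "0 < x' * x'" using that(4) by (auto simp: zero_less_mult_iff)
    then have "(x' * x') * l' < 0" using that(3) by (rule mult_pos_neg)
    with eq have "0 < (x' * z') * l" by linarith
    then show ?thesis using that(2) by (auto simp: zero_less_mult_iff)
  qed
  have xz: "x * z < 0" by (rule opposite[OF z assms(2,3) x])
  have xy: "x * y < 0" by (rule opposite[OF y assms(5,6) x])
  have "z \<noteq> 0" using xz by auto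
  then have "z * y < 0" by (rule opposite[OF yz assms(8,9)])
  then have "(x * z) * (x * y) * (z * y) < 0"
    using mult_neg_neg[OF xz xy] by (rule mult_pos_neg[rotated])
  moreover have "(x * z) * (x * y) * (z * y) = (x * y * z)\<^sup>2" by (simp add: power2_eq_square)
  ultimately show False by (metis not_less zero_le_power2)
qed

definition counted :: "nat set \<Rightarrow> nat \<Rightarrow> (nat \<Rightarrow> nat \<Rightarrow> real) \<Rightarrow> nat set \<Rightarrow> nat set set"
  where "counted N p a A = {I. A \<subseteq> I \<and> I \<subseteq> N \<and> card I = Suc (Suc p) \<and>
    feas (Suc (Suc p)) a I (N - I) \<and> possol p a I A}"

lemma finite_counted: "finite N \<Longrightarrow> finite (counted N p a A)"
  by (rule finite_subset[of _ "Pow N"]) (auto simp: counted_def)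

text \<open>\<open>P\<close> and \<open>Q\<close> are the pairings of the positive dependency of
  \<open>I\<close> with the last two columns. Strictness comes from cardinality: another
  \<open>J\<close> of the same size misses some \<open>j\<close> in \<open>I\<close>, which lies
  outside \<open>A\<close> because \<open>A\<close> is contained in \<open>J\<close>, so the weight
  \<open>b j\<close> is positive there.\<close>

lemma counted_functional:
  assumes "finite N" "I \<in> counted N p a A"
  obtains P Q c where "P * c (Suc p) + Q * c (Suc (Suc p)) = 0"
    "\<forall>i\<in>I. comb (Suc (Suc p)) a c i = 0" "\<forall>i\<in>N - I. comb (Suc (Suc p)) a c i < 0"
    "\<And>J c'. J \<in> counted N p a A \<Longrightarrow> J \<noteq> I \<Longrightarrow> \<forall>i\<in>J. comb (Suc (Suc p)) a c' i = 0 \<Longrightarrow>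
      \<forall>i\<in>N - J. comb (Suc (Suc p)) a c' i < 0 \<Longrightarrow> P * c' (Suc p) + Q * c' (Suc (Suc p)) < 0"
proof -
  have I: "A \<subseteq> I" "I \<subseteq> N" "card I = Suc (Suc p)" "feas (Suc (Suc p)) a I (N - I)" "possol p a I A"
    using assms by (auto simp: counted_def)
  have fI: "finite I" using I assms finite_subset by blast
  from I(4) obtain c where c: "\<forall>i\<in>I. comb (Suc (Suc p)) a c i = 0"
    "\<forall>i\<in>N - I. comb (Suc (Suc p)) a c i < 0" unfolding feas_def by blast
  from I(5) obtain b where b: "\<And>r. r \<le> p \<Longrightarrow> (\<Sum>i\<in>I. b i * a i r) = 0" "\<And>i. i \<in> I - A \<Longrightarrow> 0 < b i"
    unfolding possol_def by blast
  define P Q where "P = (\<Sum>i\<in>I. b i * a i (Suc p))" and "Q = (\<Sum>i\<in>I. b i * a i (Suc (Suc p)))"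
  have pair: "P * c (Suc p) + Q * c (Suc (Suc p)) = (\<Sum>i\<in>I. b i * comb (Suc (Suc p)) a c i)" for c
    by (simp add: P_def Q_def pairing_Suc2[OF b(1)] mult.commute)
  have neg: "P * c' (Suc p) + Q * c' (Suc (Suc p)) < 0"
    if J: "J \<in> counted N p a A" "J \<noteq> I" and c': "\<forall>i\<in>J. comb (Suc (Suc p)) a c' i = 0"
      "\<forall>i\<in>N - J. comb (Suc (Suc p)) a c' i < 0" for J c'
  proof -
    have J': "A \<subseteq> J" "J \<subseteq> N" "card J = Suc (Suc p)" using J by (auto simp: counted_def)
    have "\<not> I \<subseteq> J" using J' I J(2) card_subset_eq[of J I] finite_subset[OF J'(2) assms(1)] by auto
    then obtain j where j: "j \<in> I" "j \<notin> J" by blast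
    have "(\<Sum>i\<in>I. b i * comb (Suc (Suc p)) a c' i) < (\<Sum>i\<in>I. 0)"
    proof (rule sum_strict_mono_ex1)
      show "\<forall>i\<in>I. b i * comb (Suc (Suc p)) a c' i \<le> 0"
      proof
        fix i assume "i \<in> I"
        then have "i \<notin> J \<Longrightarrow> 0 < b i \<and> comb (Suc (Suc p)) a c' i < 0"
          using b(2)[of i] c' I J' by blast
        then show "b i * comb (Suc (Suc p)) a c' i \<le> 0"
          using c' by (cases "i \<in> J") (auto intro!: mult_nonneg_nonpos)
      qed
      show "\<exists>i\<in>I. b i * comb (Suc (Suc p)) a c' i < 0"
        using j b(2)[of j] c' I J' by (intro bexI[of _ j] mult_pos_neg; blast)
    qed (use fI in auto)
    then show ?thesis by (simp add: pair)
  qed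
  have "P * c (Suc p) + Q * c (Suc (Suc p)) = 0" using c by (simp add: pair)
  from that[OF this c neg] show thesis .
qed

lemma card_counted_le:
  assumes "finite N"
  shows "card (counted N p a A) \<le> 2"
proof (rule ccontr)
  assume "\<not> ?thesis"
  then have "3 \<le> card (counted N p a A)" by simp
  then obtain T where T: "T \<subseteq> counted N p a A" "card T = 3"
    by (metis obtain_subset_with_card_n)
  then obtain I J L where IJL: "T = {I, J, L}" "I \<noteq> J" "J \<noteq> L" "I \<noteq> L"
    by (auto simp: card_3_iff)
  then have cnt: "I \<in> counted N p a A" "J \<in> counted N p a A" "L \<in> counted N p a A" using T by auto
  obtain P1 Q1 c1 where 1: "P1 * c1 (Suc p) + Q1 * c1 (Suc (Suc p)) = 0"
    "\<forall>i\<in>I. comb (Suc (Suc p)) a c1 i = 0" "\<forall>i\<in>N - I. comb (Suc (Suc p)) a c1 i < 0"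
    "\<And>K c'. K \<in> counted N p a A \<Longrightarrow> K \<noteq> I \<Longrightarrow> \<forall>i\<in>K. comb (Suc (Suc p)) a c' i = 0 \<Longrightarrow>
      \<forall>i\<in>N - K. comb (Suc (Suc p)) a c' i < 0 \<Longrightarrow> P1 * c' (Suc p) + Q1 * c' (Suc (Suc p)) < 0"
    by (rule counted_functional[OF assms cnt(1)]) (rule that; blast)
  obtain P2 Q2 c2 where 2: "P2 * c2 (Suc p) + Q2 * c2 (Suc (Suc p)) = 0"
    "\<forall>i\<in>J. comb (Suc (Suc p)) a c2 i = 0" "\<forall>i\<in>N - J. comb (Suc (Suc p)) a c2 i < 0"
    "\<And>K c'. K \<in> counted N p a A \<Longrightarrow> K \<noteq> J \<Longrightarrow> \<forall>i\<in>K. comb (Suc (Suc p)) a c' i = 0 \<Longrightarrow>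
      \<forall>i\<in>N - K. comb (Suc (Suc p)) a c' i < 0 \<Longrightarrow> P2 * c' (Suc p) + Q2 * c' (Suc (Suc p)) < 0"
    by (rule counted_functional[OF assms cnt(2)]) (rule that; blast)
  obtain P3 Q3 c3 where 3: "P3 * c3 (Suc p) + Q3 * c3 (Suc (Suc p)) = 0"
    "\<forall>i\<in>L. comb (Suc (Suc p)) a c3 i = 0" "\<forall>i\<in>N - L. comb (Suc (Suc p)) a c3 i < 0"
    "\<And>K c'. K \<in> counted N p a A \<Longrightarrow> K \<noteq> L \<Longrightarrow> \<forall>i\<in>K. comb (Suc (Suc p)) a c' i = 0 \<Longrightarrow>
      \<forall>i\<in>N - K. comb (Suc (Suc p)) a c' i < 0 \<Longrightarrow> P3 * c' (Suc p) + Q3 * c' (Suc (Suc p)) < 0"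
    by (rule counted_functional[OF assms cnt(3)]) (rule that; blast)
  show False
    by (rule planar_three[of P1 "c1 (Suc p)" Q1 "c1 (Suc (Suc p))" "c2 (Suc p)" "c2 (Suc (Suc p))"
          "c3 (Suc p)" "c3 (Suc (Suc p))" P2 Q2 P3 Q3])
      (use 1(1) 2(1) 3(1) 1(4)[OF cnt(2) _ 2(2,3)] 1(4)[OF cnt(3) _ 3(2,3)]
        2(4)[OF cnt(1) _ 1(2,3)] 2(4)[OF cnt(3) _ 3(2,3)]
        3(4)[OF cnt(1) _ 1(2,3)] 3(4)[OF cnt(2) _ 2(2,3)] IJL in auto)
qed

text \<open>The ray of a counted \<open>I\<close> lies in the cone of \<open>A\<close>, so
  \<open>A\<close> spans a face in the larger dimension. A face in \<open>p\<close> coordinates is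
  excluded by duality: its functional pairs with \<open>b\<close> to 0, yet the terms in
  \<open>I - A\<close> are negative, and \<open>I - A\<close> is nonempty by cardinality.\<close>

lemma counted_imp:
  assumes fin: "finite N" and cN: "Suc (Suc p) < card N" and cA: "card A \<le> Suc p"
    and gp: "genpos N a (Suc (Suc p))" and cnt: "I \<in> counted N p a A"
  shows "feas (Suc (Suc p)) a A (N - A)" "\<not> feas p a A (N - A)"
proof -
  have I: "A \<subseteq> I" "I \<subseteq> N" "card I = Suc (Suc p)" "feas (Suc (Suc p)) a I (N - I)" "possol p a I A"
    using cnt by (auto simp: counted_def)
  have fI: "finite I" using I assms finite_subset by blast
  have cNI: "card (N - I) > 0" using I cN fI by (simp add: card_Diff_subset)
  then obtain i0 where i0: "i0 \<in> N - I" by (metis card_gt_0_iff ex_in_conv)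
  from I(4) obtain c where c: "\<forall>i\<in>I. comb (Suc (Suc p)) a c i = 0"
    "\<forall>i\<in>N - I. comb (Suc (Suc p)) a c i < 0" unfolding feas_def by blast
  have "comb (Suc (Suc p)) a c i \<le> 0" if "i \<in> N" for i
    using that c by (cases "i \<in> I") (auto intro: less_imp_le)
  then have "in_cone (Suc (Suc p)) a N A c"
    using c I i0 unfolding in_cone_def by blast
  then show "feas (Suc (Suc p)) a A (N - A)"
    using in_cone_imp_feas[OF gp fin cN] I by blast
  from I(5) obtain b where b: "\<And>r. r \<le> p \<Longrightarrow> (\<Sum>i\<in>I. b i * a i r) = 0" "\<And>i. i \<in> I - A \<Longrightarrow> 0 < b i"
    unfolding possol_def by blast
  have "\<not> I \<subseteq> A" using I cA card_mono[of A I] finite_subset[OF I(1) fI] by auto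
  then obtain j where j: "j \<in> I" "j \<notin> A" by blast
  show "\<not> feas p a A (N - A)"
  proof
    assume "feas p a A (N - A)"
    then obtain c' where c': "\<forall>i\<in>A. comb p a c' i = 0" "\<forall>i\<in>N - A. comb p a c' i < 0"
      unfolding feas_def by blast
    have "(\<Sum>i\<in>I. b i * comb p a c' i) < (\<Sum>i\<in>I. 0)"
    proof (rule sum_strict_mono_ex1)
      show "\<forall>i\<in>I. b i * comb p a c' i \<le> 0"
      proof
        fix i assume "i \<in> I"
        then show "b i * comb p a c' i \<le> 0"
          using b(2)[of i] c' I by (cases "i \<in> A") (auto intro!: mult_nonneg_nonpos intro: less_imp_le)
      qed
      show "\<exists>i\<in>I. b i * comb p a c' i < 0"
        using j b(2)[of j] c' I by (intro bexI[of _ j] mult_pos_neg; blast)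
    qed (use fI in auto)
    then show False using b(1) by (simp add: sum_comb)
  qed
qed

text \<open>By \<open>supp\<close> a linear functional of the last two coefficients supports the cone along the ray \<open>c\<close>.
  It is induced by a dependency \<open>b\<close> of the rows \<open>I\<close>, and pushing the ray into the cone in the
  coordinate \<open>i\<close> shows \<open>b i > 0\<close>.\<close>

lemma supporting_dependency:
  assumes m_def: "m = Suc (Suc p)" and fin: "finite N" and cN: "m < card N"
    and gp: "genpos N a m" and gp': "genpos N a p"
    and I: "A \<subseteq> I" "I \<subseteq> N" "card I = m"
    and c: "\<And>i. i \<in> I \<Longrightarrow> comb m a c i = 0" "\<And>i. i \<in> N - I \<Longrightarrow> comb m a c i < 0"
    and nz: "c (Suc p) \<noteq> 0 \<or> c m \<noteq> 0" and s: "s = 1 \<or> s = (-1::real)"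
    and supp: "\<And>c'. in_cone m a N A c' \<Longrightarrow> s * (c m * c' (Suc p) - c (Suc p) * c' m) \<le> 0"
  shows "\<exists>b. (\<forall>r\<le>p. (\<Sum>i\<in>I. b i * a i r) = 0) \<and> (\<Sum>i\<in>I. b i * a i (Suc p)) = s * c m \<and>
    (\<Sum>i\<in>I. b i * a i m) = - s * c (Suc p) \<and> (\<forall>i\<in>I - A. 0 < b i)"
proof -
  have fI: "finite I" using I fin finite_subset by blast
  have "card {..p} < card I" using I by (simp add: m_def)
  from homogeneous_solution[OF _ fI this, of "\<lambda>r i. a i r"] obtain b0 where
    b0: "\<exists>i\<in>I. b0 i \<noteq> 0" "\<And>r. r \<le> p \<Longrightarrow> (\<Sum>i\<in>I. b0 i * a i r) = 0" by auto
  define P Q where "P = (\<Sum>i\<in>I. b0 i * a i (Suc p))" and "Q = (\<Sum>i\<in>I. b0 i * a i m)"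
  have "c (Suc p) * P + c m * Q = (\<Sum>i\<in>I. b0 i * comb m a c i)"
    unfolding m_def P_def Q_def by (rule pairing_Suc2[symmetric, OF b0(2)])
  then have PQ: "c (Suc p) * P + c m * Q = 0" using c(1) by simp
  have "P \<noteq> 0 \<or> Q \<noteq> 0"
  proof (rule ccontr)
    assume "\<not> ?thesis"
    then have "(\<Sum>i\<in>I. b0 i * a i r) = 0" if "r \<le> m" for r
      using b0(2)[of r] that by (cases "r \<le> p") (auto simp: P_def Q_def m_def le_Suc_eq)
    then have "b0 i = 0" if "i \<in> I" for i
      using genpos_orthogonal[OF gp fin _ I(2), of b0 i] that cN I by simp
    then show False using b0(1) by blast
  qed
  \<comment> \<open>In the plane, a vector orthogonal to the nonzero vector
    \<open>(c (Suc p), c m)\<close> is a multiple of that vector turned by a right angle.\<close>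
  obtain t where t: "P = t * c m" "Q = - t * c (Suc p)"
  proof (cases "c m = 0")
    case True
    with nz PQ show thesis by (intro that[of "- Q / c (Suc p)"]) (auto simp: field_simps)
  next
    case False
    with PQ show thesis by (intro that[of "P / c m"]) (auto simp: field_simps)
  qed
  have "t \<noteq> 0" using \<open>P \<noteq> 0 \<or> Q \<noteq> 0\<close> t by auto
  \<comment> \<open>With this scaling, pairing with \<open>b\<close> is exactly the supporting
    functional in \<open>supp\<close>.\<close>
  define b where "b i = s / t * b0 i" for i
  have bsum: "(\<Sum>i\<in>I. b i * f i) = s / t * (\<Sum>i\<in>I. b0 i * f i)" for f
    by (simp add: b_def sum_distrib_left mult.assoc)
  have b1: "(\<Sum>i\<in>I. b i * a i r) = 0" if "r \<le> p" for r using b0(2) that by (simp add: bsum)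
  have b2: "(\<Sum>i\<in>I. b i * a i (Suc p)) = s * c m" "(\<Sum>i\<in>I. b i * a i m) = - s * c (Suc p)"
    using t \<open>t \<noteq> 0\<close> by (simp_all add: bsum P_def[symmetric] Q_def[symmetric])
  have "0 < b i" if i: "i \<in> I - A" for i
  proof -
    obtain c' where c': "\<forall>j\<in>I. comb m a c' j = (if j = i then -1 else 0)"
      using genpos_interpolate[OF gp fin _ I(2), of "\<lambda>j. if j = i then -1 else 0"] cN I by auto
    have "finite (N - I)" using fin by simp
    from small_perturbation[OF this, of "comb m a c" "comb m a c'"] c(2) obtain e where
      e: "e > 0" "\<forall>j\<in>N - I. comb m a c j + e * comb m a c' j < 0" by auto
    define c'' where "c'' = (\<lambda>r. c r + e * c' r)"
    have comb'': "comb m a c'' j = comb m a c j + e * comb m a c' j" for j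
      by (simp add: comb_add comb_scale c''_def)
    have "in_cone m a N A c''"
      unfolding in_cone_def
    proof (intro conjI ballI)
      show "comb m a c'' j = 0" if "j \<in> A" for j
        using that I c(1) c' i by (auto simp: comb'')
      show "comb m a c'' j \<le> 0" if "j \<in> N" for j
        using that c(1) c' e by (cases "j \<in> I") (auto simp: comb'' less_imp_le)
      show "\<exists>j\<in>N. comb m a c'' j < 0"
        using i I c' c(1) e by (intro bexI[of _ i]) (auto simp: comb'')
    qed
    then have "s * (c m * c'' (Suc p) - c (Suc p) * c'' m) \<le> 0" by (rule supp)
    also have "s * (c m * c'' (Suc p) - c (Suc p) * c'' m) = e * (s * (c m * c' (Suc p) - c (Suc p) * c' m))"
      by (simp add: c''_def algebra_simps)
    also have "s * (c m * c' (Suc p) - c (Suc p) * c' m) = (\<Sum>j\<in>I. b j * comb m a c' j)"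
      unfolding m_def by (subst pairing_Suc2[OF b1]) (auto simp: b2[unfolded m_def] algebra_simps)
    also have "\<dots> = (\<Sum>j\<in>I. if j = i then - b i else 0)"
      using c' by (intro sum.cong) auto
    also have "\<dots> = - b i" using i fI by simp
    finally have "0 \<le> b i" using e by (simp add: zero_le_mult_iff)
    \<comment> \<open>If \<open>b i\<close> vanished, the remaining \<open>p + 1\<close> rows would
      be dependent in the columns up to \<open>p\<close>, against general position in
      \<open>p\<close> coordinates.\<close>
    moreover have "b i \<noteq> 0"
    proof
      assume "b i = 0"
      then have "b0 i = 0" using s \<open>t \<noteq> 0\<close> by (auto simp: b_def)
      have "(\<Sum>j\<in>I - {i}. b0 j * a j r) = 0" if "r \<le> p" for r
        using b0(2)[OF that] \<open>b0 i = 0\<close> i fI by (simp add: sum.remove[of I i])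
      then have "b0 j = 0" if "j \<in> I - {i}" for j
        using genpos_orthogonal[OF gp' fin _ _ _ _ that, of b0] I cN i fI by (auto simp: m_def)
      with b0(1) \<open>b0 i = 0\<close> show False by blast
    qed
    ultimately show ?thesis by simp
  qed
  with b1 b2 show ?thesis by blast
qed

text \<open>The two orientations of the plane each produce an extreme ray, and each extreme ray
  carries a supporting dependency that is positive outside \<open>A\<close>.\<close>

lemma counted_two:
  assumes fin: "finite N" and cN: "Suc (Suc p) < card N" and cA: "card A \<le> Suc p" and AN: "A \<subseteq> N"
    and gp: "genpos N a (Suc (Suc p))" and gp': "genpos N a p"
    and F: "feas (Suc (Suc p)) a A (N - A)" and nF: "\<not> feas p a A (N - A)"
  shows "2 \<le> card (counted N p a A)"
proof -
  define m where "m = Suc (Suc p)"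
  note cN = cN[folded m_def] and gp = gp[folded m_def] and F = F[folded m_def]
  define Fac where "Fac = {I. A \<subseteq> I \<and> I \<subseteq> N \<and> card I = m \<and> feas m a I (N - I)}"
  have finFac: "finite Fac" by (rule finite_subset[of _ "Pow N"]) (use fin in \<open>auto simp: Fac_def\<close>)
  have "\<forall>I\<in>Fac. \<exists>c. (\<forall>i\<in>I. comb m a c i = 0) \<and> (\<forall>i\<in>N - I. comb m a c i < 0)"
    by (auto simp: Fac_def feas_def)
  then obtain C where C: "\<And>I i. I \<in> Fac \<Longrightarrow> i \<in> I \<Longrightarrow> comb m a (C I) i = 0"
    "\<And>I i. I \<in> Fac \<Longrightarrow> i \<in> N - I \<Longrightarrow> comb m a (C I) i < 0" by (metis bchoice)
  have nonempty: "\<exists>i. i \<in> N - I" if "I \<in> Fac" for I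
  proof -
    have "I \<subseteq> N" "card I = m" using that by (auto simp: Fac_def)
    then show ?thesis using cN by (metis DiffI less_irrefl subsetI subset_antisym)
  qed
  have C0: "comb m a (C I) i \<le> 0" if "I \<in> Fac" "i \<in> N" for I i
    using C(1)[OF that(1), of i] C(2)[OF that(1), of i] that(2) by fastforce
  have CA: "comb m a (C I) i = 0" if "I \<in> Fac" "i \<in> A" for I i
    using C(1)[OF that(1)] that by (auto simp: Fac_def)
  have coneI: "in_cone m a N A (C I)" if I: "I \<in> Fac" for I
    using C0[OF I] CA[OF I] nonempty[OF I] C(2)[OF I] by (force simp: in_cone_def)
  \<comment> \<open>If both last coefficients were 0, the functional would use only \<open>p\<close>
    coordinates and \<open>A\<close> would already span a face there.\<close>
  have no_zero: "c (Suc p) \<noteq> 0 \<or> c m \<noteq> 0" if "in_cone m a N A c" for c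
  proof (rule ccontr)
    assume "\<not> ?thesis"
    then have "comb m a c i = comb p a c i" for i by (simp add: m_def comb_Suc2)
    with that have "in_cone p a N A c" by (simp add: in_cone_def)
    with in_cone_imp_feas[OF gp' fin _ AN] cN nF show False by (auto simp: m_def)
  qed
  \<comment> \<open>A nonnegative combination of rays with a positive coefficient stays in the cone,
    so by \<open>no_zero\<close> its projection to the plane cannot vanish.\<close>
  have pointed: False
    if "I \<in> Fac" "J \<in> Fac" "L \<in> Fac" "0 \<le> x" "0 \<le> y" "0 < z"
      "x * C I (Suc p) + y * C J (Suc p) + z * C L (Suc p) = 0"
      "x * C I m + y * C J m + z * C L m = 0" for I J L x y z
  proof -
    define c where "c = (\<lambda>r. (x * C I r + y * C J r) + z * C L r)"
    have comb: "comb m a c i = x * comb m a (C I) i + y * comb m a (C J) i + z * comb m a (C L) i" for i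
      by (simp add: c_def comb_add comb_scale)
    obtain i where i: "i \<in> N - L" using nonempty[OF \<open>L \<in> Fac\<close>] by blast
    have le: "x * comb m a (C I) j \<le> 0" "y * comb m a (C J) j \<le> 0" "z * comb m a (C L) j \<le> 0" if "j \<in> N" for j
      using C0 that \<open>I \<in> Fac\<close> \<open>J \<in> Fac\<close> \<open>L \<in> Fac\<close> \<open>0 \<le> x\<close> \<open>0 \<le> y\<close> \<open>0 < z\<close>
      by (auto simp: mult_nonneg_nonpos)
    have "z * comb m a (C L) i < 0" using C(2)[OF \<open>L \<in> Fac\<close> i] \<open>0 < z\<close> by (simp add: mult_pos_neg)
    then have "comb m a c i < 0" using le[of i] i by (simp add: comb)
    moreover have "comb m a c j \<le> 0" if "j \<in> N" for j using le[OF that] by (simp add: comb)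
    moreover have "comb m a c j = 0" if "j \<in> A" for j using CA that \<open>I \<in> Fac\<close> \<open>J \<in> Fac\<close> \<open>L \<in> Fac\<close> by (simp add: comb)
    ultimately have "in_cone m a N A c" using i by (auto simp: in_cone_def)
    from no_zero[OF this] that show False by (simp add: c_def)
  qed
  obtain c0 where c0: "in_cone m a N A c0"
  proof -
    from F obtain c where c: "\<forall>i\<in>A. comb m a c i = 0" "\<forall>i\<in>N - A. comb m a c i < 0"
      unfolding feas_def by blast
    have "card A < card N" using cA cN by (simp add: m_def)
    then obtain i where "i \<in> N - A" by (metis AN Diff_eq_empty_iff ex_in_conv less_irrefl subset_antisym)
    with c have "in_cone m a N A c" unfolding in_cone_def by (metis DiffI order.refl less_imp_le DiffD1)
    then show thesis by (rule that)
  qed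
  have ray: "I \<in> Fac" if "A \<subseteq> I" "I \<subseteq> N" "card I = m" "\<And>i. i \<in> I \<Longrightarrow> comb m a c i = 0"
    "\<And>i. i \<in> N - I \<Longrightarrow> comb m a c i < 0" for I c
    using that unfolding Fac_def feas_def by blast
  have "Fac \<noteq> {}"
    by (rule in_cone_induct[OF gp fin cN AN _ _ c0, of "\<lambda>_. Fac \<noteq> {}"]) (use ray in blast)+
  text \<open>The ray of \<open>I\<close> is determined up to a positive factor, so a functional that is
    nonpositive on all \<open>C I\<close> is nonpositive on the cone.\<close>
  have unique_ray: "\<exists>t>0. \<forall>r\<le>m. c r = t * C I r" if I: "I \<in> Fac" and c: "\<And>i. i \<in> I \<Longrightarrow> comb m a c i = 0"
    "\<And>i. i \<in> N - I \<Longrightarrow> comb m a c i < 0" for I c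
  proof -
    obtain i where i: "i \<in> N - I" using nonempty[OF I] by blast
    define t where "t = comb m a c i / comb m a (C I) i"
    have "t > 0" using C(2)[OF I i] c(2)[OF i] by (simp add: t_def divide_neg_neg)
    moreover have "c r = t * C I r" if "r \<le> m" for r
    proof (rule ccontr)
      assume ne: "c r \<noteq> t * C I r"
      have IN: "I \<subseteq> N" "card I = m" using \<open>I \<in> Fac\<close> by (auto simp: Fac_def)
      have fI: "finite I" using IN fin finite_subset by blast
      have "card (insert i I) \<le> m"
      proof (rule genpos_card_zeros[OF gp fin _ _ that])
        show "insert i I \<subseteq> N" using i IN by auto
        show "comb m a (\<lambda>r. c r - t * C I r) j = 0" if "j \<in> insert i I" for j
        proof -
          have "t * comb m a (C I) i = comb m a c i" using C(2)[OF I i] by (simp add: t_def)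
          then show ?thesis
            using that C(1)[OF I, of j] c(1) by (auto simp: comb_diff comb_scale)
        qed
      qed (use ne in simp)
      then show False using i IN fI by simp
    qed
    ultimately show ?thesis by blast
  qed
  have functional: "x * c (Suc p) + y * c m \<le> 0"
    if le: "\<And>I. I \<in> Fac \<Longrightarrow> x * C I (Suc p) + y * C I m \<le> 0" and K: "in_cone m a N A c" for x y c
  proof (rule in_cone_induct[OF gp fin cN AN _ _ K])
    fix I c
    assume I: "A \<subseteq> I" "I \<subseteq> N" "card I = m" "\<And>i. i \<in> I \<Longrightarrow> comb m a c i = 0"
      "\<And>i. i \<in> N - I \<Longrightarrow> comb m a c i < 0"
    then have "I \<in> Fac" by (rule ray)
    from unique_ray[OF this I(4,5)] obtain t where t: "t > 0" "\<And>r. r \<le> m \<Longrightarrow> c r = t * C I r" by blast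
    have "x * c (Suc p) + y * c m = t * (x * C I (Suc p) + y * C I m)"
      using t(2)[of "Suc p"] t(2)[of m] by (simp add: m_def algebra_simps)
    also have "\<dots> \<le> 0" using le[OF \<open>I \<in> Fac\<close>] t(1) by (simp add: mult_nonneg_nonpos)
    finally show "x * c (Suc p) + y * c m \<le> 0" .
  next
    fix c c' :: "nat \<Rightarrow> real" and s :: real
    assume "x * c (Suc p) + y * c m \<le> 0" "x * c' (Suc p) + y * c' m \<le> 0" "0 < s"
    then have "s * ((x * c (Suc p) + y * c m) + (x * c' (Suc p) + y * c' m)) \<le> 0"
      by (simp add: mult_nonneg_nonpos)
    then show "x * (s * (c (Suc p) + c' (Suc p))) + y * (s * (c m + c' m)) \<le> 0"
      by (simp add: algebra_simps)
  qed
  have dep: "\<exists>b. (\<forall>r\<le>p. (\<Sum>i\<in>I. b i * a i r) = 0) \<and> (\<Sum>i\<in>I. b i * a i (Suc p)) = s * C I m \<and>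
    (\<Sum>i\<in>I. b i * a i m) = - s * C I (Suc p) \<and> (\<forall>i\<in>I - A. 0 < b i)"
    if I: "I \<in> Fac" and s: "s = 1 \<or> s = -1"
      and ext: "\<And>J. J \<in> Fac \<Longrightarrow> s * (C I m * C J (Suc p) - C I (Suc p) * C J m) \<le> 0" for I s
  proof (rule supporting_dependency[OF m_def fin cN gp gp' _ _ _ C(1)[OF I] C(2)[OF I] no_zero[OF coneI[OF I]] s])
    show "A \<subseteq> I" "I \<subseteq> N" "card I = m" using I by (auto simp: Fac_def)
    fix c' assume K: "in_cone m a N A c'"
    have "(s * C I m) * c' (Suc p) + (- s * C I (Suc p)) * c' m \<le> 0"
      by (rule functional[OF _ K]) (use ext in \<open>simp add: algebra_simps\<close>)
    then show "s * (C I m * c' (Suc p) - C I (Suc p) * c' m) \<le> 0" by (simp add: algebra_simps)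
  qed
  obtain I where I: "I \<in> Fac" "\<forall>J\<in>Fac. 0 \<le> C I (Suc p) * C J m - C I m * C J (Suc p)"
    using planar_extreme[OF finFac \<open>Fac \<noteq> {}\<close>, of "\<lambda>I. C I (Suc p)" "\<lambda>I. C I m"] pointed by blast
  obtain I' where I': "I' \<in> Fac" "\<forall>J\<in>Fac. 0 \<le> C I' m * C J (Suc p) - C I' (Suc p) * C J m"
    using planar_extreme[OF finFac \<open>Fac \<noteq> {}\<close>, of "\<lambda>I. C I m" "\<lambda>I. C I (Suc p)"] pointed by blast
  have "\<exists>b. (\<forall>r\<le>p. (\<Sum>i\<in>I. b i * a i r) = 0) \<and> (\<Sum>i\<in>I. b i * a i (Suc p)) = 1 * C I m \<and>
    (\<Sum>i\<in>I. b i * a i m) = - 1 * C I (Suc p) \<and> (\<forall>i\<in>I - A. 0 < b i)"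
    by (rule dep[OF I(1)]) (use I(2) in \<open>auto simp: algebra_simps\<close>)
  then obtain b where b: "\<And>r. r \<le> p \<Longrightarrow> (\<Sum>i\<in>I. b i * a i r) = 0" "(\<Sum>i\<in>I. b i * a i (Suc p)) = C I m"
     "(\<Sum>i\<in>I. b i * a i m) = - C I (Suc p)" "\<forall>i\<in>I - A. 0 < b i" by auto
  have "\<exists>b. (\<forall>r\<le>p. (\<Sum>i\<in>I'. b i * a i r) = 0) \<and> (\<Sum>i\<in>I'. b i * a i (Suc p)) = (-1) * C I' m \<and>
    (\<Sum>i\<in>I'. b i * a i m) = - (-1) * C I' (Suc p) \<and> (\<forall>i\<in>I' - A. 0 < b i)"
    by (rule dep[OF I'(1)]) (use I'(2) in \<open>auto simp: algebra_simps\<close>)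
  then obtain b' where b': "\<And>r. r \<le> p \<Longrightarrow> (\<Sum>i\<in>I'. b' i * a i r) = 0" "(\<Sum>i\<in>I'. b' i * a i (Suc p)) = - C I' m"
     "(\<Sum>i\<in>I'. b' i * a i m) = C I' (Suc p)" "\<forall>i\<in>I' - A. 0 < b' i" by auto
  \<comment> \<open>The two supporting functionals are opposite on a common ray, so
    \<open>b + b'\<close> would be orthogonal to all columns up to \<open>m\<close>; independence of
    the \<open>m\<close> rows contradicts its positivity outside \<open>A\<close>.\<close>
  have "I \<noteq> I'"
  proof
    assume eq: "I = I'"
    have I0: "A \<subseteq> I" "I \<subseteq> N" "card I = m" using I by (auto simp: Fac_def)
    have fI: "finite I" using I0 fin finite_subset by blast
    have "\<not> I \<subseteq> A" using I0 cA card_mono[of A I] finite_subset[OF I0(1) fI] by (auto simp: m_def)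
    then obtain j where j: "j \<in> I - A" by blast
    have "(\<Sum>i\<in>I. (b i + b' i) * a i r) = 0" if "r \<le> m" for r
      using that b(1)[of r] b'(1)[of r] b(2,3) b'(2,3)
      by (cases "r \<le> p") (auto simp: eq m_def le_Suc_eq distrib_right sum.distrib)
    then have "b j + b' j = 0"
      using genpos_orthogonal[OF gp fin _ I0(2), of "\<lambda>i. b i + b' i" j] cN I0 j by auto
    moreover have "0 < b j" "0 < b' j" using j b(4) b'(4) eq by auto
    ultimately show False by simp
  qed
  moreover have "I \<in> counted N p a A" "I' \<in> counted N p a A"
    using I(1) I'(1) b b' by (auto simp: counted_def Fac_def m_def possol_def)
  ultimately have "card {I, I'} \<le> card (counted N p a A)"
    by (intro card_mono finite_counted fin) auto
  then show ?thesis using \<open>I \<noteq> I'\<close> by simp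
qed

lemma card_counted:
  assumes "finite N" "Suc (Suc p) < card N" "card A \<le> Suc p" "A \<subseteq> N"
    and "genpos N a (Suc (Suc p))" "genpos N a p"
  shows "card (counted N p a A) =
    (if feas (Suc (Suc p)) a A (N - A) \<and> \<not> feas p a A (N - A) then 2 else 0)"
proof (cases "feas (Suc (Suc p)) a A (N - A) \<and> \<not> feas p a A (N - A)")
  case True
  then show ?thesis
    using counted_two[OF assms] card_counted_le[OF assms(1), of p a A] by simp
next
  case False
  then have "counted N p a A = {}"
    using counted_imp[OF assms(1,2,3,5)] by blast
  with False show ?thesis by auto
qed

lemma feas_mono: "p \<le> m \<Longrightarrow> feas p a A S \<Longrightarrow> feas m a A S"
  unfolding feas_def
proof (elim exE)
  fix c assume "p \<le> m" and c: "(\<forall>i\<in>A. comb p a c i = 0) \<and> (\<forall>i\<in>S. comb p a c i < 0)"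
  then have "comb m a (\<lambda>r. if r \<le> p then c r else 0) i = comb p a c i" for i
    unfolding comb_def by (intro sum.mono_neutral_cong_right) auto
  with c show "\<exists>c. (\<forall>i\<in>A. comb m a c i = 0) \<and> (\<forall>i\<in>S. comb m a c i < 0)"
    by (intro exI[of _ "\<lambda>r. if r \<le> p then c r else 0"]) simp
qed

section \<open>Uniqueness of Gaussian laws\<close>

text \<open>The total mass is the transform at 0, so both measures can be rescaled to probability
  measures by the same constant; mass 0 is treated apart. Finite measures are needed because the
  later induction restricts to events.\<close>

lemma Levy_uniqueness_finite:
  fixes M1 M2 :: "real measure"
  assumes fin: "finite_measure M1" "finite_measure M2" and sets: "sets M1 = sets borel" "sets M2 = sets borel"
    and eq: "\<And>t. (CLINT x|M1. iexp (t * x)) = (CLINT x|M2. iexp (t * x))"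
  shows "M1 = M2"
proof -
  interpret M1: finite_measure M1 by fact
  interpret M2: finite_measure M2 by fact
  note [measurable_cong] = sets
  define c where "c = measure M1 (space M1)"
  have c2: "c = measure M2 (space M2)"
    using eq[of 0] by (simp add: c_def)
  have em: "emeasure M1 (space M1) = ennreal c" "emeasure M2 (space M2) = ennreal c"
    using M1.emeasure_eq_measure M2.emeasure_eq_measure c_def c2 by auto
  show ?thesis
  proof (cases "c = 0")
    case True
    have "emeasure M1 A = emeasure M2 A" for A
      using emeasure_space[of M1 A] emeasure_space[of M2 A] em True by simp
    then show ?thesis by (intro measure_eqI) (auto simp: sets)
  next
    case False
    then have c: "c > 0" by (simp add: c_def order_less_le)
    define D where "D = (\<lambda>M :: real measure. density M (\<lambda>_. ennreal (1 / c)))"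
    have D: "real_distribution (D M)" "char (D M) t = (1 / c) *\<^sub>R (CLINT x|M. iexp (t * x))"
      if [measurable_cong]: "sets M = sets borel" and "emeasure M (space M) = ennreal c" for M t
    proof -
      have spM [simp]: "space M = UNIV" using sets_eq_imp_space_eq[OF that(1)] by simp

      have "emeasure (D M) (space (D M)) = ennreal (1 / c) * ennreal c"
        unfolding D_def by (subst emeasure_density) (use that(2) in \<open>auto simp: nn_integral_cmult_indicator\<close>)
      also have "\<dots> = 1" using c by (simp add: ennreal_mult[symmetric])
      finally have "prob_space (D M)" by (rule prob_spaceI)
      then show "real_distribution (D M)"
        unfolding real_distribution_def real_distribution_axioms_def by (simp add: D_def that)
      show "char (D M) t = (1 / c) *\<^sub>R (CLINT x|M. iexp (t * x))"
        unfolding char_def D_def using c by (subst integral_density) (auto simp: that)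
    qed
    have "D M1 = D M2"
      using D[OF sets(1) em(1)] D[OF sets(2) em(2)] eq by (intro Levy_uniqueness) (auto simp: fun_eq_iff)
    have rescale: "density (D M) (\<lambda>_. ennreal c) = M" for M
      unfolding D_def using c by (subst density_density_eq) (auto simp: ennreal_mult[symmetric] density_1)
    show ?thesis using rescale[of M1] rescale[of M2] \<open>D M1 = D M2\<close> by metis
  qed
qed

lemma finite_measure_density_bounded:
  assumes "finite_measure M" and [measurable]: "f \<in> borel_measurable M" and f: "\<And>x. f x \<le> ennreal C"
  shows "finite_measure (density M f)"
proof (rule finite_measureI)
  interpret finite_measure M by fact
  have "emeasure (density M f) (space M) = (\<integral>\<^sup>+ x. f x \<partial>M)"
    by (simp add: emeasure_density)
  also have "\<dots> \<le> (\<integral>\<^sup>+ x. ennreal C \<partial>M)" by (intro nn_integral_mono f)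
  also have "\<dots> = ennreal C * emeasure M (space M)" by simp
  also have "\<dots> < \<infinity>"
  proof -
    have "emeasure M (space M) < top"
      using emeasure_finite[of "space M"] unfolding less_top infinity_ennreal_def .
    then show ?thesis by (simp add: ennreal_mult_less_top)
  qed
  finally show "emeasure (density M f) (space (density M f)) \<noteq> \<infinity>" by simp
qed

text \<open>The weights are absorbed into the measures before passing to the laws of
  \<open>X\<close> and \<open>Y\<close>. The bound 2 is that of \<open>1 + cos\<close> and
  \<open>1 + sin\<close>, the nonnegative weights through which the other coordinates will
  enter.\<close>

lemma weighted_char_unique:
  fixes X :: "'a \<Rightarrow> real" and Y :: "'b \<Rightarrow> real"
  assumes fin: "finite_measure M" "finite_measure N"
    and [measurable]: "X \<in> borel_measurable M" "Y \<in> borel_measurable N" "B \<in> sets borel"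
      "w \<in> borel_measurable M" "v \<in> borel_measurable N"
    and w: "\<And>x. 0 \<le> w x" "\<And>x. w x \<le> 2" and v: "\<And>x. 0 \<le> v x" "\<And>x. v x \<le> (2::real)"
    and eq: "\<And>s. (CLINT x|M. w x *\<^sub>R iexp (s * X x)) = (CLINT x|N. v x *\<^sub>R iexp (s * Y x))"
  shows "(LINT x|M. w x * indicator B (X x)) = (LINT x|N. v x * indicator B (Y x))"
proof -
  define D where "D = distr (density M (\<lambda>x. ennreal (w x))) borel X"
  define E where "E = distr (density N (\<lambda>x. ennreal (v x))) borel Y"
  interpret M: finite_measure M by fact
  interpret N: finite_measure N by fact
  have D: "finite_measure D"
    unfolding D_def
    by (rule finite_measure.finite_measure_distr[OF finite_measure_density_bounded[OF fin(1), of _ 2]])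
      (use w in \<open>auto simp flip: ennreal_numeral intro: ennreal_leI\<close>)
  have E: "finite_measure E"
    unfolding E_def
    by (rule finite_measure.finite_measure_distr[OF finite_measure_density_bounded[OF fin(2), of _ 2]])
      (use v in \<open>auto simp flip: ennreal_numeral intro: ennreal_leI\<close>)
  have "(CLINT x|D. iexp (t * x)) = (CLINT x|E. iexp (t * x))" for t
    unfolding D_def E_def using w v eq[of t]
    by (simp add: integral_distr integral_density)
  then have "D = E" by (intro Levy_uniqueness_finite D E) (auto simp: D_def E_def)
  moreover have "(LINT x|D. indicator B x) = (LINT x|M. w x * indicator B (X x))"
    unfolding D_def using w by (subst integral_distr) (auto simp: integral_density simp del: integral_indicator)
  moreover have "(LINT x|E. indicator B x) = (LINT x|N. v x * indicator B (Y x))"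
    unfolding E_def using v by (subst integral_distr) (auto simp: integral_density simp del: integral_indicator)
  ultimately show ?thesis by simp
qed

text \<open>Reduction of the multivariate statement to one dimension. Restricting both measures to
  the event that coordinate \<open>j\<close> lies in \<open>B j\<close> must preserve equality of
  the transforms of the remaining coordinates. For fixed frequencies of these, their cosine and sine
  act as weights for the one-dimensional uniqueness in coordinate \<open>j\<close>.\<close>

lemma char_unique_box:
  fixes M :: "'a measure" and N :: "'b measure" and X :: "'i \<Rightarrow> 'a \<Rightarrow> real" and Y :: "'i \<Rightarrow> 'b \<Rightarrow> real"
  assumes "finite J" "finite_measure M" "finite_measure N"
    and "\<And>j. j \<in> J \<Longrightarrow> X j \<in> borel_measurable M" "\<And>j. j \<in> J \<Longrightarrow> Y j \<in> borel_measurable N"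
    and "\<And>t. (CLINT x|M. iexp (\<Sum>j\<in>J. t j * X j x)) = (CLINT x|N. iexp (\<Sum>j\<in>J. t j * Y j x))"
    and "\<And>j. j \<in> J \<Longrightarrow> B j \<in> sets borel"
  shows "measure M {x\<in>space M. \<forall>j\<in>J. X j x \<in> B j} = measure N {x\<in>space N. \<forall>j\<in>J. Y j x \<in> B j}"
  using assms
proof (induction J arbitrary: M N rule: finite_induct)
  case empty
  from empty.prems(5)[of "\<lambda>_. 0"] show ?case by simp
next
  case (insert j J)
  interpret M: finite_measure M by fact
  interpret N: finite_measure N by fact
  have [measurable]: "X j \<in> borel_measurable M" "Y j \<in> borel_measurable N" "B j \<in> sets borel"
    using insert.prems by auto
  have XJ[measurable]: "\<And>i. i \<in> J \<Longrightarrow> X i \<in> borel_measurable M" "\<And>i. i \<in> J \<Longrightarrow> Y i \<in> borel_measurable N"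
    using insert.prems by auto
  have [measurable]: "\<And>i. i \<in> J \<Longrightarrow> B i \<in> sets borel" using insert.prems by auto
  have [simp]: "j \<notin> J" "finite J" using insert by auto
  define M' where "M' = density M (\<lambda>x. indicator (B j) (X j x))"
  define N' where "N' = density N (\<lambda>x. indicator (B j) (Y j x))"
  have fM': "finite_measure M'"
    unfolding M'_def
    by (rule finite_measure_density_bounded[of _ _ 1]) (auto simp: insert.prems indicator_def)
  have fN': "finite_measure N'"
    unfolding N'_def
    by (rule finite_measure_density_bounded[of _ _ 1]) (auto simp: insert.prems indicator_def)
  have eq: "(CLINT x|M'. iexp (\<Sum>i\<in>J. t i * X i x)) = (CLINT x|N'. iexp (\<Sum>i\<in>J. t i * Y i x))" for t
  proof -
    define f where "f x = (\<Sum>i\<in>J. t i * X i x)" for x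
    define g where "g x = (\<Sum>i\<in>J. t i * Y i x)" for x
    have [measurable]: "f \<in> borel_measurable M" "g \<in> borel_measurable N"
      unfolding f_def g_def by (auto intro!: borel_measurable_sum)
    have base: "(CLINT x|M. iexp (s * X j x + r * f x)) = (CLINT x|N. iexp (s * Y j x + r * g x))" for s r
    proof -
      have "(CLINT x|M. iexp (\<Sum>i\<in>insert j J. (if i = j then s else r * t i) * X i x)) =
        (CLINT x|N. iexp (\<Sum>i\<in>insert j J. (if i = j then s else r * t i) * Y i x))"
        by (rule insert.prems(5))
      moreover have "(\<Sum>i\<in>insert j J. (if i = j then s else r * t i) * Z i) = s * Z j + r * (\<Sum>i\<in>J. t i * Z i)" for Z :: "'i \<Rightarrow> real"
      proof -
        have "(\<Sum>i\<in>J. (if i = j then s else r * t i) * Z i) = (\<Sum>i\<in>J. r * (t i * Z i))"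
          by (intro sum.cong) auto
        then show ?thesis by (simp add: sum_distrib_left)
      qed
      ultimately show ?thesis unfolding f_def g_def by simp
    qed
    have intM: "integrable M (\<lambda>x. iexp (s * X j x + r * f x))" for s r
      by (rule M.integrable_const_bound[where B = 1]) auto
    have intN: "integrable N (\<lambda>x. iexp (s * Y j x + r * g x))" for s r
      by (rule N.integrable_const_bound[where B = 1]) auto
    \<comment> \<open>Euler's formulas turn the weighted transforms into joint transforms at
      frequencies 0, 1 and -1 of the second variable, which agree by \<open>base\<close>. The added
      1 makes the weights nonnegative and is subtracted again through \<open>one\<close>.\<close>
    have expand: "(1 + cos y) *\<^sub>R iexp z = iexp (z + 0 * y) + (1/2) * iexp (z + 1 * y) + (1/2) * iexp (z + (-1) * y)"
      "(1 + sin y) *\<^sub>R iexp z = iexp (z + 0 * y) + (-\<i>/2) * iexp (z + 1 * y) + (\<i>/2) * iexp (z + (-1) * y)" for y z :: real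
      by (simp_all add: complex_eq_iff Re_exp Im_exp cos_add cos_diff sin_add sin_diff field_simps)
    have c: "(CLINT x|M. (1 + cos (f x)) *\<^sub>R iexp (s * X j x)) = (CLINT x|N. (1 + cos (g x)) *\<^sub>R iexp (s * Y j x))"
      and s: "(CLINT x|M. (1 + sin (f x)) *\<^sub>R iexp (s * X j x)) = (CLINT x|N. (1 + sin (g x)) *\<^sub>R iexp (s * Y j x))" for s
      unfolding expand by (simp_all only: intM intN base Bochner_Integration.integral_add Bochner_Integration.integrable_add
          integral_mult_right_zero integrable_mult_right)
    have one: "(LINT x|M. 1 * indicator (B j) (X j x)) = (LINT x|N. 1 * indicator (B j) (Y j x) :: real)"
      using base[of _ 0] by (intro weighted_char_unique insert.prems) auto
    have b1: "0 \<le> 1 + cos y" "1 + cos y \<le> 2" "0 \<le> 1 + sin y" "1 + sin y \<le> 2" for y :: real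
      using cos_ge_minus_one[of y] sin_ge_minus_one[of y] cos_le_one[of y] sin_le_one[of y] by linarith+
    have cosB: "(LINT x|M. (1 + cos (f x)) * indicator (B j) (X j x)) = (LINT x|N. (1 + cos (g x)) * indicator (B j) (Y j x))"
      using c b1 by (intro weighted_char_unique insert.prems) auto
    have sinB: "(LINT x|M. (1 + sin (f x)) * indicator (B j) (X j x)) = (LINT x|N. (1 + sin (g x)) * indicator (B j) (Y j x))"
      using s b1 by (intro weighted_char_unique insert.prems) auto
    have i1: "integrable M (\<lambda>x. indicator (B j) (X j x) :: real)" "integrable N (\<lambda>x. indicator (B j) (Y j x) :: real)"
      by (auto intro!: M.integrable_const_bound[where B = 1] N.integrable_const_bound[where B = 1])
    have i2: "integrable M (\<lambda>x. cos (f x) * indicator (B j) (X j x))" "integrable N (\<lambda>x. cos (g x) * indicator (B j) (Y j x))"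
      "integrable M (\<lambda>x. sin (f x) * indicator (B j) (X j x))" "integrable N (\<lambda>x. sin (g x) * indicator (B j) (Y j x))"
      by (auto intro!: M.integrable_const_bound[where B = 1] N.integrable_const_bound[where B = 1] simp: indicator_def)
    have cosB': "(LINT x|M. cos (f x) * indicator (B j) (X j x)) = (LINT x|N. cos (g x) * indicator (B j) (Y j x))"
      using cosB one i1 i2 by (simp add: distrib_right)
    have sinB': "(LINT x|M. sin (f x) * indicator (B j) (X j x)) = (LINT x|N. sin (g x) * indicator (B j) (Y j x))"
      using sinB one i1 i2 by (simp add: distrib_right)
    have dec: "indicator S y *\<^sub>R iexp z = complex_of_real (cos z * indicator S y) + \<i> * complex_of_real (sin z * indicator S y)"
      for S :: "real set" and y z by (simp add: complex_eq_iff Re_exp Im_exp)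
    have "(CLINT x|M'. iexp (f x)) = (CLINT x|M. indicator (B j) (X j x) *\<^sub>R iexp (f x))"
      unfolding M'_def by (subst integral_density[symmetric]) (auto simp: indicator_def intro!: arg_cong2[where f="\<lambda>x y. integral\<^sup>L x y"] density_cong)
    also have "\<dots> = complex_of_real (LINT x|M. cos (f x) * indicator (B j) (X j x)) + \<i> * complex_of_real (LINT x|M. sin (f x) * indicator (B j) (X j x))"
      unfolding dec using i2 by (simp del: of_real_mult)
    also have "\<dots> = complex_of_real (LINT x|N. cos (g x) * indicator (B j) (Y j x)) + \<i> * complex_of_real (LINT x|N. sin (g x) * indicator (B j) (Y j x))"
      by (simp only: cosB' sinB')
    also have "\<dots> = (CLINT x|N. indicator (B j) (Y j x) *\<^sub>R iexp (g x))"
      unfolding dec using i2 by (simp del: of_real_mult)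
    also have "\<dots> = (CLINT x|N'. iexp (g x))"
      unfolding N'_def by (subst integral_density[symmetric]) (auto simp: indicator_def intro!: arg_cong2[where f="\<lambda>x y. integral\<^sup>L x y"] density_cong)
    finally show ?thesis by (simp add: f_def g_def)
  qed
  have "measure M' {x\<in>space M'. \<forall>i\<in>J. X i x \<in> B i} = measure N' {x\<in>space N'. \<forall>i\<in>J. Y i x \<in> B i}"
    by (rule insert.IH[OF fM' fN' _ _ eq]) (use insert.prems in \<open>auto simp: M'_def N'_def\<close>)
  moreover have "measure M' {x\<in>space M'. \<forall>i\<in>J. X i x \<in> B i} = measure M {x\<in>space M. \<forall>i\<in>insert j J. X i x \<in> B i}"
  proof -
    have "emeasure M' {x\<in>space M'. \<forall>i\<in>J. X i x \<in> B i} = emeasure M {x\<in>space M. \<forall>i\<in>insert j J. X i x \<in> B i}"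
      unfolding M'_def
      by (subst emeasure_density) (auto simp flip: nn_integral_indicator intro!: nn_integral_cong simp: indicator_def)
    then show ?thesis by (simp add: measure_def)
  qed
  moreover have "measure N' {x\<in>space N'. \<forall>i\<in>J. Y i x \<in> B i} = measure N {x\<in>space N. \<forall>i\<in>insert j J. Y i x \<in> B i}"
  proof -
    have "emeasure N' {x\<in>space N'. \<forall>i\<in>J. Y i x \<in> B i} = emeasure N {x\<in>space N. \<forall>i\<in>insert j J. Y i x \<in> B i}"
      unfolding N'_def
      by (subst emeasure_density) (auto simp flip: nn_integral_indicator intro!: nn_integral_cong simp: indicator_def)
    then show ?thesis by (simp add: measure_def)
  qed
  ultimately show ?case by simp
qed

lemma law_eqI:
  fixes X :: "'i \<Rightarrow> 'a \<Rightarrow> real" and Y :: "'i \<Rightarrow> 'b \<Rightarrow> real"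
  assumes "finite J" "prob_space M" "prob_space N"
    and [measurable]: "\<And>j. j \<in> J \<Longrightarrow> X j \<in> borel_measurable M" "\<And>j. j \<in> J \<Longrightarrow> Y j \<in> borel_measurable N"
    and "\<And>t. (CLINT x|M. iexp (\<Sum>j\<in>J. t j * X j x)) = (CLINT x|N. iexp (\<Sum>j\<in>J. t j * Y j x))"
  shows "distr M (PiM J (\<lambda>_. borel)) (\<lambda>x. \<lambda>j\<in>J. X j x) = distr N (PiM J (\<lambda>_. borel)) (\<lambda>x. \<lambda>j\<in>J. Y j x)"
    (is "?P = ?Q")
proof (rule measure_eqI_PiM_finite[OF assms(1)])
  interpret M: prob_space M by fact
  interpret N: prob_space N by fact
  fix B :: "'i \<Rightarrow> real set"
  assume B[measurable]: "\<And>i. i \<in> J \<Longrightarrow> B i \<in> sets borel"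
  have PB: "Pi\<^sub>E J B \<in> sets (PiM J (\<lambda>_. borel))" using assms(1) B by (rule sets_PiM_I_finite)
  have "measure M {x\<in>space M. \<forall>j\<in>J. X j x \<in> B j} = measure N {x\<in>space N. \<forall>j\<in>J. Y j x \<in> B j}"
    by (rule char_unique_box[OF assms(1) M.finite_measure_axioms N.finite_measure_axioms assms(4-6) B])
  moreover have "?P (Pi\<^sub>E J B) = emeasure M {x\<in>space M. \<forall>j\<in>J. X j x \<in> B j}"
    using PB by (subst emeasure_distr) (auto intro!: arg_cong[where f = "emeasure M"] simp: PiE_iff)
  moreover have "?Q (Pi\<^sub>E J B) = emeasure N {x\<in>space N. \<forall>j\<in>J. Y j x \<in> B j}"
    using PB by (subst emeasure_distr) (auto intro!: arg_cong[where f = "emeasure N"] simp: PiE_iff)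
  ultimately show "?P (Pi\<^sub>E J B) = ?Q (Pi\<^sub>E J B)"
    by (simp add: M.emeasure_eq_measure N.emeasure_eq_measure)
next
  show "range (\<lambda>_. space (PiM J (\<lambda>_. borel :: real measure))) \<subseteq> prod_algebra J (\<lambda>_. borel)"
    using assms(1) by (auto simp: space_PiM intro!: prod_algebraI_finite)
  interpret P: prob_space ?P by (rule prob_space.prob_space_distr[OF assms(2)]) simp
  show "emeasure ?P (space (PiM J (\<lambda>_. borel))) \<noteq> \<infinity>" by simp
qed auto

section \<open>Standard Gaussian product measures and their linear images\<close>

abbreviation "std_normal \<equiv> density lborel (\<lambda>x. ennreal (std_normal_density x))"

definition gauss :: "'i set \<Rightarrow> ('i \<Rightarrow> real) measure"
  where "gauss J = PiM J (\<lambda>_. std_normal)"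

lemma prob_space_std_normal: "prob_space std_normal"
  by (rule prob_space_normal_density) simp

lemma prob_space_gauss: "prob_space (gauss J)"
  unfolding gauss_def by (intro prob_space_PiM prob_space_std_normal)

lemma sets_gauss [measurable_cong, simp]: "sets (gauss J) = sets (PiM J (\<lambda>_. borel))"
  unfolding gauss_def by (intro sets_PiM_cong) auto

lemma space_gauss: "space (gauss J) = PiE J (\<lambda>_. UNIV)"
  unfolding gauss_def by (simp add: space_PiM)

lemma product_prob_std_normal: "product_prob_space (\<lambda>_. std_normal)"
  by (intro product_prob_spaceI prob_space_std_normal)

lemma gauss_component [measurable]: "j \<in> J \<Longrightarrow> (\<lambda>x. x j) \<in> borel_measurable (gauss J)"
  using measurable_component_singleton[of j J "\<lambda>_. borel"] by (simp cong: measurable_cong_sets)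

lemma char_gauss:
  assumes "finite J"
  shows "(CLINT x|gauss J. iexp (\<Sum>j\<in>J. t j * x j)) = exp (- (\<Sum>j\<in>J. (t j)\<^sup>2) / 2)"
proof -
  interpret product_prob_space "\<lambda>_. std_normal" by (rule product_prob_std_normal)
  have std: "(CLINT x|std_normal. iexp (s * x)) = exp (- (s\<^sup>2) / 2)" for s
    using char_std_normal_distribution unfolding char_def fun_eq_iff by simp
  have int: "integrable std_normal (\<lambda>x. iexp (s * x))" for s
    by (rule finite_measure.integrable_const_bound[OF prob_space.finite_measure[OF prob_space_std_normal], where B = 1]) auto
  have "(CLINT x|gauss J. iexp (\<Sum>j\<in>J. t j * x j)) = (CLINT x|gauss J. \<Prod>j\<in>J. iexp (t j * x j))"
    by (simp add: sum_distrib_left exp_sum[OF assms])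
  also have "\<dots> = (\<Prod>j\<in>J. CLINT x|std_normal. iexp (t j * x))"
    unfolding gauss_def by (rule product_integral_prod[OF assms int])
  also have "\<dots> = exp (- (\<Sum>j\<in>J. (t j)\<^sup>2) / 2)"
    unfolding std using assms
    by (simp add: exp_sum[symmetric] sum_negf sum_divide_distrib flip: of_real_prod exp_of_real)
  finally show ?thesis .
qed

lemma centered_gaussian_linear:
  assumes "finite J" "finite P"
  shows "centered_gaussian_vector (gauss J) P (\<lambda>p x. \<Sum>q\<in>J. L p q * x q) (\<lambda>p p'. \<Sum>q\<in>J. L p q * L p' q)"
  unfolding centered_gaussian_vector_def
proof (intro conjI ballI allI)
  fix t :: "'b \<Rightarrow> real"
  have "(\<Sum>p\<in>P. t p * (\<Sum>q\<in>J. L p q * x q)) = (\<Sum>q\<in>J. (\<Sum>p\<in>P. t p * L p q) * x q)" for x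
  proof -
    have "(\<Sum>p\<in>P. t p * (\<Sum>q\<in>J. L p q * x q)) = (\<Sum>p\<in>P. \<Sum>q\<in>J. t p * L p q * x q)"
      by (simp add: sum_distrib_left mult.assoc)
    also have "\<dots> = (\<Sum>q\<in>J. \<Sum>p\<in>P. t p * L p q * x q)" by (rule sum.swap)
    finally show ?thesis by (simp add: sum_distrib_right)
  qed
  moreover have "(\<Sum>q\<in>J. (\<Sum>p\<in>P. t p * L p q)\<^sup>2) = (\<Sum>p\<in>P. \<Sum>p'\<in>P. t p * (\<Sum>q\<in>J. L p q * L p' q) * t p')"
  proof -
    have "(\<Sum>q\<in>J. (\<Sum>p\<in>P. t p * L p q)\<^sup>2) = (\<Sum>q\<in>J. \<Sum>p\<in>P. \<Sum>p'\<in>P. t p * L p q * (t p' * L p' q))"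
      by (simp add: power2_eq_square sum_product)
    also have "\<dots> = (\<Sum>p\<in>P. \<Sum>q\<in>J. \<Sum>p'\<in>P. t p * L p q * (t p' * L p' q))" by (rule sum.swap)
    also have "\<dots> = (\<Sum>p\<in>P. \<Sum>p'\<in>P. \<Sum>q\<in>J. t p * L p q * (t p' * L p' q))"
      by (intro sum.cong refl sum.swap)
    also have "\<dots> = (\<Sum>p\<in>P. \<Sum>p'\<in>P. t p * (\<Sum>q\<in>J. L p q * L p' q) * t p')"
      by (simp add: sum_distrib_left sum_distrib_right mult_ac)
    finally show ?thesis .
  qed
  ultimately show "(CLINT x|gauss J. iexp (\<Sum>p\<in>P. t p * (\<Sum>q\<in>J. L p q * x q))) =
    complex_of_real (exp (- (\<Sum>p\<in>P. \<Sum>p'\<in>P. t p * (\<Sum>q\<in>J. L p q * L p' q) * t p') / 2))"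
    using char_gauss[OF assms(1), of "\<lambda>q. \<Sum>p\<in>P. t p * L p q"] by simp
qed (use assms in \<open>auto intro!: prob_space_gauss borel_measurable_sum\<close>)

lemma gaussian_law_unique:
  assumes "centered_gaussian_vector M J X C" "centered_gaussian_vector N J Y C'"
    and "\<And>i j. i \<in> J \<Longrightarrow> j \<in> J \<Longrightarrow> C i j = C' i j"
  shows "distr M (PiM J (\<lambda>_. borel)) (\<lambda>x. \<lambda>j\<in>J. X j x) = distr N (PiM J (\<lambda>_. borel)) (\<lambda>x. \<lambda>j\<in>J. Y j x)"
proof (rule law_eqI)
  fix t :: "'b \<Rightarrow> real"
  have "(\<Sum>i\<in>J. \<Sum>j\<in>J. t i * C i j * t j) = (\<Sum>i\<in>J. \<Sum>j\<in>J. t i * C' i j * t j)"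
    using assms(3) by (intro sum.cong) auto
  then show "(CLINT x|M. iexp (\<Sum>j\<in>J. t j * X j x)) = (CLINT x|N. iexp (\<Sum>j\<in>J. t j * Y j x))"
    using assms(1,2) by (simp add: centered_gaussian_vector_def)
qed (use assms in \<open>auto simp: centered_gaussian_vector_def\<close>)

lemma centered_gaussian_coordinates:
  assumes "finite J"
  shows "centered_gaussian_vector (gauss J) J (\<lambda>j x. x j) (\<lambda>i j. if i = j then 1 else 0)"
proof -
  have "(\<Sum>j\<in>J. t j * x j) = (\<Sum>p\<in>J. t p * (\<Sum>q\<in>J. (if p = q then 1 else 0) * x q))" for t x :: "'a \<Rightarrow> real"
    using assms by (intro sum.cong) (auto simp: if_distrib if_distribR sum.delta cong: if_cong)
  moreover have "(\<Sum>i\<in>J. \<Sum>j\<in>J. t i * (if i = j then 1 else 0) * t j) = (\<Sum>j\<in>J. (t j)\<^sup>2)" for t :: "'a \<Rightarrow> real"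
    using assms by (intro sum.cong) (auto simp: if_distrib if_distribR sum.delta power2_eq_square cong: if_cong)
  ultimately show ?thesis
    using char_gauss[OF assms] assms by (auto simp: centered_gaussian_vector_def prob_space_gauss)
qed

text \<open>Only the rows of \<open>L\<close> have to be orthonormal, so \<open>L\<close> may lower
  the dimension. This single fact covers normalized linear forms, reflections, and the recombination
  of rows with one auxiliary row.\<close>

lemma gauss_linear_image:
  assumes "finite J" "finite P"
    and "\<And>p p'. p \<in> P \<Longrightarrow> p' \<in> P \<Longrightarrow> (\<Sum>q\<in>J. L p q * L p' q) = (if p = p' then 1 else 0)"
  shows "distr (gauss J) (PiM P (\<lambda>_. borel)) (\<lambda>x. \<lambda>p\<in>P. \<Sum>q\<in>J. L p q * x q) = gauss P"
proof -
  have "distr (gauss J) (PiM P (\<lambda>_. borel)) (\<lambda>x. \<lambda>p\<in>P. \<Sum>q\<in>J. L p q * x q) =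
      distr (gauss P) (PiM P (\<lambda>_. borel)) (\<lambda>x. \<lambda>p\<in>P. x p)"
    by (rule gaussian_law_unique[OF centered_gaussian_linear[OF assms(1,2)] centered_gaussian_coordinates[OF assms(2)] assms(3)])
  also have "\<dots> = distr (gauss P) (gauss P) (\<lambda>x. x)"
    by (rule distr_cong) (auto simp: space_gauss PiE_restrict)
  finally show ?thesis by simp
qed

text \<open>The definite description is resolved by uniqueness of Gaussian laws, so any realization
  on any sample space computes the orthant probability.\<close>

lemma gauss_orthant_eq:
  fixes M :: "'w measure"
  assumes "J \<noteq> {}" and G: "centered_gaussian_vector M J X C"
    and C: "\<And>i j. i \<in> J \<Longrightarrow> j \<in> J \<Longrightarrow> C i j = 1 / a + (if i = j then 1 / l i else 0)"
  shows "gauss_orthant J a l = measure M {\<omega> \<in> space M. \<forall>j\<in>J. X j \<omega> < 0}"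
proof -
  define C' where "C' = (\<lambda>i j :: nat. 1 / a + (if i = j then 1 / l i else 0))"
  have J: "finite J" and meas[measurable]: "\<And>j. j \<in> J \<Longrightarrow> X j \<in> borel_measurable M" and "prob_space M"
    using G by (auto simp: centered_gaussian_vector_def)
  \<comment> \<open>The law of the vector itself is the required realization on the sample space
    \<open>nat \<Rightarrow> real\<close>, with the coordinate functions as components.\<close>
  define D where "D = distr M (PiM J (\<lambda>_. borel)) (\<lambda>x. \<lambda>j\<in>J. X j x)"
  have orth: "measure N {\<omega> \<in> space N. \<forall>j\<in>J. Y j \<omega> < 0} =
      measure (distr N (PiM J (\<lambda>_. borel)) (\<lambda>x. \<lambda>j\<in>J. Y j x)) {x \<in> space (PiM J (\<lambda>_. borel)). \<forall>j\<in>J. x j < 0}"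
    if [measurable]: "\<And>j. j \<in> J \<Longrightarrow> Y j \<in> borel_measurable N" for N :: "'v measure" and Y :: "nat \<Rightarrow> 'v \<Rightarrow> real"
  proof -
    have S: "{x \<in> space (PiM J (\<lambda>_. borel)). \<forall>j\<in>J. x j < (0::real)} \<in> sets (PiM J (\<lambda>_. borel))"
      using J by measurable
    show ?thesis
      by (subst measure_distr[OF _ S]) (auto intro!: arg_cong[where f = "measure N"] simp: space_PiM J)
  qed
  have D: "centered_gaussian_vector D J (\<lambda>j x. x j) C'"
    unfolding centered_gaussian_vector_def
  proof (intro conjI ballI allI)
    show "prob_space D" unfolding D_def by (rule prob_space.prob_space_distr[OF \<open>prob_space M\<close>]) simp
    fix t :: "nat \<Rightarrow> real"
    have "(CLINT x|D. iexp (\<Sum>i\<in>J. t i * x i)) = (CLINT x|M. iexp (\<Sum>i\<in>J. t i * X i x))"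
      unfolding D_def by (subst integral_distr) (auto intro!: Bochner_Integration.integral_cong)
    also have "\<dots> = complex_of_real (exp (- (\<Sum>i\<in>J. \<Sum>j\<in>J. t i * C i j * t j) / 2))"
      using G unfolding centered_gaussian_vector_def by blast
    also have "(\<Sum>i\<in>J. \<Sum>j\<in>J. t i * C i j * t j) = (\<Sum>i\<in>J. \<Sum>j\<in>J. t i * C' i j * t j)"
      unfolding C'_def using C by (intro sum.cong) auto
    finally show "(CLINT x|D. iexp (\<Sum>i\<in>J. t i * x i)) = complex_of_real (exp (- (\<Sum>i\<in>J. \<Sum>j\<in>J. t i * C' i j * t j) / 2))" .
  qed (use J in \<open>auto simp: D_def\<close>)
  have uniq: "p = measure M {\<omega> \<in> space M. \<forall>j\<in>J. X j \<omega> < 0}"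
    if "centered_gaussian_vector N J \<eta> C'" "p = measure N {\<omega> \<in> space N. \<forall>j\<in>J. \<eta> j \<omega> < 0}"
    for N :: "(nat \<Rightarrow> real) measure" and \<eta> p
  proof -
    have "\<And>j. j \<in> J \<Longrightarrow> \<eta> j \<in> borel_measurable N" using that by (auto simp: centered_gaussian_vector_def)
    then show ?thesis
      unfolding that(2) by (simp add: orth[of \<eta> N] orth[of X M] gaussian_law_unique[OF that(1) G] C C'_def)
  qed
  have "(THE p. \<exists>(N :: (nat \<Rightarrow> real) measure) \<eta>. centered_gaussian_vector N J \<eta> C' \<and>
      p = measure N {\<omega> \<in> space N. \<forall>j\<in>J. \<eta> j \<omega> < 0}) = measure M {\<omega> \<in> space M. \<forall>j\<in>J. X j \<omega> < 0}"
  proof (rule the_equality)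
    show "\<exists>(N :: (nat \<Rightarrow> real) measure) \<eta>. centered_gaussian_vector N J \<eta> C' \<and> measure M {\<omega> \<in> space M. \<forall>j\<in>J. X j \<omega> < 0} =
        measure N {\<omega> \<in> space N. \<forall>j\<in>J. \<eta> j \<omega> < 0}"
      by (rule exI[of _ D], rule exI[of _ "\<lambda>j x. x j"], rule conjI[OF D uniq[OF D refl, symmetric]])
  next
    fix p
    assume "\<exists>(N :: (nat \<Rightarrow> real) measure) \<eta>. centered_gaussian_vector N J \<eta> C' \<and>
        p = measure N {\<omega> \<in> space N. \<forall>j\<in>J. \<eta> j \<omega> < 0}"
    then obtain N :: "(nat \<Rightarrow> real) measure" and \<eta> where "centered_gaussian_vector N J \<eta> C'"
      "p = measure N {\<omega> \<in> space N. \<forall>j\<in>J. \<eta> j \<omega> < 0}" by (elim exE conjE)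
    then show "p = measure M {\<omega> \<in> space M. \<forall>j\<in>J. X j \<omega> < 0}" by (rule uniq)
  qed
  then show ?thesis using assms(1) by (simp add: gauss_orthant_def C'_def)
qed

section \<open>Measurability and faces of polytopes\<close>

text \<open>An existential over a compact set becomes countable: solvability in \<open>K\<close> is
  equivalent to solvability with every tolerance \<open>1 / (m + 1)\<close> in a countable dense
  subset. A limit point of such approximate solutions is an exact one by continuity.\<close>

lemma measurable_compact_exists:
  fixes F :: "'p \<Rightarrow> 'w \<Rightarrow> 'c::{metric_space, second_countable_topology} \<Rightarrow> real"
  assumes P: "finite P" and K: "compact K"
    and meas[measurable]: "\<And>p c. p \<in> P \<Longrightarrow> (\<lambda>\<omega>. F p \<omega> c) \<in> borel_measurable M"
    and cont: "\<And>p \<omega>. p \<in> P \<Longrightarrow> continuous_on UNIV (F p \<omega>)"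
  shows "{\<omega>\<in>space M. \<exists>c\<in>K. \<forall>p\<in>P. F p \<omega> c \<le> 0} \<in> sets M"
proof -
  obtain B :: "'c set set" where B: "countable B" "topological_basis B"
    using ex_countable_basis by blast
  \<comment> \<open>One point of \<open>K\<close> from every basic open set that meets
    \<open>K\<close>: the dense set has to lie inside \<open>K\<close>, so that limits remain
    there.\<close>
  define D where "D = (\<lambda>b. SOME c. c \<in> K \<inter> b) ` {b\<in>B. K \<inter> b \<noteq> {}}"
  have cD: "countable D" unfolding D_def using B(1) by auto
  have pick: "(SOME c. c \<in> K \<inter> b) \<in> K \<inter> b" if "K \<inter> b \<noteq> {}" for b
    using that by (metis ex_in_conv someI_ex)
  have DK: "D \<subseteq> K" using pick by (auto simp: D_def)
  have dense: "\<exists>d\<in>D. d \<in> U" if U: "open U" "c \<in> U" "c \<in> K" for U c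
  proof -
    obtain b where b: "b \<in> B" "c \<in> b" "b \<subseteq> U"
      using B(2) U topological_basisE by metis
    then have "K \<inter> b \<noteq> {}" using U by blast
    with pick[OF this] b show ?thesis by (auto simp: D_def)
  qed
  have eq: "(\<exists>c\<in>K. \<forall>p\<in>P. F p \<omega> c \<le> 0) \<longleftrightarrow> (\<forall>m::nat. \<exists>d\<in>D. \<forall>p\<in>P. F p \<omega> d < inverse (real (Suc m)))" for \<omega>
  proof
    assume "\<exists>c\<in>K. \<forall>p\<in>P. F p \<omega> c \<le> 0"
    then obtain c where c: "c \<in> K" "\<And>p. p \<in> P \<Longrightarrow> F p \<omega> c \<le> 0" by blast
    show "\<forall>m::nat. \<exists>d\<in>D. \<forall>p\<in>P. F p \<omega> d < inverse (real (Suc m))"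
    proof
      fix m :: nat
      define U where "U = (\<Inter>p\<in>P. {d. F p \<omega> d < inverse (real (Suc m))})"
      have "open U" unfolding U_def
        using P cont by (intro open_INT ballI open_Collect_less continuous_on_const) auto
      moreover have "F p \<omega> c < inverse (real (Suc m))" if "p \<in> P" for p
        using c(2)[OF that] by (rule order.strict_trans1) simp
      then have "c \<in> U" by (auto simp: U_def)
      ultimately obtain d where "d \<in> D" "d \<in> U" using dense c(1) by blast
      then show "\<exists>d\<in>D. \<forall>p\<in>P. F p \<omega> d < inverse (real (Suc m))" by (auto simp: U_def)
    qed
  next
    assume "\<forall>m::nat. \<exists>d\<in>D. \<forall>p\<in>P. F p \<omega> d < inverse (real (Suc m))"
    then obtain s where s: "\<And>m. s m \<in> D" "\<And>m p. p \<in> P \<Longrightarrow> F p \<omega> (s m) < inverse (real (Suc m))"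
      by metis
    then have "\<And>m. s m \<in> K" using DK by auto
    with K obtain c r where c: "c \<in> K" "strict_mono r" "(s \<circ> r) \<longlonglongrightarrow> c"
      unfolding compact_eq_seq_compact_metric seq_compact_def by metis
    have "F p \<omega> c \<le> 0" if p: "p \<in> P" for p
    proof (rule LIMSEQ_le)
      have "isCont (F p \<omega>) c" using cont[OF p] by (simp add: continuous_on_eq_continuous_at)
      then show "(\<lambda>m. F p \<omega> (s (r m))) \<longlonglongrightarrow> F p \<omega> c"
        using isCont_tendsto_compose[of c "F p \<omega>" "s \<circ> r"] c(3) by (simp add: o_def)
      have "((\<lambda>m. inverse (real (Suc m))) \<circ> r) \<longlonglongrightarrow> 0"
        using LIMSEQ_inverse_real_of_nat c(2) by (rule LIMSEQ_subseq_LIMSEQ)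
      then show "(\<lambda>m. inverse (real (Suc (r m)))) \<longlonglongrightarrow> 0" by (simp add: o_def)
      show "\<exists>N. \<forall>m\<ge>N. F p \<omega> (s (r m)) \<le> inverse (real (Suc (r m)))"
        using s(2)[OF p] by (auto intro!: less_imp_le)
    qed
    with c(1) show "\<exists>c\<in>K. \<forall>p\<in>P. F p \<omega> c \<le> 0" by blast
  qed
  have "{\<omega>\<in>space M. \<forall>m::nat. \<exists>d\<in>D. \<forall>p\<in>P. F p \<omega> d < inverse (real (Suc m))} \<in> sets M"
    using P cD by measurable
  then show ?thesis unfolding eq .
qed

lemma compact_box: "compact {c :: nat \<Rightarrow> real. \<forall>i. c i \<in> {- B..B}}"
proof -
  have "{c :: nat \<Rightarrow> real. \<forall>i. c i \<in> {- B..B}} = (\<Pi>\<^sub>E i\<in>UNIV. {- B..B})" by (auto simp: PiE_iff)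
  moreover have "compactin (product_topology (\<lambda>_. euclidean) UNIV) (\<Pi>\<^sub>E i\<in>(UNIV :: nat set). {- B..B})"
    unfolding compactin_PiE by (simp add: compactin_euclidean_iff)
  ultimately show ?thesis
    by (simp add: compactin_euclidean_iff euclidean_product_topology)
qed

lemma continuous_on_lin: "continuous_on UNIV (\<lambda>c :: nat \<Rightarrow> real. \<Sum>r\<in>R. c r * g r)"
  by (intro continuous_on_sum continuous_on_mult continuous_on_product_coordinates continuous_on_const)

text \<open>Neither the coefficient space nor the strict inequalities are compact. Both are
  exhausted by a single parameter: box radius \<open>m\<close> and slack \<open>1 / (m + 1)\<close>
  give compact problems whose union is the original one.\<close>

lemma lin_feas_measurable:
  fixes f :: "'z \<Rightarrow> 'w \<Rightarrow> nat \<Rightarrow> real" and g :: "'s \<Rightarrow> 'w \<Rightarrow> nat \<Rightarrow> real"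
  assumes fin: "finite R" "finite Z" "finite S"
    and [measurable]: "\<And>z r. z \<in> Z \<Longrightarrow> r \<in> R \<Longrightarrow> (\<lambda>\<omega>. f z \<omega> r) \<in> borel_measurable M"
      "\<And>s r. s \<in> S \<Longrightarrow> r \<in> R \<Longrightarrow> (\<lambda>\<omega>. g s \<omega> r) \<in> borel_measurable M"
  shows "{\<omega>\<in>space M. \<exists>c. (\<forall>z\<in>Z. (\<Sum>r\<in>R. c r * f z \<omega> r) = 0) \<and> (\<forall>s\<in>S. (\<Sum>r\<in>R. c r * g s \<omega> r) < 0)} \<in> sets M"
proof -
  define F where "F m p \<omega> c = (case p of Inl z \<Rightarrow> \<bar>\<Sum>r\<in>R. c r * f z \<omega> r\<bar>
    | Inr s \<Rightarrow> (\<Sum>r\<in>R. c r * g s \<omega> r) + inverse (real (Suc m)))" for m p \<omega> and c :: "nat \<Rightarrow> real"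
  define P where "P = Inl ` Z \<union> Inr ` S"
  have P: "finite P" using fin by (auto simp: P_def)
  define K where "K m = {c :: nat \<Rightarrow> real. \<forall>i. c i \<in> {- real m..real m}}" for m :: nat
  have "{\<omega>\<in>space M. \<exists>c\<in>K m. \<forall>p\<in>P. F m p \<omega> c \<le> 0} \<in> sets M" for m
  proof (rule measurable_compact_exists[OF P])
    show "compact (K m)" unfolding K_def by (rule compact_box)
    fix p assume p: "p \<in> P"
    show "(\<lambda>\<omega>. F m p \<omega> c) \<in> borel_measurable M" for c
    proof (cases p)
      case (Inl z)
      with p have "z \<in> Z" by (auto simp: P_def)
      then show ?thesis unfolding F_def Inl sum.case
        by (intro borel_measurable_abs borel_measurable_sum borel_measurable_times borel_measurable_const assms(4))
    next
      case (Inr s)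
      with p have "s \<in> S" by (auto simp: P_def)
      then show ?thesis unfolding F_def Inr sum.case
        by (intro borel_measurable_add borel_measurable_sum borel_measurable_times borel_measurable_const assms(5))
    qed
    show "continuous_on UNIV (F m p \<omega>)" for \<omega>
    proof (cases p)
      case (Inl z)
      show ?thesis unfolding F_def Inl sum.case by (intro continuous_on_rabs continuous_on_lin)
    next
      case (Inr s)
      show ?thesis unfolding F_def Inr sum.case
        by (intro continuous_on_add continuous_on_const continuous_on_lin)
    qed
  qed
  then have "(\<Union>m. {\<omega>\<in>space M. \<exists>c\<in>K m. \<forall>p\<in>P. F m p \<omega> c \<le> 0}) \<in> sets M" by blast
  also have "(\<Union>m. {\<omega>\<in>space M. \<exists>c\<in>K m. \<forall>p\<in>P. F m p \<omega> c \<le> 0}) =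
    {\<omega>\<in>space M. \<exists>c. (\<forall>z\<in>Z. (\<Sum>r\<in>R. c r * f z \<omega> r) = 0) \<and> (\<forall>s\<in>S. (\<Sum>r\<in>R. c r * g s \<omega> r) < 0)}"
    (is "?L = ?R")
  proof (intro equalityI subsetI)
    fix \<omega> assume "\<omega> \<in> ?L"
    then obtain m c where c: "\<omega> \<in> space M" "\<And>p. p \<in> P \<Longrightarrow> F m p \<omega> c \<le> 0" by blast
    have "(\<Sum>r\<in>R. c r * f z \<omega> r) = 0" if "z \<in> Z" for z
      using c(2)[of "Inl z"] that by (auto simp: P_def F_def)
    moreover have "(\<Sum>r\<in>R. c r * g s \<omega> r) < 0" if "s \<in> S" for s
    proof -
      have "(\<Sum>r\<in>R. c r * g s \<omega> r) + inverse (real (Suc m)) \<le> 0"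
        using c(2)[of "Inr s"] that by (auto simp: P_def F_def)
      moreover have "0 < inverse (real (Suc m))" by simp
      ultimately show ?thesis by linarith
    qed
    ultimately show "\<omega> \<in> ?R" using c(1) by blast
  next
    fix \<omega> assume "\<omega> \<in> ?R"
    then obtain c where c: "\<omega> \<in> space M" "\<And>z. z \<in> Z \<Longrightarrow> (\<Sum>r\<in>R. c r * f z \<omega> r) = 0"
      "\<And>s. s \<in> S \<Longrightarrow> (\<Sum>r\<in>R. c r * g s \<omega> r) < 0" by blast
    \<comment> \<open>The box bounds every index, so coefficients outside \<open>R\<close> have to
      be reset.\<close>
    define c' where "c' r = (if r \<in> R then c r else 0)" for r
    have c': "(\<Sum>r\<in>R. c' r * h r) = (\<Sum>r\<in>R. c r * h r)" for h by (simp add: c'_def)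
    have "\<forall>\<^sub>F m in sequentially. (\<forall>s\<in>S. inverse (real (Suc m)) < - (\<Sum>r\<in>R. c r * g s \<omega> r)) \<and> (\<forall>r\<in>R. \<bar>c r\<bar> \<le> real m)"
    proof (intro eventually_conj eventually_ball_finite fin ballI)
      show "\<forall>\<^sub>F m in sequentially. inverse (real (Suc m)) < - (\<Sum>r\<in>R. c r * g s \<omega> r)" if "s \<in> S" for s
        using c(3)[OF that] by (intro order_tendstoD[OF LIMSEQ_inverse_real_of_nat]) auto
      show "\<forall>\<^sub>F m in sequentially. \<bar>c r\<bar> \<le> real m" for r
        using filterlim_real_sequentially by (auto simp: filterlim_at_top)
    qed
    then obtain m where m: "\<And>s. s \<in> S \<Longrightarrow> inverse (real (Suc m)) < - (\<Sum>r\<in>R. c r * g s \<omega> r)"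
      "\<And>r. r \<in> R \<Longrightarrow> \<bar>c r\<bar> \<le> real m"
      using eventually_happens' sequentially_bot by blast
    have "c' \<in> K m" using m(2) by (auto simp: K_def c'_def abs_le_iff minus_le_iff)
    moreover have "F m p \<omega> c' \<le> 0" if "p \<in> P" for p
      using that c(2) m(1) by (force simp: P_def F_def c')
    ultimately show "\<omega> \<in> ?L" using c(1) by blast
  qed
  finally show ?thesis .
qed

lemma feas_measurable [measurable]:
  assumes [measurable]: "\<And>i r. i \<in> Z \<union> S \<Longrightarrow> r \<le> m \<Longrightarrow> (\<lambda>\<omega>. a \<omega> i r) \<in> borel_measurable M"
    and "finite Z" "finite S"
  shows "{\<omega>\<in>space M. feas m (a \<omega>) Z S} \<in> sets M"
  unfolding feas_def comb_def
  by (rule lin_feas_measurable[where f = "\<lambda>i \<omega>. a \<omega> i" and g = "\<lambda>i \<omega>. a \<omega> i"])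
    (use assms(2,3) in \<open>auto intro!: assms(1)\<close>)

lemma possol_measurable:
  assumes [measurable]: "\<And>i r. i \<in> I \<Longrightarrow> r \<le> p \<Longrightarrow> (\<lambda>\<omega>. a \<omega> i r) \<in> borel_measurable M"
    and "finite I"
  shows "{\<omega>\<in>space M. possol p (a \<omega>) I A} \<in> sets M"
proof -
  have "{\<omega>\<in>space M. \<exists>b. (\<forall>r\<in>{..p}. (\<Sum>i\<in>I. b i * a \<omega> i r) = 0) \<and>
      (\<forall>s\<in>I - A. (\<Sum>i\<in>I. b i * (if i = s then -1 else 0)) < 0)} \<in> sets M"
    by (rule lin_feas_measurable[where f = "\<lambda>r \<omega> i. a \<omega> i r" and g = "\<lambda>s \<omega> i. if i = s then -1 else 0"])
      (use assms(2) in \<open>auto intro!: assms(1)\<close>)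
  also have "(\<Sum>i\<in>I. b i * (if i = s then -1 else 0)) = - b s" if "s \<in> I - A" for b :: "nat \<Rightarrow> real" and s
    using assms(2) that by (simp add: if_distrib cong: if_cong)
  then have "{\<omega>\<in>space M. \<exists>b. (\<forall>r\<in>{..p}. (\<Sum>i\<in>I. b i * a \<omega> i r) = 0) \<and>
      (\<forall>s\<in>I - A. (\<Sum>i\<in>I. b i * (if i = s then -1 else 0)) < 0)} = {\<omega>\<in>space M. possol p (a \<omega>) I A}"
    unfolding possol_def by (intro Collect_cong conj_cong refl ex_cong1) auto
  finally show ?thesis .
qed

section \<open>Affine dimension and faces through supporting functionals\<close>

text \<open>A functional bounded below on an affine subspace is constant on it, so strict separation
  from the hull already has the required shape. This turns affine independence into a condition of
  the type \<open>feas\<close>.\<close>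

lemma not_in_affine_hull_iff:
  fixes y :: "'a::euclidean_space"
  shows "y \<notin> affine hull V \<longleftrightarrow> (\<exists>u c. (\<forall>z\<in>V. u \<bullet> z = c) \<and> u \<bullet> y < c)"
proof
  assume y: "y \<notin> affine hull V"
  show "\<exists>u c. (\<forall>z\<in>V. u \<bullet> z = c) \<and> u \<bullet> y < c"
  proof (cases "V = {}")
    case True
    then show ?thesis by (intro exI[of _ 0] exI[of _ 1]) auto
  next
    case False
    then obtain z0 where z0: "z0 \<in> V" by blast
    have cv: "convex (affine hull V)" by (simp add: affine_imp_convex)
    obtain u b where ub: "u \<bullet> y < b" "\<And>z. z \<in> affine hull V \<Longrightarrow> b < u \<bullet> z"
      using separating_hyperplane_closed_point[OF cv closed_affine_hull y] by blast
    have "u \<bullet> z = u \<bullet> z0" if z: "z \<in> V" for z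
    proof (rule ccontr)
      assume ne: "u \<bullet> z \<noteq> u \<bullet> z0"
      \<comment> \<open>The point with parameter \<open>t\<close> on the line through
        \<open>z0\<close> and \<open>z\<close> has value exactly \<open>b\<close>, although the hull
        lies strictly above \<open>b\<close>.\<close>
      define t where "t = (b - u \<bullet> z0) / (u \<bullet> z - u \<bullet> z0)"
      have "(1 - t) *\<^sub>R z0 + t *\<^sub>R z \<in> affine hull V"
        using z z0 hull_inc[of _ V affine] by (intro mem_affine[OF affine_affine_hull]) auto
      from ub(2)[OF this] have "b < u \<bullet> z0 + t * (u \<bullet> z - u \<bullet> z0)"
        by (simp add: inner_add_right algebra_simps)
      then show False using ne by (simp add: t_def)
    qed
    then show ?thesis using ub(1) ub(2)[OF hull_inc[OF z0]]
      by (intro exI[of _ u] exI[of _ "u \<bullet> z0"]) auto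
  qed
next
  assume "\<exists>u c. (\<forall>z\<in>V. u \<bullet> z = c) \<and> u \<bullet> y < c"
  then obtain u c where uc: "\<forall>z\<in>V. u \<bullet> z = c" "u \<bullet> y < c" by blast
  have "affine hull V \<subseteq> {z. u \<bullet> z = c}"
    by (rule hull_minimal) (use uc affine_hyperplane in auto)
  with uc(2) show "y \<notin> affine hull V" by auto
qed

text \<open>Dimension at least \<open>k\<close> means \<open>k + 1\<close> affinely independent
  points, each separated from the hull of the others. Quantifying over index sets allows repeated
  points, since separation forces \<open>x\<close> to be injective on \<open>T\<close>.\<close>

lemma aff_dim_image_ge_iff:
  fixes x :: "'i \<Rightarrow> 'a::euclidean_space"
  assumes "finite S"
  shows "int k \<le> aff_dim (x ` S) \<longleftrightarrow>
    (\<exists>T\<subseteq>S. card T = Suc k \<and> (\<forall>j\<in>T. \<exists>u c. (\<forall>i\<in>T - {j}. u \<bullet> x i = c) \<and> u \<bullet> x j < c))"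
    (is "_ \<longleftrightarrow> ?R")
proof
  assume le: "int k \<le> aff_dim (x ` S)"
  obtain B where B: "B \<subseteq> x ` S" "\<not> affine_dependent B" "affine hull (x ` S) = affine hull B"
    using affine_basis_exists by blast
  have "aff_dim (x ` S) = aff_dim B" using B(3) by (metis aff_dim_affine_hull)
  with aff_dim_affine_independent[OF B(2)] le have "Suc k \<le> card B" by linarith
  then obtain B' where B': "B' \<subseteq> B" "card B' = Suc k" by (metis obtain_subset_with_card_n)
  with B(1) obtain T where T: "T \<subseteq> S" "inj_on x T" "B' = x ` T"
    by (metis order.trans subset_image_inj)
  have ind: "\<not> affine_dependent (x ` T)" using B(2) B'(1) T(3) affine_dependent_subset by metis
  have "\<exists>u c. (\<forall>i\<in>T - {j}. u \<bullet> x i = c) \<and> u \<bullet> x j < c" if "j \<in> T" for j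
  proof -
    have "x ` T - {x j} = x ` (T - {j})" using T(2) that by (auto simp: inj_on_def)
    then have "x j \<notin> affine hull (x ` (T - {j}))"
      using ind that unfolding affine_dependent_def by (metis image_eqI)
    then show ?thesis unfolding not_in_affine_hull_iff by auto
  qed
  moreover have "card T = Suc k" using T B'(2) card_image by metis
  ultimately show ?R using T(1) by blast
next
  assume ?R
  then obtain T where T: "T \<subseteq> S" "card T = Suc k"
    "\<And>j. j \<in> T \<Longrightarrow> \<exists>u c. (\<forall>i\<in>T - {j}. u \<bullet> x i = c) \<and> u \<bullet> x j < c" by blast
  have nin: "x j \<notin> affine hull (x ` (T - {j}))" if "j \<in> T" for j
    using T(3)[OF that] unfolding not_in_affine_hull_iff by auto
  have inj: "inj_on x T"
  proof (rule inj_onI, rule ccontr)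
    fix i j assume ij: "i \<in> T" "j \<in> T" "x i = x j" "i \<noteq> j"
    then have "x j \<in> x ` (T - {j})" by (metis Diff_iff image_eqI singletonD)
    with nin[OF ij(2)] show False using hull_inc[of "x j" "x ` (T - {j})" affine] by blast
  qed
  have "\<not> affine_dependent (x ` T)"
  proof
    assume "affine_dependent (x ` T)"
    then obtain j where j: "j \<in> T" "x j \<in> affine hull (x ` T - {x j})"
      unfolding affine_dependent_def by blast
    have "x ` T - {x j} = x ` (T - {j})" using inj j(1) by (auto simp: inj_on_def)
    with nin[OF j(1)] j(2) show False by simp
  qed
  from aff_dim_affine_independent[OF this] card_image[OF inj] T(2)
  have "aff_dim (x ` T) = int k" by simp
  then show "int k \<le> aff_dim (x ` S)" using aff_dim_subset[OF image_mono[OF T(1)], of x] by simp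
qed

text \<open>All faces of a polytope are exposed, and a face is the hull of the given points it
  contains; so it corresponds to the full set of indices of those points. Taking all such indices
  keeps the correspondence bijective when points coincide or are not vertices.\<close>

lemma face_number_image:
  fixes x :: "'i \<Rightarrow> 'a::euclidean_space"
  assumes "finite N" "N \<noteq> {}"
  shows "face_number k (convex hull (x ` N)) =
    card {S. S \<subseteq> N \<and> (\<exists>u c. (\<forall>i\<in>S. u \<bullet> x i = c) \<and> (\<forall>i\<in>N - S. u \<bullet> x i < c)) \<and> aff_dim (x ` S) = int k}"
    (is "_ = card ?S")
proof -
  define P where "P = convex hull (x ` N)"
  have "polytope P" unfolding P_def polytope_def using assms(1) by blast
  then have P: "convex P" "polyhedron P"
    by (rule polytope_imp_convex, rule polytope_imp_polyhedron)
  have xP: "x i \<in> P" if "i \<in> N" for i unfolding P_def by (rule hull_inc) (rule imageI[OF that])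
  define S where "S F = {i\<in>N. x i \<in> F}" for F
  have hull: "F = convex hull (x ` S F)" if F: "F face_of P" for F
  proof
    show "convex hull (x ` S F) \<subseteq> F"
      by (rule hull_minimal) (use face_of_imp_convex[OF F] in \<open>auto simp: S_def\<close>)
    have "compact (x ` N)" using assms by (simp add: finite_imp_compact)
    from face_of_convex_hull_subset[OF this F[unfolded P_def]] obtain S' where
      S': "S' \<subseteq> x ` N" "F = convex hull S'" .
    have "S' \<subseteq> x ` S F" using S' hull_subset[of S' convex] by (auto simp: S_def)
    then show "F \<subseteq> convex hull (x ` S F)" unfolding S'(2)[symmetric] using S'(2) hull_mono by metis
  qed
  have "bij_betw S {F. F face_of P \<and> aff_dim F = int k} ?S"
    unfolding bij_betw_def
  proof (intro conjI equalityI subsetI)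
    show "inj_on S {F. F face_of P \<and> aff_dim F = int k}"
      by (rule inj_onI) (metis (mono_tags) hull mem_Collect_eq)
    fix T assume "T \<in> S ` {F. F face_of P \<and> aff_dim F = int k}"
    then obtain F where F: "F face_of P" "aff_dim F = int k" "T = S F" by blast
    have ne: "F \<noteq> {}" using F(2) by auto
    have "F exposed_face_of P" using P F exposed_face_of_polyhedron by blast
    then obtain u c where uc: "P \<subseteq> {y. u \<bullet> y \<le> c}" "F = P \<inter> {y. u \<bullet> y = c}"
      unfolding exposed_face_of_def by blast
    have "(\<forall>i\<in>T. u \<bullet> x i = c) \<and> (\<forall>i\<in>N - T. u \<bullet> x i < c)"
      using uc xP F(3) unfolding S_def by (auto simp: order.strict_iff_order)
    moreover have "aff_dim (x ` T) = int k"
      using F hull[OF F(1)] by (metis aff_dim_convex_hull)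
    ultimately show "T \<in> ?S" using F(3) by (auto simp: S_def)
  next
    fix T assume "T \<in> ?S"
    then obtain u c where T: "T \<subseteq> N" "\<And>i. i \<in> T \<Longrightarrow> u \<bullet> x i = c" "\<And>i. i \<in> N - T \<Longrightarrow> u \<bullet> x i < c"
      "aff_dim (x ` T) = int k" by blast
    define F where "F = P \<inter> {y. u \<bullet> y = c}"
    have le: "u \<bullet> y \<le> c" if "y \<in> P" for y
    proof -
      have "P \<subseteq> {y. u \<bullet> y \<le> c}" unfolding P_def
        by (rule hull_minimal) (use T(2,3) in \<open>force simp: convex_halfspace_le\<close>)+
      then show ?thesis using that by blast
    qed
    have F: "F face_of P" unfolding F_def using P(1) le by (rule face_of_Int_supporting_hyperplane_le)
    have SF: "S F = T" using T xP by (force simp: S_def F_def)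
    have "aff_dim F = int k" using hull[OF F] T(4) SF by (metis aff_dim_convex_hull)
    with F SF show "T \<in> S ` {F. F face_of P \<and> aff_dim F = int k}" by blast
  qed
  from bij_betw_same_card[OF this] show ?thesis
    unfolding face_number_def P_def by simp
qed

section \<open>Gaussian matrices in general position\<close>

definition gmat :: "(nat \<Rightarrow> real) \<Rightarrow> (nat \<times> nat \<Rightarrow> real) \<Rightarrow> nat \<Rightarrow> nat \<Rightarrow> real"
  where "gmat \<tau> x i r = (if r = 0 then \<tau> i else x (i, r))"

lemma gauss_merge:
  assumes "finite I" "finite J" "I \<inter> J = {}"
  shows "distr (gauss I \<Otimes>\<^sub>M gauss J) (PiM (I \<union> J) (\<lambda>_. borel)) (merge I J) = gauss (I \<union> J)"
proof -
  interpret product_prob_space "\<lambda>_. std_normal" by (rule product_prob_std_normal)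
  have "distr (gauss I \<Otimes>\<^sub>M gauss J) (gauss (I \<union> J)) (merge I J) = gauss (I \<union> J)"
    unfolding gauss_def by (rule distr_merge[OF assms(3,1,2)])
  moreover have "distr (gauss I \<Otimes>\<^sub>M gauss J) (gauss (I \<union> J)) (merge I J) =
      distr (gauss I \<Otimes>\<^sub>M gauss J) (PiM (I \<union> J) (\<lambda>_. borel)) (merge I J)"
    by (rule distr_cong) auto
  ultimately show ?thesis by simp
qed

lemma measurable_merge_gauss:
  "merge I J \<in> measurable (gauss I \<Otimes>\<^sub>M gauss J) (gauss (I \<union> J))"
proof -
  have "merge I J \<in> measurable (PiM I (\<lambda>_. borel) \<Otimes>\<^sub>M PiM J (\<lambda>_. borel)) (PiM (I \<union> J) (\<lambda>_. borel :: real measure))"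
    by measurable
  then show ?thesis
    by (simp cong: measurable_cong_sets sets_pair_measure_cong)
qed

lemma emeasure_gauss_split:
  assumes fin: "finite I" "finite J" "I \<inter> J = {}"
    and E: "{x\<in>space (gauss (I \<union> J)). Q x} \<in> sets (gauss (I \<union> J))"
  shows "emeasure (gauss (I \<union> J)) {x\<in>space (gauss (I \<union> J)). Q x} =
    (\<integral>\<^sup>+ x. emeasure (gauss J) {y\<in>space (gauss J). Q (merge I J (x, y))} \<partial>gauss I)"
proof -
  interpret I: prob_space "gauss I" by (rule prob_space_gauss)
  interpret J: prob_space "gauss J" by (rule prob_space_gauss)
  let ?E = "{x\<in>space (gauss (I \<union> J)). Q x}"
  have "emeasure (gauss (I \<union> J)) ?E = emeasure (distr (gauss I \<Otimes>\<^sub>M gauss J) (PiM (I \<union> J) (\<lambda>_. borel)) (merge I J)) ?E"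
    by (simp only: gauss_merge[OF fin])
  also have "\<dots> = emeasure (gauss I \<Otimes>\<^sub>M gauss J) (merge I J -` ?E \<inter> space (gauss I \<Otimes>\<^sub>M gauss J))"
    using E measurable_merge_gauss[of I J] by (subst emeasure_distr) (auto cong: measurable_cong_sets)
  also have "\<dots> = (\<integral>\<^sup>+ x. emeasure (gauss J) (Pair x -` (merge I J -` ?E \<inter> space (gauss I \<Otimes>\<^sub>M gauss J))) \<partial>gauss I)"
    by (rule J.emeasure_pair_measure_alt) (rule measurable_sets[OF measurable_merge_gauss E])
  also have "\<dots> = (\<integral>\<^sup>+ x. emeasure (gauss J) {y\<in>space (gauss J). Q (merge I J (x, y))} \<partial>gauss I)"
  proof (rule nn_integral_cong)
    fix x assume x: "x \<in> space (gauss I)"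
    have "Pair x -` (merge I J -` ?E \<inter> space (gauss I \<Otimes>\<^sub>M gauss J)) = {y\<in>space (gauss J). Q (merge I J (x, y))}"
      using x measurable_space[OF measurable_merge_gauss, of "(x, _)" I J] by (auto simp: space_pair_measure)
    then show "emeasure (gauss J) (Pair x -` (merge I J -` ?E \<inter> space (gauss I \<Otimes>\<^sub>M gauss J))) =
      emeasure (gauss J) {y\<in>space (gauss J). Q (merge I J (x, y))}" by simp
  qed
  finally show ?thesis .
qed

lemma AE_gauss_split:
  assumes fin: "finite I" "finite J" "I \<inter> J = {}"
    and E: "{x\<in>space (gauss (I \<union> J)). Q x} \<in> sets (gauss (I \<union> J))"
  shows "(AE x in gauss (I \<union> J). Q x) \<longleftrightarrow> (AE x in gauss I. AE y in gauss J. Q (merge I J (x, y)))"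
proof -
  interpret I: prob_space "gauss I" by (rule prob_space_gauss)
  interpret J: prob_space "gauss J" by (rule prob_space_gauss)
  interpret IJ: pair_sigma_finite "gauss I" "gauss J" ..
  have E': "{x\<in>space (PiM (I \<union> J) (\<lambda>_. borel)). Q x} \<in> sets (PiM (I \<union> J) (\<lambda>_. borel))"
    using E by (simp add: space_gauss space_PiM)
  have "(AE x in gauss (I \<union> J). Q x) \<longleftrightarrow> (AE x in distr (gauss I \<Otimes>\<^sub>M gauss J) (PiM (I \<union> J) (\<lambda>_. borel)) (merge I J). Q x)"
    by (simp only: gauss_merge[OF fin])
  also have "\<dots> \<longleftrightarrow> (AE z in gauss I \<Otimes>\<^sub>M gauss J. Q (merge I J z))"
    by (rule AE_distr_iff) (use measurable_merge_gauss[of I J] E' in \<open>auto cong: measurable_cong_sets\<close>)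
  also have "\<dots> \<longleftrightarrow> (AE x in gauss I. AE y in gauss J. Q (merge I J (x, y)))"
  proof -
    have "merge I J -` {x\<in>space (gauss (I \<union> J)). Q x} \<inter> space (gauss I \<Otimes>\<^sub>M gauss J) =
        {z\<in>space (gauss I \<Otimes>\<^sub>M gauss J). Q (merge I J z)}"
      using measurable_space[OF measurable_merge_gauss, of _ I J] by auto
    then have "{z\<in>space (gauss I \<Otimes>\<^sub>M gauss J). Q (merge I J z)} \<in> sets (gauss I \<Otimes>\<^sub>M gauss J)"
      using measurable_sets[OF measurable_merge_gauss E] by simp
    then have "{z\<in>space (gauss I \<Otimes>\<^sub>M gauss J). Q (merge I J (fst z, snd z))} \<in> sets (gauss I \<Otimes>\<^sub>M gauss J)"
      by simp
    from IJ.AE_pair_iff[OF this] show ?thesis by simp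
  qed
  finally show ?thesis .
qed

text \<open>Divided by the norm of \<open>b\<close>, the linear form has a one-dimensional standard
  normal law, here a product over \<open>unit\<close>, and this law has no atom at 0.\<close>

lemma AE_gauss_linear_nonzero:
  assumes "finite J" "q \<in> J" "b q \<noteq> 0"
  shows "AE y in gauss J. (\<Sum>j\<in>J. b j * y j) \<noteq> 0"
proof -
  define \<sigma> where "\<sigma> = sqrt (\<Sum>j\<in>J. (b j)\<^sup>2)"
  have pos: "0 < (\<Sum>j\<in>J. (b j)\<^sup>2)" using assms by (intro sum_pos2[of J q]) auto
  have \<sigma>: "\<sigma> > 0" "\<sigma>\<^sup>2 = (\<Sum>j\<in>J. (b j)\<^sup>2)" using pos by (auto simp: \<sigma>_def)
  define L where "L = (\<lambda>(p :: unit) j. b j / \<sigma>)"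
  have "distr (gauss J) (PiM UNIV (\<lambda>_. borel)) (\<lambda>x. \<lambda>p\<in>UNIV. \<Sum>q\<in>J. L p q * x q) = gauss UNIV"
  proof (rule gauss_linear_image)
    fix p p' :: unit
    have "(\<Sum>q\<in>J. L p q * L p' q) = (\<Sum>q\<in>J. (b q)\<^sup>2) / \<sigma>\<^sup>2"
      by (simp add: L_def power2_eq_square sum_divide_distrib)
    then show "(\<Sum>q\<in>J. L p q * L p' q) = (if p = p' then 1 else 0)" using \<sigma>(2) pos by simp
  qed (use assms in auto)
  moreover have "AE x in gauss (UNIV :: unit set). x () \<noteq> 0"
  proof -
    interpret product_prob_space "\<lambda>_. std_normal" by (rule product_prob_std_normal)
    have "emeasure (gauss (UNIV :: unit set)) (PiE UNIV (\<lambda>_. {0})) = (\<Prod>i\<in>(UNIV :: unit set). emeasure std_normal {0})"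
      unfolding gauss_def by (rule emeasure_PiM) auto
    also have "\<dots> = 0" by (simp add: emeasure_density nn_integral_null_set AE_iff_null_sets)
    finally have null: "emeasure (gauss (UNIV :: unit set)) (PiE UNIV (\<lambda>_. {0})) = 0" .
    have S: "PiE UNIV (\<lambda>_. {0}) \<in> sets (gauss (UNIV :: unit set))"
      unfolding sets_gauss by (rule sets_PiM_I_finite) auto
    show ?thesis
      by (rule AE_I[OF _ null S]) (auto simp: PiE_iff)
  qed
  ultimately have "AE x in distr (gauss J) (PiM UNIV (\<lambda>_. borel)) (\<lambda>x. \<lambda>p\<in>UNIV. \<Sum>q\<in>J. L p q * x q). x () \<noteq> 0"
    by (simp only:)
  then have "AE x in gauss J. (\<Sum>q\<in>J. L () q * x q) \<noteq> 0"
    by (subst (asm) AE_distr_iff) auto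
  then show ?thesis
    by (rule AE_mp) (auto simp: L_def sum_divide_distrib[symmetric])
qed

lemma gmat_measurable:
  assumes "r = 0 \<or> (i, r) \<in> J"
  shows "(\<lambda>x. gmat \<tau> x i r) \<in> borel_measurable (gauss J)"
  using assms by (cases "r = 0") (auto simp: gmat_def)

text \<open>The complement is a finite union of existential events. A nonzero coefficient is
  detected as a negative one, which suffices because kernels are closed under negation.\<close>

lemma genpos_measurable:
  assumes "finite N" and a: "\<And>i r. i \<in> N \<Longrightarrow> r \<le> m \<Longrightarrow> (\<lambda>x. a x i r) \<in> borel_measurable M"
  shows "{x\<in>space M. genpos N (a x) m} \<in> sets M"
proof -
  define B where "B I s = {x\<in>space M. \<exists>c. (\<forall>z\<in>I. (\<Sum>r\<in>{..m}. c r * a x z r) = 0) \<and>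
      (\<forall>s\<in>{s}. (\<Sum>r\<in>{..m}. c r * (if r = s then 1 else 0)) < 0)}" for I s
  have "B I s \<in> sets M" if "I \<subseteq> N" for I s
    unfolding B_def
    by (rule lin_feas_measurable[where f = "\<lambda>i x. a x i" and g = "\<lambda>s x r. if r = s then 1 else 0"])
      (use assms that finite_subset[OF that] in auto)
  then have "(\<Union>I\<in>{I. I \<subseteq> N \<and> card I = Suc m}. \<Union>s\<in>{..m}. B I s) \<in> sets M"
    using assms(1) by (intro sets.finite_UN) auto
  then have "space M - (\<Union>I\<in>{I. I \<subseteq> N \<and> card I = Suc m}. \<Union>s\<in>{..m}. B I s) \<in> sets M" by auto
  also have "space M - (\<Union>I\<in>{I. I \<subseteq> N \<and> card I = Suc m}. \<Union>s\<in>{..m}. B I s) = {x\<in>space M. genpos N (a x) m}"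
  proof -
    have single: "(\<Sum>r\<in>{..m}. c r * (if r = s then 1 else 0)) = c s" if "s \<le> m" for c :: "nat \<Rightarrow> real" and s
      using that by (simp add: if_distrib cong: if_cong)
    have "genpos N (a x) m \<longleftrightarrow> (\<forall>I\<in>{I. I \<subseteq> N \<and> card I = Suc m}. \<forall>s\<in>{..m}. x \<notin> B I s)"
      if x: "x \<in> space M" for x
    proof
      assume gp: "genpos N (a x) m"
      show "\<forall>I\<in>{I. I \<subseteq> N \<and> card I = Suc m}. \<forall>s\<in>{..m}. x \<notin> B I s"
      proof (intro ballI notI)
        fix I s assume I: "I \<in> {I. I \<subseteq> N \<and> card I = Suc m}" and s: "s \<in> {..m}" and "x \<in> B I s"
        then obtain c where "\<forall>z\<in>I. comb m (a x) c z = 0" "c s < 0"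
          by (auto simp: B_def single comb_def)
        with gp I s show False unfolding genpos_def by fastforce
      qed
    next
      assume nB: "\<forall>I\<in>{I. I \<subseteq> N \<and> card I = Suc m}. \<forall>s\<in>{..m}. x \<notin> B I s"
      show "genpos N (a x) m"
        unfolding genpos_def
      proof (intro allI impI)
        fix I c s assume I: "I \<subseteq> N" "card I = Suc m" "\<forall>i\<in>I. comb m (a x) c i = 0" and s: "s \<le> m"
        have pos: "\<not> c' s < 0" if "\<forall>i\<in>I. comb m (a x) c' i = 0" for c'
        proof
          assume "c' s < 0"
          then have "x \<in> B I s" using that x s by (auto simp: B_def single comb_def intro!: exI[of _ c'])
          with nB I s show False by auto
        qed
        have "\<forall>i\<in>I. comb m (a x) (\<lambda>r. (-1) * c r) i = 0" unfolding comb_scale using I(3) by simp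
        from pos[OF this] pos[OF I(3)] show "c s = 0" by simp
      qed
    qed
    then show ?thesis by auto
  qed
  finally show ?thesis .
qed

text \<open>Induction on the columns. Any \<open>m + 2\<close> rows carry a nontrivial dependency
  \<open>b\<close> in the columns up to \<open>m\<close>; conditionally on these, the next Gaussian
  column is almost surely not orthogonal to \<open>b\<close>. Then a kernel vector must vanish at
  the new column, and the previous stage kills the rest. The start uses
  \<open>\<tau> i \<noteq> 0\<close>.\<close>

lemma AE_genpos:
  assumes N: "finite N" and \<tau>: "\<And>i. i \<in> N \<Longrightarrow> \<tau> i \<noteq> 0" and "m \<le> d"
  shows "AE x in gauss (N \<times> {1..d}). genpos N (gmat \<tau> x) m"
  using \<open>m \<le> d\<close>
proof (induction m)
  case 0
  have "genpos N (gmat \<tau> x) 0" for x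
    unfolding genpos_def comb_def using \<tau> by (auto simp: card_Suc_eq gmat_def)
  then show ?case by simp
next
  case (Suc m)
  define J1 where "J1 = N \<times> ({1..d} - {Suc m})"
  define J2 where "J2 = N \<times> {Suc m}"
  have J: "finite J1" "finite J2" "J1 \<inter> J2 = {}" "N \<times> {1..d} = J1 \<union> J2"
    using N Suc.prems by (auto simp: J1_def J2_def)
  have meas: "{x\<in>space (gauss (J1 \<union> J2)). genpos N (gmat \<tau> x) k} \<in> sets (gauss (J1 \<union> J2))" if "k \<le> d" for k
    by (rule genpos_measurable[OF N]) (use that Suc.prems in \<open>auto simp: J(4)[symmetric] intro!: gmat_measurable\<close>)
  have IH: "AE x in gauss J1. AE y in gauss J2. genpos N (gmat \<tau> (merge J1 J2 (x, y))) m"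
  proof (rule iffD1[OF AE_gauss_split[OF J(1-3) meas]])
    show "m \<le> d" using Suc.prems by simp
    show "AE x in gauss (J1 \<union> J2). genpos N (gmat \<tau> x) m" using Suc.IH Suc.prems unfolding J(4) by simp
  qed
  have "AE x in gauss J1. AE y in gauss J2. genpos N (gmat \<tau> (merge J1 J2 (x, y))) (Suc m)"
    using IH
  proof eventually_elim
    fix x assume ae: "AE y in gauss J2. genpos N (gmat \<tau> (merge J1 J2 (x, y))) m"
    interpret prob_space "gauss J2" by (rule prob_space_gauss)
    have "\<exists>y0. genpos N (gmat \<tau> (merge J1 J2 (x, y0))) m"
    proof (rule ccontr)
      assume "\<not> ?thesis"
      with ae have "AE y in gauss J2. False" by simp
      then show False using AE_False by blast
    qed
    \<comment> \<open>The columns up to \<open>m\<close> do not involve \<open>y\<close>, so one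
      good \<open>y0\<close> represents them for every \<open>y\<close>; in particular
      \<open>b\<close> below can be chosen independently of \<open>y\<close>.\<close>
    then obtain y0 where y0: "genpos N (gmat \<tau> (merge J1 J2 (x, y0))) m" ..
    have same: "gmat \<tau> (merge J1 J2 (x, y)) i r = gmat \<tau> (merge J1 J2 (x, y0)) i r" if "i \<in> N" "r \<le> m" for y i r
      using that Suc.prems by (auto simp: gmat_def merge_def J1_def J2_def)
    have last: "gmat \<tau> (merge J1 J2 (x, y)) i (Suc m) = y (i, Suc m)" if "i \<in> N" for y i
      using that by (auto simp: gmat_def merge_def J1_def J2_def)
    define G where "G I y = (\<forall>c. (\<forall>i\<in>I. comb (Suc m) (gmat \<tau> (merge J1 J2 (x, y))) c i = 0) \<longrightarrow> (\<forall>r\<le>Suc m. c r = 0))" for I y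
    have "AE y in gauss J2. G I y" if I: "I \<subseteq> N" "card I = Suc (Suc m)" for I
    proof -
      have fI: "finite I" using I N finite_subset by blast
      have "card {..m} < card I" using I by simp
      from homogeneous_solution[OF _ fI this, of "\<lambda>r i. gmat \<tau> (merge J1 J2 (x, y0)) i r"] obtain b where
        b: "\<exists>i\<in>I. b i \<noteq> 0" "\<And>r. r \<le> m \<Longrightarrow> (\<Sum>i\<in>I. b i * gmat \<tau> (merge J1 J2 (x, y0)) i r) = 0" by auto
      then obtain i0 where i0: "i0 \<in> I" "b i0 \<noteq> 0" by blast
      have "AE y in gauss J2. (\<Sum>j\<in>J2. (if fst j \<in> I then b (fst j) else 0) * y j) \<noteq> 0"
        by (rule AE_gauss_linear_nonzero[of _ "(i0, Suc m)"]) (use J i0 I in \<open>auto simp: J2_def\<close>)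
      then show ?thesis
      proof eventually_elim
        fix y assume "(\<Sum>j\<in>J2. (if fst j \<in> I then b (fst j) else 0) * y j) \<noteq> 0"
        also have "(\<Sum>j\<in>J2. (if fst j \<in> I then b (fst j) else 0) * y j) = (\<Sum>i\<in>N. (if i \<in> I then b i else 0) * y (i, Suc m))"
          unfolding J2_def by (rule sum.reindex_bij_witness[of _ "\<lambda>i. (i, Suc m)" fst]) auto
        also have "\<dots> = (\<Sum>i\<in>I. b i * y (i, Suc m))"
          using I N by (intro sum.mono_neutral_cong_right) auto
        finally have nz: "(\<Sum>i\<in>I. b i * y (i, Suc m)) \<noteq> 0" .
        show "G I y"
          unfolding G_def
        proof (rule allI, rule impI)
          fix c assume c: "\<forall>i\<in>I. comb (Suc m) (gmat \<tau> (merge J1 J2 (x, y))) c i = 0"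
          have split: "comb (Suc m) (gmat \<tau> (merge J1 J2 (x, y))) c i =
              comb m (gmat \<tau> (merge J1 J2 (x, y0))) c i + c (Suc m) * y (i, Suc m)" if "i \<in> N" for i
          proof -
            have "(\<Sum>r\<le>m. c r * gmat \<tau> (merge J1 J2 (x, y)) i r) = (\<Sum>r\<le>m. c r * gmat \<tau> (merge J1 J2 (x, y0)) i r)"
              by (intro sum.cong refl arg_cong2[where f = "(*)"] same that) auto
            then show ?thesis using last[OF that, of y] by (simp add: comb_def)
          qed
          have "0 = (\<Sum>i\<in>I. b i * comb (Suc m) (gmat \<tau> (merge J1 J2 (x, y))) c i)" using c by simp
          also have "\<dots> = (\<Sum>i\<in>I. b i * comb m (gmat \<tau> (merge J1 J2 (x, y0))) c i + c (Suc m) * (b i * y (i, Suc m)))"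
            using split I by (intro sum.cong) (auto simp: algebra_simps)
          also have "\<dots> = c (Suc m) * (\<Sum>i\<in>I. b i * y (i, Suc m))"
            using b(2) by (simp add: sum.distrib sum_comb sum_distrib_left)
          finally have c0: "c (Suc m) = 0" using nz by simp
          have "\<forall>i\<in>I. comb m (gmat \<tau> (merge J1 J2 (x, y0))) c i = 0"
          proof
            fix i assume "i \<in> I"
            then show "comb m (gmat \<tau> (merge J1 J2 (x, y0))) c i = 0"
              using c split[of i] I(1) c0 by auto
          qed
          moreover obtain I' where "I' \<subseteq> I" "card I' = Suc m"
            using obtain_subset_with_card_n[of "Suc m" I] I(2) by auto
          ultimately have "\<forall>i\<in>I'. comb m (gmat \<tau> (merge J1 J2 (x, y0))) c i = 0" "I' \<subseteq> N" "card I' = Suc m"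
            using I(1) by blast+
          then have "\<forall>r\<le>m. c r = 0" using y0 unfolding genpos_def by simp
          with c0 show "\<forall>r\<le>Suc m. c r = 0" by (auto simp: le_Suc_eq)
        qed
      qed
    qed
    then have "AE y in gauss J2. \<forall>I\<in>{I. I \<subseteq> N \<and> card I = Suc (Suc m)}. G I y"
      using N by (intro AE_finite_allI) auto
    then show "AE y in gauss J2. genpos N (gmat \<tau> (merge J1 J2 (x, y))) (Suc m)"
      by (rule AE_mp) (auto simp: G_def genpos_def)
  qed
  then show ?case
    unfolding J(4) by (subst AE_gauss_split[OF J(1-3) meas[OF Suc.prems]])
qed

text \<open>The same orthonormal mixing of rows is applied in every column; its matrix on pairs is
  block diagonal with equal blocks.\<close>

lemma gauss_row_image:
  fixes l :: "'j \<Rightarrow> 'i \<Rightarrow> real" and D :: "'c set"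
  assumes fin: "finite R" "finite R'" "finite D"
    and l: "\<And>i j. i \<in> R' \<Longrightarrow> j \<in> R' \<Longrightarrow> (\<Sum>k\<in>R. l i k * l j k) = (if i = j then 1 else 0)"
  shows "distr (gauss (R \<times> D)) (PiM (R' \<times> D) (\<lambda>_. borel))
      (\<lambda>x. \<lambda>p\<in>R' \<times> D. \<Sum>k\<in>R. l (fst p) k * x (k, snd p)) = gauss (R' \<times> D)"
proof -
  define L :: "'j \<times> 'c \<Rightarrow> 'i \<times> 'c \<Rightarrow> real"
    where "L p q = (if snd p = snd q then l (fst p) (fst q) else 0)" for p q
  have sumL: "(\<Sum>q\<in>R \<times> D. L p q * f q) = (\<Sum>k\<in>R. l (fst p) k * f (k, snd p))" if "snd p \<in> D" for p f
  proof -
    have "(\<Sum>q\<in>R \<times> D. L p q * f q) = (\<Sum>k\<in>R. \<Sum>c\<in>D. L p (k, c) * f (k, c))"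
      by (simp add: sum.cartesian_product)
    also have "\<dots> = (\<Sum>k\<in>R. l (fst p) k * f (k, snd p))"
    proof (rule sum.cong[OF refl])
      fix k
      have "(\<Sum>c\<in>D. L p (k, c) * f (k, c)) = (\<Sum>c\<in>D. if c = snd p then l (fst p) k * f (k, snd p) else 0)"
        by (intro sum.cong) (auto simp: L_def)
      then show "(\<Sum>c\<in>D. L p (k, c) * f (k, c)) = l (fst p) k * f (k, snd p)"
        using that fin by simp
    qed
    finally show ?thesis .
  qed
  have "distr (gauss (R \<times> D)) (PiM (R' \<times> D) (\<lambda>_. borel)) (\<lambda>x. \<lambda>p\<in>R' \<times> D. \<Sum>q\<in>R \<times> D. L p q * x q) = gauss (R' \<times> D)"
  proof (rule gauss_linear_image)
    fix p p' assume p: "p \<in> R' \<times> D" "p' \<in> R' \<times> D"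
    then have "(\<Sum>q\<in>R \<times> D. L p q * L p' q) = (\<Sum>k\<in>R. l (fst p) k * L p' (k, snd p))"
      by (intro sumL) auto
    also have "\<dots> = (if snd p' = snd p then (\<Sum>k\<in>R. l (fst p) k * l (fst p') k) else 0)"
      by (simp add: L_def)
    also have "\<dots> = (if p = p' then 1 else 0)" using p l[of "fst p" "fst p'"] by (auto simp: prod_eq_iff)
    finally show "(\<Sum>q\<in>R \<times> D. L p q * L p' q) = (if p = p' then 1 else 0)" .
  qed (use fin in auto)
  also have "(\<lambda>x. \<lambda>p\<in>R' \<times> D. \<Sum>q\<in>R \<times> D. L p q * x q) = (\<lambda>x. \<lambda>p\<in>R' \<times> D. \<Sum>k\<in>R. l (fst p) k * x (k, snd p))"
    by (intro ext restrict_ext sumL) auto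
  finally show ?thesis .
qed

section \<open>The probability of being a facet\<close>

lemma comb_cong: "(\<And>r. r \<le> m \<Longrightarrow> a i r = a' i r) \<Longrightarrow> comb m a c i = comb m a' c i"
  by (simp add: comb_def)

lemma feas_cong:
  assumes "\<And>i r. i \<in> Z \<union> S \<Longrightarrow> r \<le> m \<Longrightarrow> a i r = a' i r"
  shows "feas m a Z S = feas m a' Z S"
proof -
  have "comb m a c i = comb m a' c i" if "i \<in> Z \<union> S" for c i
    using assms that by (intro comb_cong) auto
  then show ?thesis unfolding feas_def by (intro arg_cong[where f = Ex] ext) auto
qed

lemma genpos_cong:
  assumes "\<And>i r. i \<in> N \<Longrightarrow> r \<le> m \<Longrightarrow> a i r = a' i r"
  shows "genpos N a m = genpos N a' m"
proof -
  have "(\<forall>i\<in>I. comb m a c i = 0) = (\<forall>i\<in>I. comb m a' c i = 0)" if "I \<subseteq> N" for c I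
    using assms that comb_cong[of m a _ a'] by (intro ball_cong refl arg_cong[where f = "\<lambda>x. x = 0"] comb_cong) auto
  then show ?thesis unfolding genpos_def by (intro arg_cong[where f = All] ext) auto
qed

lemma possol_cong:
  assumes "\<And>i r. i \<in> I \<Longrightarrow> r \<le> p \<Longrightarrow> a i r = a' i r"
  shows "possol p a I A = possol p a' I A"
proof -
  have "(\<Sum>i\<in>I. b i * a i r) = (\<Sum>i\<in>I. b i * a' i r)" if "r \<le> p" for b r
    using assms that by (intro sum.cong) auto
  then show ?thesis unfolding possol_def by (intro arg_cong[where f = Ex] ext) auto
qed

lemma comb_0: "comb m a c i = c 0 * a i 0 + (\<Sum>r\<in>{1..m}. c r * a i r)"
proof -
  have "{..m} = insert 0 {1..m}" by auto
  then show ?thesis by (simp add: comb_def)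
qed

text \<open>Up to sign there is only one row combination vanishing on \<open>I\<close>.\<close>

lemma feas_iff_sign:
  assumes gp: "genpos N a m" and fin: "finite N" and I: "I \<subseteq> N" "card I = m" and m: "m < card N"
    and c: "\<And>i. i \<in> I \<Longrightarrow> comb m a c i = 0" "\<exists>r\<le>m. c r \<noteq> 0"
  shows "feas m a I (N - I) \<longleftrightarrow> (\<forall>j\<in>N - I. comb m a c j < 0) \<or> (\<forall>j\<in>N - I. 0 < comb m a c j)"
proof
  assume "feas m a I (N - I)"
  then obtain c' where c': "\<And>i. i \<in> I \<Longrightarrow> comb m a c' i = 0" "\<And>j. j \<in> N - I \<Longrightarrow> comb m a c' j < 0"
    unfolding feas_def by blast
  have fI: "finite I" using I fin finite_subset by blast
  have "0 < card (N - I)" using I m fI by (simp add: card_Diff_subset)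
  then obtain j0 where j0: "j0 \<in> N - I" by (metis card_gt_0_iff ex_in_conv)
  define s t where "s = comb m a c' j0" and "t = comb m a c j0"
  have s: "s < 0" using c'(2)[OF j0] by (simp add: s_def)
  \<comment> \<open>The combination that also cancels at \<open>j0\<close> has \<open>m + 1\<close>
    zeros, hence is trivial.\<close>
  have proportional: "s * comb m a c j = t * comb m a c' j" if "j \<in> N - I" for j
  proof -
    define e where "e = (\<lambda>r. s * c r - t * c' r)"
    have e: "comb m a e i = s * comb m a c i - t * comb m a c' i" for i
      by (simp add: e_def comb_diff comb_scale)
    have "comb m a e i = 0" if "i \<in> insert j0 I" for i
      using that c(1) c'(1) by (auto simp: e s_def t_def)
    then have "\<forall>r\<le>m. e r = 0"
      using gp I j0 fI unfolding genpos_def by (auto dest!: spec[of _ "insert j0 I"])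
    then have "comb m a e j = 0" by (simp add: comb_def)
    then show ?thesis by (simp add: e)
  qed
  have "t \<noteq> 0"
  proof
    assume "t = 0"
    then have "comb m a c i = 0" if "i \<in> insert j0 I" for i
      using that c(1) by (auto simp: t_def)
    then have "\<forall>r\<le>m. c r = 0"
      using gp I j0 fI unfolding genpos_def by (auto dest!: spec[of _ "insert j0 I"])
    then show False using c(2) by auto
  qed
  then consider "t < 0" | "t > 0" by linarith
  then show "(\<forall>j\<in>N - I. comb m a c j < 0) \<or> (\<forall>j\<in>N - I. 0 < comb m a c j)"
  proof cases
    case 1
    have "comb m a c j < 0" if j: "j \<in> N - I" for j
    proof -
      have "0 < s * comb m a c j" using proportional[OF j] c'(2)[OF j] 1 by (simp add: mult_neg_neg)
      then show ?thesis using s by (auto simp: zero_less_mult_iff)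
    qed
    then show ?thesis by blast
  next
    case 2
    have "0 < comb m a c j" if j: "j \<in> N - I" for j
    proof -
      have "s * comb m a c j < 0" using proportional[OF j] c'(2)[OF j] 2 by (simp add: mult_pos_neg)
      then show ?thesis using s by (auto simp: mult_less_0_iff)
    qed
    then show ?thesis by blast
  qed
next
  assume "(\<forall>j\<in>N - I. comb m a c j < 0) \<or> (\<forall>j\<in>N - I. 0 < comb m a c j)"
  then show "feas m a I (N - I)"
  proof
    assume "\<forall>j\<in>N - I. comb m a c j < 0"
    then show ?thesis unfolding feas_def using c(1) by blast
  next
    assume "\<forall>j\<in>N - I. 0 < comb m a c j"
    then show ?thesis unfolding feas_def
      using c(1) by (intro exI[of _ "\<lambda>r. (-1) * c r"] conjI ballI; subst comb_scale) auto
  qed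
qed

text \<open>The rows in \<open>I\<close> are put together from the part of \<open>x\<close> orthogonal to \<open>\<tau>\<close> and, in the direction of
  \<open>\<tau>\<close>, from the additional row \<open>0\<close> of \<open>y\<close>; this preserves the Gaussian law.\<close>

definition split_entry ::
    "(nat \<Rightarrow> real) \<Rightarrow> nat set \<Rightarrow> (nat \<times> nat \<Rightarrow> real) \<Rightarrow> (nat \<times> nat \<Rightarrow> real) \<Rightarrow> nat \<Rightarrow> nat \<Rightarrow> real"
  where "split_entry \<tau> I x y i r = (if r = 0 then \<tau> i
    else if i \<in> I then x (i, r) - \<tau> i / (\<Sum>k\<in>I. (\<tau> k)\<^sup>2) * (\<Sum>k\<in>I. \<tau> k * x (k, r))
      + \<tau> i / sqrt (\<Sum>k\<in>I. (\<tau> k)\<^sup>2) * y (0, r)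
    else y (i, r))"

text \<open>Negating \<open>L\<close> leaves the covariance unchanged, so the two opposite orthants,
  which are disjoint since \<open>P\<close> is nonempty, have equal probability. Both factors 2 in
  the facet and sign probabilities come from here.\<close>

lemma orthant_pair_measure:
  assumes J: "finite J" and P: "finite P" "P \<noteq> {}"
    and cov: "\<And>i j. i \<in> P \<Longrightarrow> j \<in> P \<Longrightarrow> (\<Sum>q\<in>J. L i q * L j q) = 1 / a + (if i = j then 1 / l i else 0)"
  shows "emeasure (gauss J) {y\<in>space (gauss J). (\<forall>p\<in>P. (\<Sum>q\<in>J. L p q * y q) < 0) \<or> (\<forall>p\<in>P. 0 < (\<Sum>q\<in>J. L p q * y q))} =
    ennreal (2 * gauss_orthant P a l)"
proof -
  interpret prob_space "gauss J" by (rule prob_space_gauss)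
  define E F where "E = {y\<in>space (gauss J). \<forall>p\<in>P. (\<Sum>q\<in>J. L p q * y q) < 0}"
    and "F = {y\<in>space (gauss J). \<forall>p\<in>P. (\<Sum>q\<in>J. (- L p q) * y q) < 0}"
  have [measurable]: "(\<lambda>y. \<Sum>q\<in>J. L p q * y q) \<in> borel_measurable (gauss J)" for p
    by (intro borel_measurable_sum borel_measurable_times borel_measurable_const gauss_component)
  have [measurable]: "(\<lambda>y. \<Sum>q\<in>J. (- L p q) * y q) \<in> borel_measurable (gauss J)" for p
    by (intro borel_measurable_sum borel_measurable_times borel_measurable_const gauss_component)
  have EF: "E \<in> sets (gauss J)" "F \<in> sets (gauss J)"
    unfolding E_def F_def using P(1) by measurable
  have "measure (gauss J) E = gauss_orthant P a l"
    unfolding E_def by (rule gauss_orthant_eq[symmetric, OF P(2) centered_gaussian_linear[OF J P(1)] cov])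
  moreover have "measure (gauss J) F = gauss_orthant P a l"
    unfolding F_def
    by (rule gauss_orthant_eq[symmetric, OF P(2) centered_gaussian_linear[OF J P(1)]]) (use cov in simp)
  moreover have "E \<inter> F = {}" using P(2) by (fastforce simp: E_def F_def sum_negf)
  then have "measure (gauss J) (E \<union> F) = measure (gauss J) E + measure (gauss J) F"
    by (rule finite_measure_Union[OF EF])
  moreover have "{y\<in>space (gauss J). (\<forall>p\<in>P. (\<Sum>q\<in>J. L p q * y q) < 0) \<or> (\<forall>p\<in>P. 0 < (\<Sum>q\<in>J. L p q * y q))} = E \<union> F"
    by (auto simp: E_def F_def sum_negf)
  ultimately show ?thesis by (simp add: emeasure_eq_measure)
qed

lemma orthant_nonneg:
  assumes "finite J" "finite P" "P \<noteq> {}"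
    and "\<And>i j. i \<in> P \<Longrightarrow> j \<in> P \<Longrightarrow> (\<Sum>q\<in>J. L i q * L j q) = 1 / a + (if i = j then 1 / l i else 0)"
  shows "0 \<le> gauss_orthant P a l"
  using gauss_orthant_eq[OF assms(3) centered_gaussian_linear[OF assms(1,2)] assms(4)] by simp

text \<open>With \<open>x\<close> fixed, the projected rows of \<open>I\<close> are orthogonal to
  \<open>\<tau>\<close> and span at most \<open>m - 1\<close> dimensions, so a unit vector
  \<open>v\<close> independent of \<open>y\<close> annihilates them. It is the normal of the
  hyperplane through the points of \<open>I\<close>; the auxiliary row 0 only shifts its offset. The
  facet event compares the values at the other points with this offset, which gives the covariance
  \<open>1 / T + \<delta> / \<tau>^2\<close> for every \<open>x\<close> whose
  \<open>y\<close>-sections are generic.\<close>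

lemma facet_section:
  fixes \<tau> :: "nat \<Rightarrow> real" and x :: "nat \<times> nat \<Rightarrow> real"
  defines "T \<equiv> \<lambda>I. \<Sum>k\<in>I. (\<tau> k)\<^sup>2"
  assumes N: "finite N" "0 \<notin> N" and \<tau>: "\<And>i. i \<in> N \<Longrightarrow> 0 < \<tau> i"
    and I: "I \<subseteq> N" "card I = m" and m: "1 \<le> m" "m < card N" "m \<le> d"
    and gp: "AE y in gauss (insert 0 (N - I) \<times> {1..d}). genpos N (split_entry \<tau> I x y) m"
  shows "emeasure (gauss (insert 0 (N - I) \<times> {1..d}))
      {y\<in>space (gauss (insert 0 (N - I) \<times> {1..d})). feas m (split_entry \<tau> I x y) I (N - I)} =
    ennreal (2 * gauss_orthant (N - I) (T I) (\<lambda>j. (\<tau> j)\<^sup>2))"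
proof -
  define J where "J = insert 0 (N - I) \<times> {1..d}"
  have J: "finite J" using N by (auto simp: J_def)
  have fI: "finite I" using I N finite_subset by blast
  obtain i0 where i0: "i0 \<in> I" using I m by fastforce
  have Tpos: "T I > 0" unfolding T_def
    using fI i0 \<tau>[of i0] I by (intro sum_pos2[of I i0]) auto
  define h where "h i r = x (i, r) - \<tau> i / T I * (\<Sum>k\<in>I. \<tau> k * x (k, r))" for i r
  have h_orth: "(\<Sum>i\<in>I. \<tau> i * h i r) = 0" for r
  proof -
    define s where "s = (\<Sum>k\<in>I. \<tau> k * x (k, r))"
    have "(\<Sum>i\<in>I. \<tau> i * h i r) = s - (\<Sum>i\<in>I. (\<tau> i)\<^sup>2 * (s / T I))"
      by (simp add: h_def s_def algebra_simps sum_subtractf power2_eq_square)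
    also have "(\<Sum>i\<in>I. (\<tau> i)\<^sup>2 * (s / T I)) = T I * (s / T I)"
      by (simp add: T_def sum_distrib_right sum_divide_distrib)
    finally show ?thesis using Tpos by simp
  qed
  \<comment> \<open>Dropping the equation of \<open>i0\<close> leaves fewer equations than unknowns;
    it is recovered from the others by \<open>h_orth\<close>.\<close>
  have "card (I - {i0}) < card {1..m}" using i0 fI I m by simp
  from homogeneous_solution[OF _ _ this, of h] fI obtain v0 where
    v0: "\<exists>r\<in>{1..m}. v0 r \<noteq> 0" "\<And>i. i \<in> I - {i0} \<Longrightarrow> (\<Sum>r\<in>{1..m}. v0 r * h i r) = 0" by auto
  have v0': "(\<Sum>r\<in>{1..m}. v0 r * h i r) = 0" if "i \<in> I" for i
  proof (cases "i = i0")
    case True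
    have "(\<Sum>i\<in>I. \<tau> i * (\<Sum>r\<in>{1..m}. v0 r * h i r)) = (\<Sum>r\<in>{1..m}. v0 r * (\<Sum>i\<in>I. \<tau> i * h i r))"
      by (simp add: sum_distrib_left mult_ac) (rule sum.swap)
    also have "\<dots> = 0" using h_orth by simp
    finally have "\<tau> i0 * (\<Sum>r\<in>{1..m}. v0 r * h i0 r) = 0"
      using v0(2) fI i0 by (simp add: sum.remove[of I i0])
    then show ?thesis using \<tau>[of i0] i0 I True by auto
  qed (use v0 that in auto)
  define n2 where "n2 = sqrt (\<Sum>r\<in>{1..m}. (v0 r)\<^sup>2)"
  have n2_pos: "0 < (\<Sum>r\<in>{1..m}. (v0 r)\<^sup>2)"
    using v0(1) by (metis (no_types, lifting) finite_atLeastAtMost sum_pos2 zero_less_power2 zero_le_power2)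
  then have n2: "n2 > 0" "n2\<^sup>2 = (\<Sum>r\<in>{1..m}. (v0 r)\<^sup>2)" by (auto simp: n2_def)
  define v where "v r = v0 r / n2" for r
  have v1: "(\<Sum>r\<in>{1..m}. (v r)\<^sup>2) = 1"
    using n2 n2_pos by (simp add: v_def power_divide sum_divide_distrib[symmetric])
  have vh: "(\<Sum>r\<in>{1..m}. v r * h i r) = 0" if "i \<in> I" for i
    using v0'[OF that] by (simp add: v_def sum_divide_distrib[symmetric])
  have vnz: "\<exists>r\<in>{1..m}. v r \<noteq> 0" using v0(1) n2 by (auto simp: v_def)
  \<comment> \<open>Components of the rows along the unit normal: independent standard Gaussian
    variables.\<close>
  define q where "q y i = (\<Sum>r\<in>{1..m}. v r * y (i, r))" for y :: "nat \<times> nat \<Rightarrow> real" and i :: nat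
  define cv where "cv y r = (if r = 0 then - q y 0 / sqrt (T I) else v r)" for y r
  have cvI: "comb m (split_entry \<tau> I x y) (cv y) i = 0" if i: "i \<in> I" for y i
  proof -
    have "(\<Sum>r\<in>{1..m}. cv y r * split_entry \<tau> I x y i r) =
        (\<Sum>r\<in>{1..m}. v r * h i r + \<tau> i / sqrt (T I) * (v r * y (0, r)))"
      using i by (intro sum.cong) (auto simp: cv_def split_entry_def h_def T_def algebra_simps)
    also have "\<dots> = \<tau> i / sqrt (T I) * q y 0"
      using vh[OF i] by (simp add: sum.distrib q_def sum_distrib_left)
    finally show ?thesis by (simp add: comb_0 cv_def split_entry_def)
  qed
  have cvnz: "\<exists>r\<le>m. cv y r \<noteq> 0" for y
  proof -
    obtain r where "r \<in> {1..m}" "v r \<noteq> 0" using vnz by blast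
    then show ?thesis by (intro exI[of _ r]) (auto simp: cv_def)
  qed
  have cvJ: "comb m (split_entry \<tau> I x y) (cv y) j = \<tau> j * (q y j / \<tau> j - q y 0 / sqrt (T I))" if j: "j \<in> N - I" for y j
  proof -
    have "(\<Sum>r\<in>{1..m}. cv y r * split_entry \<tau> I x y j r) = q y j"
      unfolding q_def using j by (intro sum.cong) (auto simp: cv_def split_entry_def)
    then show ?thesis using \<tau>[of j] j by (simp add: comb_0 cv_def split_entry_def field_simps)
  qed
  \<comment> \<open>The form \<open>q y j / \<tau> j - q y 0 / sqrt (T I)\<close> as a coefficient
    matrix: \<open>u\<close> acts on rows, and \<open>w\<close>, which is \<open>v\<close> padded by
    0 up to column \<open>d\<close>, acts on columns.\<close>
  define u where "u j k = (if k = j then 1 / \<tau> j else if k = 0 then - 1 / sqrt (T I) else 0)" for j k :: nat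
  define w where "w c = (if c \<le> m then v c else 0)" for c
  define L where "L j p = u j (fst p) * w (snd p)" for j and p :: "nat \<times> nat"
  have wsum: "(\<Sum>c\<in>{1..d}. w c * f c) = (\<Sum>c\<in>{1..m}. v c * f c)" for f :: "nat \<Rightarrow> real"
    using m(3) by (intro sum.mono_neutral_cong_right) (auto simp: w_def)
  have usum: "(\<Sum>k\<in>insert 0 (N - I). u j k * f k) = f j / \<tau> j - f 0 / sqrt (T I)" if j: "j \<in> N - I" for j and f :: "nat \<Rightarrow> real"
  proof -
    have "(\<Sum>k\<in>N - I. u j k * f k) = (\<Sum>k\<in>N - I. if k = j then f j / \<tau> j else 0)"
      using N by (intro sum.cong) (auto simp: u_def)
    also have "\<dots> = f j / \<tau> j" using j N by simp
    finally have *: "(\<Sum>k\<in>N - I. u j k * f k) = f j / \<tau> j" .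
    have "u j 0 = - 1 / sqrt (T I)" using j N by (auto simp: u_def)
    then show ?thesis using N * by simp
  qed
  have Lsum: "(\<Sum>p\<in>J. L j p * y p) = q y j / \<tau> j - q y 0 / sqrt (T I)" if j: "j \<in> N - I" for j y
  proof -
    have "(\<Sum>p\<in>J. L j p * y p) = (\<Sum>k\<in>insert 0 (N - I). \<Sum>c\<in>{1..d}. u j k * (w c * y (k, c)))"
      unfolding J_def L_def by (simp add: sum.cartesian_product mult.assoc case_prod_unfold)
    also have "\<dots> = (\<Sum>k\<in>insert 0 (N - I). u j k * q y k)"
      unfolding sum_distrib_left[symmetric] wsum q_def ..
    also have "\<dots> = q y j / \<tau> j - q y 0 / sqrt (T I)" by (rule usum[OF j])
    finally show ?thesis .
  qed
  have cov: "(\<Sum>p\<in>J. L i p * L j p) = 1 / T I + (if i = j then 1 / (\<tau> i)\<^sup>2 else 0)"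
    if ij: "i \<in> N - I" "j \<in> N - I" for i j
  proof -
    have "(\<Sum>p\<in>J. L i p * L j p) = (\<Sum>k\<in>insert 0 (N - I). \<Sum>c\<in>{1..d}. (u i k * u j k) * (w c * w c))"
      unfolding J_def L_def by (simp add: sum.cartesian_product mult_ac case_prod_unfold)
    also have "\<dots> = (\<Sum>k\<in>insert 0 (N - I). u i k * u j k)"
    proof -
      have "(\<Sum>c\<in>{1..d}. w c * w c) = (\<Sum>c\<in>{1..m}. v c * w c)" by (rule wsum)
      also have "\<dots> = 1" using v1 by (simp add: w_def power2_eq_square)
      finally show ?thesis by (simp only: sum_distrib_left[symmetric] mult_1_right)
    qed
    also have "\<dots> = u j i / \<tau> i - u j 0 / sqrt (T I)" by (rule usum[OF ij(1)])
    also have "\<dots> = 1 / T I + (if i = j then 1 / (\<tau> i)\<^sup>2 else 0)"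
    proof -
      have "i \<noteq> 0" "j \<noteq> 0" using ij N(2) by (metis DiffD1)+
      then show ?thesis using Tpos by (auto simp: u_def power2_eq_square)
    qed
    finally show ?thesis .
  qed
  have cN: "N - I \<noteq> {}" using I m fI by (metis Diff_eq_empty_iff less_irrefl subset_antisym)
  have "emeasure (gauss J) {y\<in>space (gauss J). feas m (split_entry \<tau> I x y) I (N - I)} =
    emeasure (gauss J) {y\<in>space (gauss J). (\<forall>j\<in>N - I. (\<Sum>p\<in>J. L j p * y p) < 0) \<or> (\<forall>j\<in>N - I. 0 < (\<Sum>p\<in>J. L j p * y p))}"
  proof (rule emeasure_eq_AE)
    show "AE y in gauss J. y \<in> {y\<in>space (gauss J). feas m (split_entry \<tau> I x y) I (N - I)} \<longleftrightarrow>
      y \<in> {y\<in>space (gauss J). (\<forall>j\<in>N - I. (\<Sum>p\<in>J. L j p * y p) < 0) \<or> (\<forall>j\<in>N - I. 0 < (\<Sum>p\<in>J. L j p * y p))}"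
      using gp[folded J_def]
    proof eventually_elim
      fix y assume gy: "genpos N (split_entry \<tau> I x y) m"
      have "feas m (split_entry \<tau> I x y) I (N - I) \<longleftrightarrow>
        (\<forall>j\<in>N - I. comb m (split_entry \<tau> I x y) (cv y) j < 0) \<or> (\<forall>j\<in>N - I. 0 < comb m (split_entry \<tau> I x y) (cv y) j)"
        by (rule feas_iff_sign[OF gy N(1) I m(2) cvI]) (assumption, rule cvnz)
      also have "\<dots> \<longleftrightarrow> (\<forall>j\<in>N - I. (\<Sum>p\<in>J. L j p * y p) < 0) \<or> (\<forall>j\<in>N - I. 0 < (\<Sum>p\<in>J. L j p * y p))"
      proof -
        have "comb m (split_entry \<tau> I x y) (cv y) j < 0 \<longleftrightarrow> (\<Sum>p\<in>J. L j p * y p) < 0"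
          "0 < comb m (split_entry \<tau> I x y) (cv y) j \<longleftrightarrow> 0 < (\<Sum>p\<in>J. L j p * y p)" if j: "j \<in> N - I" for j
        proof -
          have "0 < \<tau> j" using \<tau> j by blast
          then show "comb m (split_entry \<tau> I x y) (cv y) j < 0 \<longleftrightarrow> (\<Sum>p\<in>J. L j p * y p) < 0"
            "0 < comb m (split_entry \<tau> I x y) (cv y) j \<longleftrightarrow> 0 < (\<Sum>p\<in>J. L j p * y p)"
            unfolding cvJ[OF j] Lsum[OF j] by (auto simp: mult_less_0_iff zero_less_mult_iff)
        qed
        then show ?thesis by auto
      qed
      finally show "y \<in> {y\<in>space (gauss J). feas m (split_entry \<tau> I x y) I (N - I)} \<longleftrightarrow>
        y \<in> {y\<in>space (gauss J). (\<forall>j\<in>N - I. (\<Sum>p\<in>J. L j p * y p) < 0) \<or> (\<forall>j\<in>N - I. 0 < (\<Sum>p\<in>J. L j p * y p))}"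
        by simp
    qed
    show "{y\<in>space (gauss J). feas m (split_entry \<tau> I x y) I (N - I)} \<in> sets (gauss J)"
    proof (rule feas_measurable)
      fix i r assume ir: "i \<in> I \<union> (N - I)" "r \<le> m"
      consider "r = 0" | "r \<noteq> 0" "i \<in> I" | "r \<noteq> 0" "i \<notin> I" by blast
      then show "(\<lambda>y. split_entry \<tau> I x y i r) \<in> borel_measurable (gauss J)"
      proof cases
        case 1
        then show ?thesis by (simp add: split_entry_def)
      next
        case 2
        have "(\<lambda>y. y (0, r)) \<in> borel_measurable (gauss J)"
          using 2 ir m by (intro gauss_component) (auto simp: J_def)
        then show ?thesis unfolding split_entry_def if_not_P[OF 2(1)] if_P[OF 2(2)]
          by (intro borel_measurable_add borel_measurable_times borel_measurable_const)
      next
        case 3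
        show ?thesis unfolding split_entry_def if_not_P[OF 3(1)] if_not_P[OF 3(2)]
          using 3 ir m by (intro gauss_component) (auto simp: J_def)
      qed
    qed (use N fI in auto)
    have "(\<lambda>y. \<Sum>p\<in>J. L j p * y p) \<in> borel_measurable (gauss J)" for j
      by (intro borel_measurable_sum borel_measurable_times borel_measurable_const gauss_component)
    then show "{y\<in>space (gauss J). (\<forall>j\<in>N - I. (\<Sum>p\<in>J. L j p * y p) < 0) \<or> (\<forall>j\<in>N - I. 0 < (\<Sum>p\<in>J. L j p * y p))} \<in> sets (gauss J)"
      using N by (intro sets.sets_Collect_disj sets.sets_Collect_finite_All borel_measurable_less borel_measurable_const) auto
  qed
  also have "\<dots> = ennreal (2 * gauss_orthant (N - I) (T I) (\<lambda>j. (\<tau> j)\<^sup>2))"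
    by (rule orthant_pair_measure[OF J _ cN cov]) (use N in auto)
  finally show ?thesis unfolding J_def .
qed

text \<open>Column 0 forces a dependency to be orthogonal to \<open>\<tau>\<close>, and in each
  other column the split rows differ from the original ones by a common multiple of
  \<open>\<tau> i\<close>. So the sign event does not see the part along
  \<open>\<tau>\<close>.\<close>

lemma possol_split_entry:
  assumes "finite I"
  shows "possol p (split_entry \<tau> I x y) I A = possol p (gmat \<tau> x) I A"
proof -
  have eq: "(\<Sum>i\<in>I. b i * split_entry \<tau> I x y i r) = (\<Sum>i\<in>I. b i * gmat \<tau> x i r)"
    if b: "(\<Sum>i\<in>I. b i * \<tau> i) = 0" for b r
  proof (cases "r = 0")
    case False
    define s where "s = y (0, r) / sqrt (\<Sum>k\<in>I. (\<tau> k)\<^sup>2) - (\<Sum>k\<in>I. \<tau> k * x (k, r)) / (\<Sum>k\<in>I. (\<tau> k)\<^sup>2)"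
    have "(\<Sum>i\<in>I. b i * split_entry \<tau> I x y i r) = (\<Sum>i\<in>I. b i * gmat \<tau> x i r + b i * \<tau> i * s)"
      using False by (intro sum.cong) (auto simp: split_entry_def gmat_def s_def algebra_simps)
    also have "\<dots> = (\<Sum>i\<in>I. b i * gmat \<tau> x i r) + (\<Sum>i\<in>I. b i * \<tau> i) * s"
      by (simp add: sum.distrib sum_distrib_right)
    finally show ?thesis using b by simp
  qed (simp add: split_entry_def gmat_def)
  have "(\<forall>r\<le>p. (\<Sum>i\<in>I. b i * split_entry \<tau> I x y i r) = 0) \<longleftrightarrow> (\<forall>r\<le>p. (\<Sum>i\<in>I. b i * gmat \<tau> x i r) = 0)" for b
  proof (cases "(\<Sum>i\<in>I. b i * \<tau> i) = 0")
    case True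
    then show ?thesis by (simp add: eq)
  next
    case False
    then have "(\<Sum>i\<in>I. b i * split_entry \<tau> I x y i 0) \<noteq> 0" "(\<Sum>i\<in>I. b i * gmat \<tau> x i 0) \<noteq> 0"
      by (simp_all add: split_entry_def gmat_def)
    then show ?thesis by blast
  qed
  then show ?thesis unfolding possol_def by simp
qed

text \<open>Independence is obtained by enlarging the sample space: the component of the rows
  \<open>I\<close> along \<open>\<tau>\<close> is replaced by an independent row 0, available since
  \<open>0\<close> is not in \<open>N\<close>. The entries \<open>x\<close> then decide the sign
  event alone, and the facet event has the same conditional probability for almost every
  \<open>x\<close>.\<close>

lemma facet_prob:
  fixes \<tau> :: "nat \<Rightarrow> real"
  defines "T \<equiv> \<lambda>I. \<Sum>k\<in>I. (\<tau> k)\<^sup>2"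
  assumes N: "finite N" "0 \<notin> N" and \<tau>: "\<And>i. i \<in> N \<Longrightarrow> 0 < \<tau> i"
    and I: "I \<subseteq> N" "card I = m" and m: "1 \<le> m" "m < card N" "m \<le> d" and p: "p \<le> d"
  shows "emeasure (gauss (N \<times> {1..d}))
      {x\<in>space (gauss (N \<times> {1..d})). feas m (gmat \<tau> x) I (N - I) \<and> possol p (gmat \<tau> x) I A} =
    ennreal (2 * gauss_orthant (N - I) (T I) (\<lambda>j. (\<tau> j)\<^sup>2)) *
      emeasure (gauss (I \<times> {1..d})) {x\<in>space (gauss (I \<times> {1..d})). possol p (gmat \<tau> x) I A}"
proof -
  define D where "D = {1..d}"
  define J1 J2 where "J1 = I \<times> D" and "J2 = insert 0 (N - I) \<times> D"
  have fI: "finite I" using I N finite_subset by blast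
  have J: "finite J1" "finite J2" "J1 \<inter> J2 = {}" "insert 0 N \<times> D = J1 \<union> J2"
    using N I fI by (auto simp: J1_def J2_def D_def)
  obtain i0 where i0: "i0 \<in> I" using I m by fastforce
  have Tpos: "T I > 0" unfolding T_def
    using fI i0 \<tau>[of i0] I by (intro sum_pos2[of I i0]) auto
  define \<delta> :: "nat \<Rightarrow> nat \<Rightarrow> real" where "\<delta> i k = (if k = i then 1 else 0)" for i k
  \<comment> \<open>On \<open>I\<close> this is the orthogonal projection along
    \<open>\<tau>\<close> plus the unit vector \<open>\<tau> / sqrt T\<close> times row 0; elsewhere
    it is the identity. Its rows are orthonormal although there is one more input row than output
    rows.\<close>
  define l where "l i k = (if i \<in> I then (if k = 0 then \<tau> i / sqrt (T I)
    else if k \<in> I then \<delta> i k - \<tau> i * \<tau> k / T I else 0) else \<delta> i k)" for i k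
  have \<delta>sum: "(\<Sum>k\<in>S. \<delta> i k * f k) = f i" if "finite S" "i \<in> S" for S f i
  proof -
    have "(\<Sum>k\<in>S. \<delta> i k * f k) = (\<Sum>k\<in>S. if k = i then f i else 0)"
      by (intro sum.cong) (auto simp: \<delta>_def)
    then show ?thesis using that by simp
  qed
  have lsumI: "(\<Sum>k\<in>insert 0 N. l i k * f k) = f i - \<tau> i / T I * (\<Sum>k\<in>I. \<tau> k * f k) + \<tau> i / sqrt (T I) * f 0"
    if i: "i \<in> I" for i f
  proof -
    have "(\<Sum>k\<in>N. l i k * f k) = (\<Sum>k\<in>I. \<delta> i k * f k - \<tau> i / T I * (\<tau> k * f k))"
      using i I N by (intro sum.mono_neutral_cong_right) (auto simp: l_def algebra_simps)
    also have "\<dots> = f i - \<tau> i / T I * (\<Sum>k\<in>I. \<tau> k * f k)"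
      using \<delta>sum[OF fI i] by (simp add: sum_subtractf sum_distrib_left)
    finally show ?thesis using N i by (simp add: l_def)
  qed
  have lsumN: "(\<Sum>k\<in>insert 0 N. l i k * f k) = f i" if i: "i \<in> N - I" for i f
    using \<delta>sum[of "insert 0 N" i f] N i by (simp add: l_def)
  have lorth: "(\<Sum>k\<in>insert 0 N. l i k * l j k) = (if i = j then 1 else 0)" if ij: "i \<in> N" "j \<in> N" for i j
  proof (cases "i \<in> I")
    case True
    show ?thesis
    proof (cases "j \<in> I")
      case jI: True
      have "(\<Sum>k\<in>I. \<tau> k * l j k) = (\<Sum>k\<in>I. \<delta> j k * \<tau> k - \<tau> j / T I * (\<tau> k)\<^sup>2)"
        using jI I N by (intro sum.cong) (auto simp: l_def algebra_simps power2_eq_square)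
      also have "\<dots> = \<tau> j - \<tau> j / T I * T I"
        unfolding sum_subtractf \<delta>sum[OF fI jI] by (simp only: T_def sum_distrib_left)
      finally have "(\<Sum>k\<in>I. \<tau> k * l j k) = 0" using Tpos by simp
      moreover have "i \<noteq> 0" "j \<noteq> 0" using ij N(2) by metis+
      ultimately show ?thesis using True jI lsumI[OF True, of "l j"] Tpos
        by (auto simp: l_def \<delta>_def power2_eq_square)
    next
      case False
      then have "(\<Sum>k\<in>I. \<tau> k * l j k) = 0" by (intro sum.neutral) (auto simp: l_def \<delta>_def)
      moreover have "i \<noteq> 0" "j \<noteq> 0" "i \<noteq> j" using ij N(2) False True by metis+
      ultimately show ?thesis using False lsumI[OF True, of "l j"] by (simp add: l_def \<delta>_def)
    qed
  next
    case False
    then have "(\<Sum>k\<in>insert 0 N. l i k * l j k) = l j i" using ij by (intro lsumN) auto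
    also have "\<dots> = (if i = j then 1 else 0)" using False ij N by (auto simp: l_def \<delta>_def)
    finally show ?thesis .
  qed
  define \<Phi> where "\<Phi> x = (\<lambda>q\<in>N \<times> D. \<Sum>k\<in>insert 0 N. l (fst q) k * x (k, snd q))" for x :: "nat \<times> nat \<Rightarrow> real"
  have law: "distr (gauss (J1 \<union> J2)) (PiM (N \<times> D) (\<lambda>_. borel)) \<Phi> = gauss (N \<times> D)"
    unfolding \<Phi>_def J(4)[symmetric] using N lorth by (intro gauss_row_image) (auto simp: D_def)
  have \<Phi>_meas: "\<Phi> \<in> measurable (gauss (J1 \<union> J2)) (gauss (N \<times> D))"
  proof -
    have "\<Phi> \<in> measurable (gauss (J1 \<union> J2)) (PiM (N \<times> D) (\<lambda>_. borel))"
      unfolding \<Phi>_def J(4)[symmetric]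
      by (intro measurable_restrict borel_measurable_sum borel_measurable_times borel_measurable_const gauss_component) auto
    then show ?thesis by (simp cong: measurable_cong_sets)
  qed
  have entry: "gmat \<tau> (\<Phi> (merge J1 J2 (x, y))) i r = split_entry \<tau> I x y i r" if i: "i \<in> N" and r: "r \<le> d" for x y i r
  proof (cases "r = 0")
    case False
    then have rD: "r \<in> D" using r by (simp add: D_def)
    have mI: "merge J1 J2 (x, y) (k, r) = x (k, r)" if "k \<in> I" for k
      using that rD by (simp add: merge_def J1_def)
    have mJ: "merge J1 J2 (x, y) (k, r) = y (k, r)" if "k \<in> insert 0 (N - I)" for k
      using that rD N I by (auto simp: merge_def J1_def J2_def)
    show ?thesis
    proof (cases "i \<in> I")
      case True
      have "(\<Sum>k\<in>I. \<tau> k * merge J1 J2 (x, y) (k, r)) = (\<Sum>k\<in>I. \<tau> k * x (k, r))"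
        using mI by (intro sum.cong) auto
      then show ?thesis using True False rD i lsumI[OF True, of "\<lambda>k. merge J1 J2 (x, y) (k, r)"]
        by (simp add: gmat_def \<Phi>_def split_entry_def mI mJ T_def)
    next
      case iI: False
      then show ?thesis using False rD i lsumN[of i "\<lambda>k. merge J1 J2 (x, y) (k, r)"]
        by (simp add: gmat_def \<Phi>_def split_entry_def mJ)
    qed
  qed (simp add: gmat_def split_entry_def)
  define Q where "Q z \<longleftrightarrow> feas m (gmat \<tau> z) I (N - I) \<and> possol p (gmat \<tau> z) I A" for z
  have possol_sets: "{x\<in>space (gauss (I' \<times> D)). possol p (gmat \<tau> x) I A} \<in> sets (gauss (I' \<times> D))" if "I \<subseteq> I'" for I'
    using that p fI by (intro possol_measurable gmat_measurable) (auto simp: D_def)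
  have feas_sets: "{z\<in>space (gauss (N \<times> D)). feas m (gmat \<tau> z) I (N - I)} \<in> sets (gauss (N \<times> D))"
    using m I N fI by (intro feas_measurable gmat_measurable) (auto simp: D_def)
  have E: "{z\<in>space (gauss (N \<times> D)). Q z} \<in> sets (gauss (N \<times> D))"
    unfolding Q_def using sets.Int[OF feas_sets possol_sets[OF I(1)]] by (simp add: Collect_conj_eq[symmetric] Int_def conj_ac)
  have E0: "{x\<in>space (gauss (J1 \<union> J2)). Q (\<Phi> x)} = \<Phi> -` {z\<in>space (gauss (N \<times> D)). Q z} \<inter> space (gauss (J1 \<union> J2))"
    using measurable_space[OF \<Phi>_meas] by auto
  have E0': "{x\<in>space (gauss (J1 \<union> J2)). Q (\<Phi> x)} \<in> sets (gauss (J1 \<union> J2))"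
    unfolding E0 by (rule measurable_sets[OF \<Phi>_meas E])
  have gp: "AE x in gauss J1. AE y in gauss J2. genpos N (split_entry \<tau> I x y) m"
  proof -
    have "AE z in gauss (N \<times> D). genpos N (gmat \<tau> z) m"
      unfolding D_def by (rule AE_genpos[OF N(1) _ m(3)]) (use \<tau> in force)
    then have "AE z in distr (gauss (J1 \<union> J2)) (PiM (N \<times> D) (\<lambda>_. borel)) \<Phi>. genpos N (gmat \<tau> z) m"
      by (simp only: law)
    then have "AE x in gauss (J1 \<union> J2). genpos N (gmat \<tau> (\<Phi> x)) m"
      by (rule AE_distrD[rotated]) (use \<Phi>_meas in \<open>simp cong: measurable_cong_sets\<close>)
    then have "AE x in gauss J1. AE y in gauss J2. genpos N (gmat \<tau> (\<Phi> (merge J1 J2 (x, y)))) m"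
    proof (rule iffD1[OF AE_gauss_split[OF J(1-3)], rotated])
      show "{x\<in>space (gauss (J1 \<union> J2)). genpos N (gmat \<tau> (\<Phi> x)) m} \<in> sets (gauss (J1 \<union> J2))"
      proof (rule genpos_measurable[OF N(1)])
        fix i r assume ir: "i \<in> N" "r \<le> m"
        have "(\<lambda>z. gmat \<tau> z i r) \<in> borel_measurable (gauss (N \<times> D))"
          using ir m by (intro gmat_measurable) (auto simp: D_def)
        from measurable_compose[OF \<Phi>_meas this]
        show "(\<lambda>x. gmat \<tau> (\<Phi> x) i r) \<in> borel_measurable (gauss (J1 \<union> J2))" .
      qed
    qed
    moreover have "genpos N (gmat \<tau> (\<Phi> (merge J1 J2 (x, y)))) m = genpos N (split_entry \<tau> I x y) m" for x y
      by (rule genpos_cong) (use entry m in auto)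
    ultimately show ?thesis by simp
  qed
  define \<gamma> where "\<gamma> = ennreal (2 * gauss_orthant (N - I) (T I) (\<lambda>j. (\<tau> j)\<^sup>2))"
  have "emeasure (gauss (N \<times> D)) {z\<in>space (gauss (N \<times> D)). Q z} =
      emeasure (distr (gauss (J1 \<union> J2)) (PiM (N \<times> D) (\<lambda>_. borel)) \<Phi>) {z\<in>space (gauss (N \<times> D)). Q z}"
    by (simp only: law)
  also have "\<dots> = emeasure (gauss (J1 \<union> J2)) {x\<in>space (gauss (J1 \<union> J2)). Q (\<Phi> x)}"
    unfolding E0 using \<Phi>_meas E by (intro emeasure_distr) (auto cong: measurable_cong_sets)
  also have "\<dots> = (\<integral>\<^sup>+ x. emeasure (gauss J2) {y\<in>space (gauss J2). Q (\<Phi> (merge J1 J2 (x, y)))} \<partial>gauss J1)"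
    by (rule emeasure_gauss_split[OF J(1-3) E0'])
  also have "\<dots> = (\<integral>\<^sup>+ x. \<gamma> * indicator {x\<in>space (gauss J1). possol p (gmat \<tau> x) I A} x \<partial>gauss J1)"
  proof (rule nn_integral_cong_AE)
    show "AE x in gauss J1. emeasure (gauss J2) {y\<in>space (gauss J2). Q (\<Phi> (merge J1 J2 (x, y)))} =
        \<gamma> * indicator {x\<in>space (gauss J1). possol p (gmat \<tau> x) I A} x"
      using gp AE_space
    proof eventually_elim
      fix x assume gx: "AE y in gauss J2. genpos N (split_entry \<tau> I x y) m" and x: "x \<in> space (gauss J1)"
      have "feas m (gmat \<tau> (\<Phi> (merge J1 J2 (x, y)))) I (N - I) = feas m (split_entry \<tau> I x y) I (N - I)" for y
        by (rule feas_cong) (use entry m I in auto)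
      moreover have "possol p (gmat \<tau> (\<Phi> (merge J1 J2 (x, y)))) I A = possol p (split_entry \<tau> I x y) I A" for y
        by (rule possol_cong) (use entry p I in auto)
      ultimately have Q: "Q (\<Phi> (merge J1 J2 (x, y))) \<longleftrightarrow> feas m (split_entry \<tau> I x y) I (N - I) \<and> possol p (gmat \<tau> x) I A" for y
        by (simp add: Q_def possol_split_entry[OF fI])
      have "emeasure (gauss J2) {y\<in>space (gauss J2). feas m (split_entry \<tau> I x y) I (N - I)} = \<gamma>"
        unfolding \<gamma>_def J2_def D_def T_def
        by (rule facet_section[OF N \<tau> I m gx[unfolded J2_def D_def]])
      then show "emeasure (gauss J2) {y\<in>space (gauss J2). Q (\<Phi> (merge J1 J2 (x, y)))} =
        \<gamma> * indicator {x\<in>space (gauss J1). possol p (gmat \<tau> x) I A} x"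
        using x by (cases "possol p (gmat \<tau> x) I A") (simp_all add: Q)
    qed
  qed
  also have "\<dots> = \<gamma> * emeasure (gauss J1) {x\<in>space (gauss J1). possol p (gmat \<tau> x) I A}"
    by (rule nn_integral_cmult_indicator) (use possol_sets[of I] in \<open>simp add: J1_def\<close>)
  finally show ?thesis unfolding Q_def \<gamma>_def J1_def D_def .
qed

section \<open>Rotation invariant directions\<close>

text \<open>\<open>uperp x\<close> holds for two opposite unit vectors, the dependency of the rows in \<open>I\<close>.  Its
  direction and that of a projected Gaussian vector \<open>proj z\<close> are compared by counting pairs
  \<open>(x, z)\<close> whose directions are close: by rotation invariance, fixing either component gives the same
  probability, for every value of the fixed component.\<close>

locale sphere =
  fixes I :: "nat set" and \<tau> :: "nat \<Rightarrow> real" and p d :: nat and K :: "nat set"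
  assumes fI: "finite I" and cI: "card I = Suc (Suc p)" and \<tau>: "\<And>i. i \<in> I \<Longrightarrow> 0 < \<tau> i"
    and pd: "p \<le> d" and KI: "K \<subseteq> I" "K \<noteq> {}"
begin

definition ip :: "(nat \<Rightarrow> real) \<Rightarrow> (nat \<Rightarrow> real) \<Rightarrow> real"
  where "ip b z = (\<Sum>i\<in>I. b i * z i)"

definition proj :: "(nat \<Rightarrow> real) \<Rightarrow> nat \<Rightarrow> real"
  where "proj z i = z i - (ip \<tau> z / ip \<tau> \<tau>) * \<tau> i"

definition perp :: "(nat \<times> nat \<Rightarrow> real) \<Rightarrow> (nat \<Rightarrow> real) \<Rightarrow> bool"
  where "perp x b \<longleftrightarrow> (\<forall>r\<le>p. (\<Sum>i\<in>I. b i * gmat \<tau> x i r) = 0)"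

definition uperp :: "(nat \<times> nat \<Rightarrow> real) \<Rightarrow> (nat \<Rightarrow> real) \<Rightarrow> bool"
  where "uperp x b \<longleftrightarrow> perp x b \<and> ip b b = 1"

text \<open>A lower bound \<open>1 - r\<close> on the squared cosine of the angle. Both sides are
  quadratic in \<open>u\<close>, so only its direction counts, and the square identifies opposite
  unit dependencies.\<close>

definition near :: "real \<Rightarrow> (nat \<times> nat \<Rightarrow> real) \<Rightarrow> (nat \<Rightarrow> real) \<Rightarrow> bool"
  where "near r x u \<longleftrightarrow> (\<exists>b. uperp x b \<and> (1 - r) * ip u u \<le> (ip b u)\<^sup>2)"

definition X :: "(nat \<times> nat \<Rightarrow> real) measure" where "X = gauss (I \<times> {1..d})"

definition Z :: "(nat \<Rightarrow> real) measure" where "Z = gauss I"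

lemma ip_cong: "(\<And>i. i \<in> I \<Longrightarrow> b i = b' i) \<Longrightarrow> (\<And>i. i \<in> I \<Longrightarrow> z i = z' i) \<Longrightarrow> ip b z = ip b' z'"
  by (simp add: ip_def)

lemma ip_commute: "ip b z = ip z b"
  by (simp add: ip_def mult.commute)

lemma ip_diff_right: "ip b (\<lambda>i. z i - z' i) = ip b z - ip b z'"
  by (simp add: ip_def right_diff_distrib sum_subtractf)

lemma ip_scale_right: "ip b (\<lambda>i. s * z i) = s * ip b z"
  by (simp add: ip_def sum_distrib_left mult_ac)

lemma ip_diff_left: "ip (\<lambda>i. b i - b' i) z = ip b z - ip b' z"
  by (simp add: ip_def left_diff_distrib sum_subtractf)

lemma ip_scale_left: "ip (\<lambda>i. s * b i) z = s * ip b z"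
  by (simp add: ip_def sum_distrib_left mult_ac)

lemma ip_nonneg: "0 \<le> ip b b"
  by (simp add: ip_def sum_nonneg)

lemma ip_eq_0: "ip b b = 0 \<Longrightarrow> i \<in> I \<Longrightarrow> b i = 0"
  using fI by (simp add: ip_def sum_nonneg_eq_0_iff)

lemma square_le_ip: "i \<in> I \<Longrightarrow> (b i)\<^sup>2 \<le> ip b b"
  using member_le_sum[of i I "\<lambda>i. b i * b i"] fI by (simp add: ip_def power2_eq_square)

lemma T_pos: "0 < ip \<tau> \<tau>"
proof -
  obtain i where "i \<in> I" using KI by blast
  then show ?thesis unfolding ip_def using fI \<tau>[of i] by (intro sum_pos2[of I i]) auto
qed

lemma ip_tau_proj: "ip \<tau> (proj z) = 0"
  using T_pos unfolding proj_def ip_diff_right ip_scale_right by simp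

lemma ip_proj: "ip b \<tau> = 0 \<Longrightarrow> ip b (proj z) = ip b z"
  unfolding proj_def ip_diff_right ip_scale_right by simp

lemma ip_proj_proj: "ip (proj z) (proj z) = ip z z - (ip \<tau> z)\<^sup>2 / ip \<tau> \<tau>"
proof -
  have "ip (proj z) (proj z) = ip (proj z) z"
    by (rule ip_proj) (simp add: ip_commute[of "proj z"] ip_tau_proj)
  also have "\<dots> = ip z (proj z)" by (rule ip_commute)
  also have "\<dots> = ip z z - ip \<tau> z / ip \<tau> \<tau> * ip z \<tau>"
    unfolding proj_def ip_diff_right ip_scale_right ..
  finally show ?thesis by (simp add: ip_commute[of z \<tau>] power2_eq_square)
qed

section \<open>Householder reflections and invariance of the Gaussian laws\<close>

definition kern :: "(nat \<Rightarrow> real) \<Rightarrow> nat \<Rightarrow> nat \<Rightarrow> real"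
  where "kern w i k = (if i = k then 1 else 0) - 2 / ip w w * w i * w k"

text \<open>The reflection in the hyperplane orthogonal to \<open>w\<close>. If
  \<open>ip w w = 0\<close>, division by zero gives 0 and the map is the identity.\<close>

definition reflect :: "(nat \<Rightarrow> real) \<Rightarrow> (nat \<Rightarrow> real) \<Rightarrow> nat \<Rightarrow> real"
  where "reflect w z i = z i - 2 / ip w w * ip w z * w i"

lemma sum_kern: "i \<in> I \<Longrightarrow> (\<Sum>k\<in>I. kern w i k * z k) = reflect w z i"
proof -
  assume i: "i \<in> I"
  have "(\<Sum>k\<in>I. kern w i k * z k) = (\<Sum>k\<in>I. (if k = i then z i else 0) - 2 / ip w w * w i * (w k * z k))"
    by (intro sum.cong) (auto simp: kern_def algebra_simps)
  also have "\<dots> = z i - 2 / ip w w * w i * ip w z"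
    using i fI by (simp add: sum_subtractf ip_def sum_distrib_left)
  finally show ?thesis by (simp add: reflect_def mult_ac)
qed

lemma ip_refl_right: "ip b (reflect w z) = ip b z - 2 / ip w w * ip w z * ip b w"
  unfolding reflect_def ip_diff_right ip_scale_right ..

lemma ip_refl: "ip (reflect w b) (reflect w z) = ip b z"
proof (cases "ip w w = 0")
  case True
  then have "reflect w z = z" for z by (auto simp: reflect_def)
  then show ?thesis by simp
next
  case False
  have "ip (reflect w b) (reflect w z) = ip (reflect w b) z - 2 / ip w w * ip w z * ip (reflect w b) w"
    by (rule ip_refl_right)
  also have "ip (reflect w b) z = ip b z - 2 / ip w w * ip w b * ip w z"
    by (simp add: ip_commute[of "reflect w b" z] ip_refl_right ip_commute[of z b] ip_commute[of z w])
  also have "ip (reflect w b) w = - ip w b"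
    using False by (simp add: ip_commute[of "reflect w b" w] ip_refl_right)
  finally show ?thesis by simp
qed

lemma kern_orthonormal: "i \<in> I \<Longrightarrow> j \<in> I \<Longrightarrow> (\<Sum>k\<in>I. kern w i k * kern w j k) = (if i = j then 1 else 0)"
proof -
  assume ij: "i \<in> I" "j \<in> I"
  define e where "e i k = (if k = i then 1 else 0 :: real)" for i k :: nat
  have e: "ip (e i) z = z i" if "i \<in> I" for i z
  proof -
    have "ip (e i) z = (\<Sum>k\<in>I. if k = i then z i else 0)" unfolding ip_def by (intro sum.cong) (auto simp: e_def)
    then show ?thesis using that fI by simp
  qed
  have k: "kern w i k = reflect w (e i) k" if "i \<in> I" "k \<in> I" for i k
    using e[OF that(1), of w] by (simp add: kern_def reflect_def ip_commute[of w "e i"] e_def)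
  have "(\<Sum>k\<in>I. kern w i k * kern w j k) = ip (reflect w (e i)) (reflect w (e j))"
    unfolding ip_def using ij k by (intro sum.cong) auto
  also have "\<dots> = (if i = j then 1 else 0)" unfolding ip_refl e[OF ij(1)] by (auto simp: e_def)
  finally show ?thesis .
qed

text \<open>One reflection already moves any unit vector to any other, so general rotations are
  avoided. If both vectors are orthogonal to \<open>\<tau>\<close>, so is their difference, and the
  reflection fixes \<open>\<tau>\<close>.\<close>

lemma refl_swap:
  assumes "ip b b = 1" "ip b' b' = 1" "i \<in> I"
  shows "reflect (\<lambda>i. b i - b' i) b i = b' i"
proof -
  define w where "w = (\<lambda>i. b i - b' i)"
  have ww: "ip w w = 2 - 2 * ip b b'"
    using assms unfolding w_def ip_diff_left ip_diff_right by (simp add: ip_commute[of b' b])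
  have wb: "ip w b = 1 - ip b b'" unfolding w_def ip_diff_left using assms by (simp add: ip_commute[of b' b])
  show ?thesis
  proof (cases "ip w w = 0")
    case True
    with ip_eq_0[OF True assms(3)] show ?thesis unfolding w_def[symmetric] by (simp add: reflect_def w_def)
  next
    case False
    then have "2 / ip w w * ip w b = 1" using ww wb by (simp add: field_simps)
    then show ?thesis unfolding w_def[symmetric] by (simp add: reflect_def) (simp add: w_def)
  qed
qed

lemma refl_tau: "ip w \<tau> = 0 \<Longrightarrow> reflect w \<tau> = \<tau>"
  by (auto simp: reflect_def)

lemma law_Z_refl: "distr Z (PiM I (\<lambda>_. borel)) (\<lambda>z. \<lambda>i\<in>I. reflect w z i) = Z"
proof -
  have "distr (gauss I) (PiM I (\<lambda>_. borel)) (\<lambda>x. \<lambda>i\<in>I. \<Sum>k\<in>I. kern w i k * x k) = gauss I"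
    by (rule gauss_linear_image[OF fI fI kern_orthonormal])
  also have "(\<lambda>x. \<lambda>i\<in>I. \<Sum>k\<in>I. kern w i k * x k) = (\<lambda>z. \<lambda>i\<in>I. reflect w z i)"
    by (intro ext restrict_ext sum_kern)
  finally show ?thesis unfolding Z_def .
qed

definition reflX :: "(nat \<Rightarrow> real) \<Rightarrow> (nat \<times> nat \<Rightarrow> real) \<Rightarrow> nat \<times> nat \<Rightarrow> real"
  where "reflX w x = (\<lambda>q\<in>I \<times> {1..d}. reflect w (\<lambda>k. x (k, snd q)) (fst q))"

lemma law_X_refl: "distr X (PiM (I \<times> {1..d}) (\<lambda>_. borel)) (reflX w) = X"
proof -
  have "distr (gauss (I \<times> {1..d})) (PiM (I \<times> {1..d}) (\<lambda>_. borel))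
      (\<lambda>x. \<lambda>q\<in>I \<times> {1..d}. \<Sum>k\<in>I. kern w (fst q) k * x (k, snd q)) = gauss (I \<times> {1..d})"
    by (rule gauss_row_image[OF fI fI _ kern_orthonormal]) auto
  also have "(\<lambda>x. \<lambda>q\<in>I \<times> {1..d}. \<Sum>k\<in>I. kern w (fst q) k * x (k, snd q)) = reflX w"
    unfolding reflX_def by (intro ext restrict_ext sum_kern) auto
  finally show ?thesis unfolding X_def .
qed

lemma prob_spaces: "prob_space X" "prob_space Z"
  unfolding X_def Z_def by (rule prob_space_gauss)+

lemma ip_measurable [measurable]:
  assumes "\<And>i. i \<in> I \<Longrightarrow> (\<lambda>\<omega>. f \<omega> i) \<in> borel_measurable M" "\<And>i. i \<in> I \<Longrightarrow> (\<lambda>\<omega>. g \<omega> i) \<in> borel_measurable M"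
  shows "(\<lambda>\<omega>. ip (f \<omega>) (g \<omega>)) \<in> borel_measurable M"
  unfolding ip_def using assms by (intro borel_measurable_sum borel_measurable_times)

lemma Z_component [measurable]: "i \<in> I \<Longrightarrow> (\<lambda>z. z i) \<in> borel_measurable Z"
  unfolding Z_def by (rule gauss_component)

lemma proj_measurable [measurable]: "i \<in> I \<Longrightarrow> (\<lambda>z. proj z i) \<in> borel_measurable Z"
  unfolding proj_def by measurable

lemma gmatX_measurable [measurable]: "i \<in> I \<Longrightarrow> r \<le> d \<Longrightarrow> (\<lambda>x. gmat \<tau> x i r) \<in> borel_measurable X"
  unfolding X_def by (rule gmat_measurable) auto

lemma uperp_tau: "uperp x b \<Longrightarrow> ip b \<tau> = 0"
  by (auto simp: uperp_def perp_def ip_def gmat_def)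

lemma uperp_cong: "(\<And>i. i \<in> I \<Longrightarrow> b i = b' i) \<Longrightarrow> uperp x b = uperp x b'"
  unfolding uperp_def perp_def by (simp add: ip_def)

text \<open>Unit vectors have coordinates in \<open>[-1, 1]\<close>, so the search space is compact
  once the coordinates outside \<open>I\<close> are set to 0, which \<open>dep\<close>
  permits.\<close>

lemma exists_uperp_measurable:
  fixes h :: "nat \<Rightarrow> 'w \<Rightarrow> (nat \<Rightarrow> real) \<Rightarrow> real"
  assumes x: "\<And>i r. i \<in> I \<Longrightarrow> r \<le> p \<Longrightarrow> (\<lambda>\<omega>. gmat \<tau> (x \<omega>) i r) \<in> borel_measurable M"
    and S: "finite S" and h: "\<And>s b. s \<in> S \<Longrightarrow> (\<lambda>\<omega>. h s \<omega> b) \<in> borel_measurable M"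
    and cont: "\<And>s \<omega>. s \<in> S \<Longrightarrow> continuous_on UNIV (h s \<omega>)"
    and dep: "\<And>s \<omega> b b'. s \<in> S \<Longrightarrow> (\<And>i. i \<in> I \<Longrightarrow> b i = b' i) \<Longrightarrow> h s \<omega> b = h s \<omega> b'"
  shows "{\<omega>\<in>space M. \<exists>b. uperp (x \<omega>) b \<and> (\<forall>s\<in>S. h s \<omega> b \<le> 0)} \<in> sets M"
proof -
  define F where "F q \<omega> b = (case q of Inl r \<Rightarrow> (if r \<le> p then \<bar>\<Sum>i\<in>I. b i * gmat \<tau> (x \<omega>) i r\<bar> else \<bar>ip b b - 1\<bar>)
    | Inr s \<Rightarrow> h s \<omega> b)" for q \<omega> b
  \<comment> \<open>The indices up to \<open>p\<close> are the orthogonality conditions;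
    \<open>Suc p\<close> stands for the normalization \<open>ip b b = 1\<close>.\<close>
  define P where "P = Inl ` {..Suc p} \<union> Inr ` S"
  define C where "C = {c :: nat \<Rightarrow> real. \<forall>i. c i \<in> {- 1..1}}"
  have "{\<omega>\<in>space M. \<exists>b\<in>C. \<forall>q\<in>P. F q \<omega> b \<le> 0} \<in> sets M"
  proof (rule measurable_compact_exists)
    show "finite P" using S by (simp add: P_def)
    show "compact C" unfolding C_def by (rule compact_box)
    fix q assume q: "q \<in> P"
    show "(\<lambda>\<omega>. F q \<omega> b) \<in> borel_measurable M" for b
    proof (cases q)
      case (Inl r)
      show ?thesis
      proof (cases "r \<le> p")
        case True
        show ?thesis unfolding F_def Inl sum.case if_P[OF True]
          by (intro borel_measurable_abs borel_measurable_sum borel_measurable_times borel_measurable_const x True)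
      next
        case False
        show ?thesis unfolding F_def Inl sum.case if_not_P[OF False] by (rule borel_measurable_const)
      qed
    next
      case (Inr s)
      with q have "s \<in> S" by (auto simp: P_def)
      then show ?thesis unfolding F_def Inr sum.case by (rule h)
    qed
    show "continuous_on UNIV (F q \<omega>)" for \<omega>
    proof (cases q)
      case (Inl r)
      have "continuous_on UNIV (\<lambda>b :: nat \<Rightarrow> real. ip b b)"
        unfolding ip_def by (intro continuous_on_sum continuous_on_mult continuous_on_product_coordinates)
      then have "continuous_on UNIV (\<lambda>b :: nat \<Rightarrow> real. \<bar>ip b b - 1\<bar>)"
        by (intro continuous_on_rabs continuous_on_diff continuous_on_const)
      moreover have "continuous_on UNIV (\<lambda>b :: nat \<Rightarrow> real. \<bar>\<Sum>i\<in>I. b i * gmat \<tau> (x \<omega>) i r\<bar>)"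
        by (intro continuous_on_rabs continuous_on_lin)
      ultimately show ?thesis unfolding F_def Inl sum.case by (cases "r \<le> p") simp_all
    next
      case (Inr s)
      with q have "s \<in> S" by (auto simp: P_def)
      then show ?thesis unfolding F_def Inr sum.case by (rule cont)
    qed
  qed
  also have "{\<omega>\<in>space M. \<exists>b\<in>C. \<forall>q\<in>P. F q \<omega> b \<le> 0} = {\<omega>\<in>space M. \<exists>b. uperp (x \<omega>) b \<and> (\<forall>s\<in>S. h s \<omega> b \<le> 0)}"
  proof (intro Collect_cong conj_cong refl iffI)
    fix \<omega> assume "\<exists>b\<in>C. \<forall>q\<in>P. F q \<omega> b \<le> 0"
    then obtain b where b: "\<And>q. q \<in> P \<Longrightarrow> F q \<omega> b \<le> 0" by blast
    have "uperp (x \<omega>) b"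
      unfolding uperp_def perp_def
    proof (intro conjI allI impI)
      show "(\<Sum>i\<in>I. b i * gmat \<tau> (x \<omega>) i r) = 0" if "r \<le> p" for r
        using b[of "Inl r"] that by (simp add: P_def F_def)
      show "ip b b = 1" using b[of "Inl (Suc p)"] by (simp add: P_def F_def)
    qed
    moreover have "\<forall>s\<in>S. h s \<omega> b \<le> 0"
    proof
      fix s assume "s \<in> S"
      then show "h s \<omega> b \<le> 0" using b[of "Inr s"] by (simp add: P_def F_def)
    qed
    ultimately show "\<exists>b. uperp (x \<omega>) b \<and> (\<forall>s\<in>S. h s \<omega> b \<le> 0)" by blast
  next
    fix \<omega> assume "\<exists>b. uperp (x \<omega>) b \<and> (\<forall>s\<in>S. h s \<omega> b \<le> 0)"
    then obtain b where b: "uperp (x \<omega>) b" "\<forall>s\<in>S. h s \<omega> b \<le> 0" by blast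
    define b' where "b' i = (if i \<in> I then b i else 0)" for i
    have "(b i)\<^sup>2 \<le> 1" if "i \<in> I" for i using square_le_ip[OF that, of b] b(1) by (simp add: uperp_def)
    then have "\<bar>b' i\<bar> \<le> 1" for i by (simp add: b'_def abs_square_le_1)
    then have "b' \<in> C" by (simp add: C_def abs_le_iff minus_le_iff)
    moreover have b'u: "uperp (x \<omega>) b'" using b(1) uperp_cong[of b b'] by (simp add: b'_def)
    moreover have "h s \<omega> b' \<le> 0" if "s \<in> S" for s
    proof -
      have "h s \<omega> b = h s \<omega> b'" by (rule dep[OF that]) (simp add: b'_def)
      with b(2) that show ?thesis by metis
    qed
    ultimately have "b' \<in> C" "\<And>q. q \<in> P \<Longrightarrow> F q \<omega> b' \<le> 0"
      by (auto simp: P_def F_def uperp_def perp_def)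
    then show "\<exists>b\<in>C. \<forall>q\<in>P. F q \<omega> b \<le> 0" by blast
  qed
  finally show ?thesis .
qed

end

context sphere
begin

lemma near_measurable:
  assumes x: "\<And>i r. i \<in> I \<Longrightarrow> r \<le> p \<Longrightarrow> (\<lambda>\<omega>. gmat \<tau> (x \<omega>) i r) \<in> borel_measurable M"
    and u: "\<And>i. i \<in> I \<Longrightarrow> (\<lambda>\<omega>. u \<omega> i) \<in> borel_measurable M"
  shows "{\<omega>\<in>space M. near r (x \<omega>) (u \<omega>)} \<in> sets M"
proof -
  have "{\<omega>\<in>space M. \<exists>b. uperp (x \<omega>) b \<and> (\<forall>s\<in>{0::nat}. (1 - r) * ip (u \<omega>) (u \<omega>) - (ip b (u \<omega>))\<^sup>2 \<le> 0)} \<in> sets M"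
  proof (rule exists_uperp_measurable[OF x])
    show "(\<lambda>\<omega>. (1 - r) * ip (u \<omega>) (u \<omega>) - (ip b (u \<omega>))\<^sup>2) \<in> borel_measurable M" for b
      unfolding ip_def
      by (intro borel_measurable_diff borel_measurable_times borel_measurable_power borel_measurable_sum borel_measurable_const u)
    show "continuous_on UNIV (\<lambda>b. (1 - r) * ip (u \<omega>) (u \<omega>) - (ip b (u \<omega>))\<^sup>2)" for \<omega>
      unfolding ip_def by (intro continuous_on_diff continuous_on_const continuous_on_power continuous_on_lin)
    show "(1 - r) * ip (u \<omega>) (u \<omega>) - (ip b (u \<omega>))\<^sup>2 = (1 - r) * ip (u \<omega>) (u \<omega>) - (ip b' (u \<omega>))\<^sup>2"
      if "\<And>i. i \<in> I \<Longrightarrow> b i = b' i" for \<omega> b b'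
      using that ip_cong[of b b' "u \<omega>" "u \<omega>"] by simp
  qed auto
  then show ?thesis unfolding near_def by simp
qed

lemma near_scale: "s \<noteq> 0 \<Longrightarrow> near r x (\<lambda>i. s * u i) = near r x u"
proof -
  assume "s \<noteq> 0"
  have "(1 - r) * ip (\<lambda>i. s * u i) (\<lambda>i. s * u i) \<le> (ip b (\<lambda>i. s * u i))\<^sup>2 \<longleftrightarrow>
      s\<^sup>2 * ((1 - r) * ip u u) \<le> s\<^sup>2 * (ip b u)\<^sup>2" for b
    by (simp add: ip_scale_right ip_scale_left power_mult_distrib power2_eq_square mult_ac)
  also have "s\<^sup>2 * ((1 - r) * ip u u) \<le> s\<^sup>2 * (ip b u)\<^sup>2 \<longleftrightarrow> (1 - r) * ip u u \<le> (ip b u)\<^sup>2" for b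
    using \<open>s \<noteq> 0\<close> by (simp add: mult_le_cancel_left)
  finally show ?thesis unfolding near_def by simp
qed

text \<open>The measure of the double spherical cap around the axis \<open>b\<close>, expressed
  through a projected Gaussian vector.\<close>

definition cap :: "real \<Rightarrow> (nat \<Rightarrow> real) \<Rightarrow> ennreal"
  where "cap r b = emeasure Z {z\<in>space Z. (1 - r) * ip (proj z) (proj z) \<le> (ip b (proj z))\<^sup>2}"

text \<open>The reflection exchanging \<open>b\<close> and \<open>b'\<close> preserves the law of
  \<open>Z\<close> and fixes \<open>\<tau>\<close>. Writing the event through \<open>ip z z\<close>,
  \<open>ip \<tau> z\<close> and \<open>ip b z\<close> shows that it carries one cap to the
  other.\<close>

lemma cap_const:
  assumes b: "ip b b = 1" "ip b \<tau> = 0" and b': "ip b' b' = 1" "ip b' \<tau> = 0"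
  shows "cap r b = cap r b'"
proof -
  define w where "w = (\<lambda>i. b i - b' i)"
  have w\<tau>: "ip w \<tau> = 0" unfolding w_def ip_diff_left using b b' by simp
  define E where "E = (\<lambda>b. {z\<in>space Z. (1 - r) * (ip z z - (ip \<tau> z)\<^sup>2 / ip \<tau> \<tau>) \<le> (ip b z)\<^sup>2})"
  have cap: "cap r c = emeasure Z (E c)" if "ip c \<tau> = 0" for c
    unfolding cap_def E_def ip_proj_proj ip_proj[OF that] ..
  have ipZ: "(\<lambda>z. ip c z) \<in> borel_measurable Z" "(\<lambda>z. ip z z) \<in> borel_measurable Z" for c
    unfolding ip_def
    by (intro borel_measurable_sum borel_measurable_times borel_measurable_const Z_component; assumption)+
  have E: "E c \<in> sets Z" for c
    unfolding E_def
    by (intro borel_measurable_le borel_measurable_times borel_measurable_diff borel_measurable_divide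
        borel_measurable_power borel_measurable_const ipZ)
  have \<Phi>: "(\<lambda>z. \<lambda>i\<in>I. reflect w z i) \<in> measurable Z (PiM I (\<lambda>_. borel))"
    unfolding reflect_def
    by (intro measurable_restrict borel_measurable_times borel_measurable_diff borel_measurable_const Z_component ipZ)
  have sets: "sets Z = sets (PiM I (\<lambda>_. borel))" "space Z = PiE I (\<lambda>_. UNIV)"
    unfolding Z_def by (simp_all add: space_gauss)
  have "emeasure Z (E b') = emeasure (distr Z (PiM I (\<lambda>_. borel)) (\<lambda>z. \<lambda>i\<in>I. reflect w z i)) (E b')"
    by (simp only: law_Z_refl)
  also have "\<dots> = emeasure Z ((\<lambda>z. \<lambda>i\<in>I. reflect w z i) -` E b' \<inter> space Z)"
    using E[of b'] \<Phi> by (intro emeasure_distr) (auto simp: sets)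
  also have "(\<lambda>z. \<lambda>i\<in>I. reflect w z i) -` E b' \<inter> space Z = E b"
  proof -
    have "ip c (\<lambda>i\<in>I. reflect w z i) = ip c (reflect w z)" for c z by (rule ip_cong) auto
    moreover have "ip (\<lambda>i\<in>I. reflect w z i) (\<lambda>i\<in>I. reflect w z i) = ip (reflect w z) (reflect w z)" for z by (rule ip_cong) auto
    moreover have "ip b' (reflect w z) = ip b z" for z
    proof -
      have "ip b' (reflect w z) = ip (reflect w b) (reflect w z)"
        by (rule ip_cong) (use refl_swap[OF b(1) b'(1)] in \<open>auto simp: w_def\<close>)
      then show ?thesis by (simp add: ip_refl)
    qed
    moreover have "ip \<tau> (reflect w z) = ip \<tau> z" for z
      using ip_refl[of w \<tau> z] refl_tau[OF w\<tau>] by simp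
    ultimately show ?thesis unfolding E_def by (auto simp: ip_refl sets)
  qed
  finally show ?thesis using cap b b' by simp
qed

definition hit :: "real \<Rightarrow> (nat \<Rightarrow> real) \<Rightarrow> ennreal"
  where "hit r u = emeasure X {x\<in>space X. near r x u}"

lemma hit_sets: "{x\<in>space X. near r x u} \<in> sets X"
  by (rule near_measurable[where x = "\<lambda>x. x"]) (use pd in auto)

text \<open>Reflecting every column of the matrix carries its unit dependencies along and moves
  \<open>u\<close> to \<open>u'\<close>, without changing the law of \<open>X\<close>. An inequality
  suffices because the roles of \<open>u\<close> and \<open>u'\<close> can be exchanged.\<close>

lemma hit_le:
  assumes u: "ip u u = 1" "ip u \<tau> = 0" and u': "ip u' u' = 1" "ip u' \<tau> = 0"
  shows "hit r u \<le> hit r u'"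
proof -
  define w where "w = (\<lambda>i. u i - u' i)"
  have w\<tau>: "ip w \<tau> = 0" unfolding w_def ip_diff_left using u u' by simp
  have \<Phi>: "reflX w \<in> measurable X (PiM (I \<times> {1..d}) (\<lambda>_. borel))"
    unfolding reflX_def reflect_def ip_def X_def
    by (intro measurable_restrict borel_measurable_diff borel_measurable_times borel_measurable_sum
        borel_measurable_const gauss_component) auto
  have sets: "sets X = sets (PiM (I \<times> {1..d}) (\<lambda>_. borel))" unfolding X_def by simp
  have space: "space X = space (PiM (I \<times> {1..d}) (\<lambda>_. borel))" unfolding X_def by (simp add: space_gauss space_PiM)
  have perp: "perp (reflX w x) (reflect w b)" if "perp x b" for x b
    unfolding perp_def
  proof (intro allI impI)
    fix r assume r: "r \<le> p"
    show "(\<Sum>i\<in>I. reflect w b i * gmat \<tau> (reflX w x) i r) = 0"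
    proof (cases "r = 0")
      case True
      have "(\<Sum>i\<in>I. reflect w b i * gmat \<tau> (reflX w x) i r) = ip (reflect w b) \<tau>" using True by (simp add: gmat_def ip_def)
      also have "\<dots> = ip (reflect w b) (reflect w \<tau>)" by (simp add: refl_tau[OF w\<tau>])
      also have "\<dots> = ip b \<tau>" by (rule ip_refl)
      also have "\<dots> = 0" using that by (auto simp: perp_def ip_def gmat_def)
      finally show ?thesis .
    next
      case False
      have "(\<Sum>i\<in>I. reflect w b i * gmat \<tau> (reflX w x) i r) = ip (reflect w b) (reflect w (\<lambda>k. x (k, r)))"
        using False r pd unfolding ip_def by (intro sum.cong) (auto simp: gmat_def reflX_def)
      also have "\<dots> = ip b (\<lambda>k. x (k, r))" by (rule ip_refl)
      also have "\<dots> = (\<Sum>i\<in>I. b i * gmat \<tau> x i r)" using False by (simp add: gmat_def ip_def)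
      also have "\<dots> = 0" using that r by (simp add: perp_def)
      finally show ?thesis .
    qed
  qed
  have near: "near r (reflX w x) u'" if "near r x u" for x
  proof -
    from that obtain b where b: "uperp x b" "(1 - r) * ip u u \<le> (ip b u)\<^sup>2" unfolding near_def by blast
    have "ip (reflect w b) u' = ip (reflect w b) (reflect w u)"
      by (rule ip_cong) (use refl_swap[OF u(1) u'(1)] in \<open>auto simp: w_def\<close>)
    then have "ip (reflect w b) u' = ip b u" by (simp add: ip_refl)
    then show ?thesis
      using b u u' perp[of x b] ip_refl[of w b b] unfolding near_def uperp_def by (intro exI[of _ "reflect w b"]) simp
  qed
  have "hit r u \<le> emeasure X (reflX w -` {x\<in>space X. near r x u'} \<inter> space X)"
    unfolding hit_def
  proof (rule emeasure_mono)
    show "reflX w -` {x\<in>space X. near r x u'} \<inter> space X \<in> sets X"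
      using measurable_sets[OF \<Phi>, of "{x\<in>space X. near r x u'}"] hit_sets[of r u'] by (simp add: sets)
    show "{x\<in>space X. near r x u} \<subseteq> reflX w -` {x\<in>space X. near r x u'} \<inter> space X"
      using near measurable_space[OF \<Phi>] by (auto simp: space)
  qed
  also have "\<dots> = emeasure (distr X (PiM (I \<times> {1..d}) (\<lambda>_. borel)) (reflX w)) {x\<in>space X. near r x u'}"
    using hit_sets[of r u'] \<Phi> by (intro emeasure_distr[symmetric]) (auto simp: sets)
  also have "\<dots> = hit r u'" unfolding law_X_refl hit_def ..
  finally show ?thesis .
qed

lemma exists_uperp: "\<exists>b. uperp x b"
proof -
  have "card {..p} < card I" using cI by simp
  from homogeneous_solution[OF _ fI this, of "\<lambda>r i. gmat \<tau> x i r"] obtain b where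
    b: "\<exists>i\<in>I. b i \<noteq> 0" "\<And>r. r \<le> p \<Longrightarrow> (\<Sum>i\<in>I. b i * gmat \<tau> x i r) = 0" by auto
  have pos: "0 < ip b b"
    using b(1) ip_eq_0[of b] ip_nonneg[of b] by (metis order_le_less)
  define s where "s = 1 / sqrt (ip b b)"
  have "(\<Sum>i\<in>I. s * b i * gmat \<tau> x i r) = 0" if "r \<le> p" for r
    using b(2)[OF that] by (simp add: mult.assoc sum_distrib_left[symmetric])
  moreover have "s * (s * ip b b) = 1" using pos by (simp add: s_def)
  ultimately have "uperp x (\<lambda>i. s * b i)" unfolding uperp_def perp_def ip_scale_left ip_scale_right by simp
  then show ?thesis by blast
qed

text \<open>The combination of \<open>b\<close> and \<open>b'\<close> that vanishes at
  \<open>i0\<close> is a dependency of only \<open>p + 1\<close> rows, hence 0. So the two are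
  proportional, and their norms leave only the sign.\<close>

lemma uperp_unique:
  assumes gp: "genpos I (gmat \<tau> x) p" and b: "uperp x b" and b': "uperp x b'"
  shows "(\<forall>i\<in>I. b' i = b i) \<or> (\<forall>i\<in>I. b' i = - b i)"
proof -
  obtain i0 where i0: "i0 \<in> I" "b i0 \<noteq> 0"
  proof (rule ccontr)
    assume "\<not> thesis"
    with that have "ip b b = 0" unfolding ip_def by (intro sum.neutral) auto
    with b show False by (simp add: uperp_def)
  qed
  define e where "e = (\<lambda>i. b i0 * b' i - b' i0 * b i)"
  have e0: "e i0 = 0" by (simp add: e_def)
  have "(\<Sum>i\<in>I - {i0}. e i * gmat \<tau> x i r) = 0" if r: "r \<le> p" for r
  proof -
    have "(\<Sum>i\<in>I. e i * gmat \<tau> x i r) = b i0 * (\<Sum>i\<in>I. b' i * gmat \<tau> x i r) - b' i0 * (\<Sum>i\<in>I. b i * gmat \<tau> x i r)"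
      by (simp add: e_def algebra_simps sum_subtractf sum_distrib_left)
    also have "\<dots> = 0" using b b' r by (simp add: uperp_def perp_def)
    finally show ?thesis using e0 i0 fI by (simp add: sum.remove[of I i0])
  qed
  then have "e i = 0" if "i \<in> I" for i
    using genpos_orthogonal[OF gp fI, of "I - {i0}" e i] that e0 i0 cI fI by (cases "i = i0") auto
  then have proportional: "b' i = b' i0 / b i0 * b i" if "i \<in> I" for i
    using that i0 by (simp add: e_def field_simps)
  define t where "t = b' i0 / b i0"
  have "ip b' b' = ip (\<lambda>i. t * b i) (\<lambda>i. t * b i)" by (rule ip_cong) (use proportional in \<open>auto simp: t_def\<close>)
  then have "t * t = 1" using b b' by (simp add: uperp_def ip_scale_left ip_scale_right)
  then have "t = 1 \<or> t = -1" by (simp add: square_eq_1_iff)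
  then show ?thesis using proportional unfolding t_def[symmetric] by auto
qed

text \<open>Two unit vectors with inner product close to \<open>\<plusminus>1\<close> have the same signs, up to a global one,
  in the coordinates where one of them is bounded away from zero.\<close>

lemma close_signs:
  assumes b: "ip b b = 1" and u: "ip u u = 1" and close: "1 - \<delta>\<^sup>2 / 4 \<le> (ip b u)\<^sup>2" and \<delta>: "0 < \<delta>"
    and sgn: "(\<forall>i\<in>K. \<delta> \<le> b i) \<or> (\<forall>i\<in>K. b i \<le> - \<delta>)"
  shows "(\<forall>i\<in>K. 0 < u i) \<or> (\<forall>i\<in>K. u i < 0)"
proof -
  \<comment> \<open>The global sign that turns \<open>u\<close> towards \<open>b\<close>.\<close>
  define e where "e = (if 0 \<le> ip b u then 1 else -1 :: real)"
  have eb: "e * ip b u = \<bar>ip b u\<bar>" and ee: "e * e = 1" by (auto simp: e_def)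
  have dist: "ip (\<lambda>i. b i - e * u i) (\<lambda>i. b i - e * u i) = 2 - 2 * \<bar>ip b u\<bar>"
    unfolding ip_diff_left ip_diff_right ip_scale_left ip_scale_right
    using b u eb ee by (simp add: ip_commute[of u b] algebra_simps)
  \<comment> \<open>The absolute value is at most 1 and hence at least its square, so the squared
    distance is at most \<open>2 - 2 * (1 - \<delta>^2 / 4)\<close>, that is
    \<open>\<delta>^2 / 2\<close>; every coordinate then differs by less than
    \<open>\<delta>\<close>.\<close>
  have "0 \<le> 2 - 2 * \<bar>ip b u\<bar>" unfolding dist[symmetric] by (rule ip_nonneg)
  then have "(ip b u)\<^sup>2 \<le> \<bar>ip b u\<bar>"
    using mult_left_le[of "\<bar>ip b u\<bar>" "\<bar>ip b u\<bar>"] by (simp add: power2_eq_square abs_mult[symmetric])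
  with close have d2: "2 - 2 * \<bar>ip b u\<bar> \<le> \<delta>\<^sup>2 / 2" by simp
  have near: "\<bar>b i - e * u i\<bar> < \<delta>" if "i \<in> I" for i
  proof -
    have "(b i - e * u i)\<^sup>2 \<le> \<delta>\<^sup>2 / 2"
      using square_le_ip[OF that, of "\<lambda>i. b i - e * u i"] dist d2 by simp
    also have "\<dots> < \<delta>\<^sup>2" using \<delta> by simp
    finally have "\<bar>b i - e * u i\<bar>\<^sup>2 < \<delta>\<^sup>2" by simp
    then show ?thesis by (rule power2_less_imp_less) (use \<delta> in simp)
  qed
  have "e = 1 \<or> e = -1" by (auto simp: e_def)
  then show ?thesis
    using sgn
  proof (elim disjE)
    assume e: "e = 1" and s: "\<forall>i\<in>K. \<delta> \<le> b i"
    have "0 < u i" if "i \<in> K" for i using near[OF subsetD[OF KI(1) that]] bspec[OF s that] unfolding e abs_less_iff by linarith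
    then show ?thesis by blast
  next
    assume e: "e = 1" and s: "\<forall>i\<in>K. b i \<le> - \<delta>"
    have "u i < 0" if "i \<in> K" for i using near[OF subsetD[OF KI(1) that]] bspec[OF s that] unfolding e abs_less_iff by linarith
    then show ?thesis by blast
  next
    assume e: "e = -1" and s: "\<forall>i\<in>K. \<delta> \<le> b i"
    have "u i < 0" if "i \<in> K" for i using near[OF subsetD[OF KI(1) that]] bspec[OF s that] unfolding e abs_less_iff by linarith
    then show ?thesis by blast
  next
    assume e: "e = -1" and s: "\<forall>i\<in>K. b i \<le> - \<delta>"
    have "0 < u i" if "i \<in> K" for i using near[OF subsetD[OF KI(1) that]] bspec[OF s that] unfolding e abs_less_iff by linarith
    then show ?thesis by blast
  qed
qed

end

lemma emeasure_pair_sections: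
  assumes "sigma_finite_measure M" "sigma_finite_measure N"
    and E: "{\<omega>\<in>space (M \<Otimes>\<^sub>M N). Q (fst \<omega>) (snd \<omega>)} \<in> sets (M \<Otimes>\<^sub>M N)"
  shows "(\<integral>\<^sup>+ x. emeasure N {z\<in>space N. Q x z} \<partial>M) = (\<integral>\<^sup>+ z. emeasure M {x\<in>space M. Q x z} \<partial>N)"
proof -
  interpret M: sigma_finite_measure M by fact
  interpret N: sigma_finite_measure N by fact
  interpret pair_sigma_finite M N ..
  let ?E = "{\<omega>\<in>space (M \<Otimes>\<^sub>M N). Q (fst \<omega>) (snd \<omega>)}"
  have "(\<integral>\<^sup>+ x. emeasure N {z\<in>space N. Q x z} \<partial>M) = (\<integral>\<^sup>+ x. emeasure N (Pair x -` ?E) \<partial>M)"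
    by (intro nn_integral_cong arg_cong[where f = "emeasure N"]) (auto simp: space_pair_measure)
  also have "\<dots> = emeasure (M \<Otimes>\<^sub>M N) ?E" by (rule N.emeasure_pair_measure_alt[OF E, symmetric])
  also have "\<dots> = (\<integral>\<^sup>+ z. emeasure M ((\<lambda>x. (x, z)) -` ?E) \<partial>N)" by (rule emeasure_pair_measure_alt2[OF E])
  also have "\<dots> = (\<integral>\<^sup>+ z. emeasure M {x\<in>space M. Q x z} \<partial>N)"
    by (intro nn_integral_cong arg_cong[where f = "emeasure M"]) (auto simp: space_pair_measure)
  finally show ?thesis .
qed

context sphere
begin

section \<open>Comparing the signs of a dependency and of a projected Gaussian vector\<close>

definition posx :: "(nat \<times> nat \<Rightarrow> real) \<Rightarrow> bool"
  where "posx x \<longleftrightarrow> (\<exists>b. perp x b \<and> (\<forall>i\<in>K. 0 < b i))"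

text \<open>Both signs are listed because \<open>perp x\<close> is closed under negation, whereas
  \<open>proj z\<close> is a single vector.\<close>

definition posz :: "(nat \<Rightarrow> real) \<Rightarrow> bool"
  where "posz z \<longleftrightarrow> (\<forall>i\<in>K. 0 < proj z i) \<or> (\<forall>i\<in>K. proj z i < 0)"

definition posx_margin :: "real \<Rightarrow> (nat \<times> nat \<Rightarrow> real) \<Rightarrow> bool"
  where "posx_margin \<delta> x \<longleftrightarrow> (\<exists>b. uperp x b \<and> (\<forall>i\<in>K. \<delta> \<le> b i))"

text \<open>The margin \<open>\<delta>\<close> refers to the normalized vector; multiplying by the
  norm avoids the division.\<close>

definition posz_margin :: "real \<Rightarrow> (nat \<Rightarrow> real) \<Rightarrow> bool"
  where "posz_margin \<delta> z \<longleftrightarrow> (\<forall>i\<in>K. \<delta> * sqrt (ip (proj z) (proj z)) \<le> proj z i) \<or>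
    (\<forall>i\<in>K. proj z i \<le> - (\<delta> * sqrt (ip (proj z) (proj z))))"

lemma fK: "finite K" using fI KI finite_subset by blast

lemma ip_projZ [measurable]: "(\<lambda>z. ip (proj z) (proj z)) \<in> borel_measurable Z"
  unfolding ip_def by (intro borel_measurable_sum borel_measurable_times proj_measurable)

lemma posx_sets: "{x\<in>space X. posx x} \<in> sets X"
proof -
  have "{x\<in>space X. possol p (gmat \<tau> x) I (I - K)} \<in> sets X"
    by (rule possol_measurable) (use fI pd gmatX_measurable in auto)
  moreover have "I - (I - K) = K" using KI by auto
  ultimately show ?thesis unfolding posx_def possol_def perp_def by simp
qed

lemma posz_sets: "{z\<in>space Z. posz z} \<in> sets Z"
  unfolding posz_def using fK KI
  by (intro sets.sets_Collect_disj sets.sets_Collect_finite_All borel_measurable_less borel_measurable_const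
      proj_measurable) auto

lemma posx_margin_sets: "{x\<in>space X. posx_margin \<delta> x} \<in> sets X"
proof -
  have "{x\<in>space X. \<exists>b. uperp x b \<and> (\<forall>i\<in>K. \<delta> - b i \<le> 0)} \<in> sets X"
    by (rule exists_uperp_measurable[where x = "\<lambda>x. x"])
      (use pd KI fK gmatX_measurable in \<open>auto intro!: continuous_on_diff continuous_on_const continuous_on_product_coordinates\<close>)
  then show ?thesis unfolding posx_margin_def by simp
qed

lemma posz_margin_sets: "{z\<in>space Z. posz_margin \<delta> z} \<in> sets Z"
  unfolding posz_margin_def using fK KI
  by (intro sets.sets_Collect_disj sets.sets_Collect_finite_All borel_measurable_le borel_measurable_times
      borel_measurable_uminus borel_measurable_sqrt borel_measurable_const proj_measurable ip_projZ) auto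

text \<open>Since \<open>I\<close> has a second index, coordinate \<open>i\<close> of the projection
  is a nonzero linear form: \<open>(\<tau> i)^2\<close> is strictly smaller than
  \<open>ip \<tau> \<tau>\<close>.\<close>

lemma AE_proj_nonzero: "AE z in Z. ip (proj z) (proj z) \<noteq> 0"
proof -
  have "1 < card I" using cI by simp
  then obtain i j where ij: "i \<in> I" "j \<in> I" "i \<noteq> j"
    by (metis card_le_Suc0_iff_eq fI not_less_eq_eq One_nat_def Suc_leI not_less)
  define b where "b k = (if k = i then 1 else 0) - \<tau> i / ip \<tau> \<tau> * \<tau> k" for k
  have "(\<tau> i)\<^sup>2 < ip \<tau> \<tau>"
  proof -
    have "(\<tau> i)\<^sup>2 + (\<tau> j)\<^sup>2 = (\<Sum>k\<in>{i, j}. \<tau> k * \<tau> k)" using ij by (simp add: power2_eq_square)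
    also have "\<dots> \<le> ip \<tau> \<tau>" unfolding ip_def using ij fI by (intro sum_mono2) auto
    finally show ?thesis using \<tau>[OF ij(2)] by (smt (verit) zero_less_power2)
  qed
  then have "b i \<noteq> 0" using T_pos by (simp add: b_def power2_eq_square)
  then have "AE z in Z. (\<Sum>k\<in>I. b k * z k) \<noteq> 0"
    unfolding Z_def by (intro AE_gauss_linear_nonzero[OF fI ij(1)])
  then show ?thesis
  proof eventually_elim
    fix z :: "nat \<Rightarrow> real" assume nz: "(\<Sum>k\<in>I. b k * z k) \<noteq> 0"
    have "(\<Sum>k\<in>I. b k * z k) = (\<Sum>k\<in>I. (if k = i then z i else 0) - \<tau> i / ip \<tau> \<tau> * (\<tau> k * z k))"
      by (intro sum.cong) (auto simp: b_def algebra_simps)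
    also have "\<dots> = proj z i"
      unfolding sum_subtractf sum_distrib_left[symmetric] ip_def[symmetric] using ij fI by (simp add: proj_def)
    finally show "ip (proj z) (proj z) \<noteq> 0" using nz ip_eq_0[OF _ ij(1), of "proj z"] by auto
  qed
qed

lemma AE_genposX: "AE x in X. genpos I (gmat \<tau> x) p"
  unfolding X_def by (rule AE_genpos[OF fI _ pd]) (use \<tau> in force)

text \<open>A reference direction: for the zero matrix only column 0 is a constraint, so this is
  some unit vector orthogonal to \<open>\<tau>\<close>.\<close>

definition b0 :: "nat \<Rightarrow> real" where "b0 = (SOME b. uperp (\<lambda>_. 0) b)"

lemma b0: "ip b0 b0 = 1" "ip b0 \<tau> = 0"
proof -
  have "uperp (\<lambda>_. 0) b0" unfolding b0_def using exists_uperp by (rule someI_ex)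
  then show "ip b0 b0 = 1" "ip b0 \<tau> = 0" using uperp_tau by (auto simp: uperp_def)
qed

lemma near_iff:
  assumes "genpos I (gmat \<tau> x) p" "uperp x b"
  shows "near r x u \<longleftrightarrow> (1 - r) * ip u u \<le> (ip b u)\<^sup>2"
proof
  assume "near r x u"
  then obtain b' where b': "uperp x b'" "(1 - r) * ip u u \<le> (ip b' u)\<^sup>2" unfolding near_def by blast
  from uperp_unique[OF assms b'(1)] have "(ip b' u)\<^sup>2 = (ip b u)\<^sup>2"
  proof
    assume "\<forall>i\<in>I. b' i = b i"
    then have "ip b' u = ip b u" by (intro ip_cong) auto
    then show ?thesis by simp
  next
    assume "\<forall>i\<in>I. b' i = - b i"
    then have "ip b' u = ip (\<lambda>i. (-1) * b i) u" by (intro ip_cong) auto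
    then show ?thesis by (simp only: ip_scale_left) simp
  qed
  with b' show "(1 - r) * ip u u \<le> (ip b u)\<^sup>2" by simp
qed (use assms in \<open>auto simp: near_def\<close>)

lemma section_x:
  assumes "genpos I (gmat \<tau> x) p"
  shows "emeasure Z {z\<in>space Z. near r x (proj z)} = cap r b0"
proof -
  obtain b where b: "uperp x b" using exists_uperp by blast
  have "emeasure Z {z\<in>space Z. near r x (proj z)} = cap r b"
    unfolding cap_def near_iff[OF assms b] ..
  also have "\<dots> = cap r b0"
    using b uperp_tau[OF b] b0 by (intro cap_const) (auto simp: uperp_def)
  finally show ?thesis .
qed

lemma section_z:
  assumes nz: "ip (proj z) (proj z) \<noteq> 0"
  shows "hit r (proj z) = hit r b0"
proof -
  define s where "s = 1 / sqrt (ip (proj z) (proj z))"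
  have pos: "0 < ip (proj z) (proj z)" using nz ip_nonneg[of "proj z"] by (simp add: order_le_less)
  then have s: "s \<noteq> 0" by (simp add: s_def)
  define u where "u = (\<lambda>i. s * proj z i)"
  have u: "ip u u = 1" "ip u \<tau> = 0"
    unfolding u_def ip_scale_left ip_scale_right using pos
    by (auto simp: s_def ip_commute[of "proj z" \<tau>] ip_tau_proj)
  have "hit r (proj z) = hit r u" unfolding hit_def u_def near_scale[OF s] ..
  also have "\<dots> = hit r b0" using hit_le[OF u b0, of r] hit_le[OF b0 u, of r] by (rule order.antisym)
  finally show ?thesis .
qed

lemma pair_sets:
  assumes "{x\<in>space X. A x} \<in> sets X" "{z\<in>space Z. B z} \<in> sets Z"
  shows "{\<omega>\<in>space (X \<Otimes>\<^sub>M Z). near r (fst \<omega>) (proj (snd \<omega>)) \<and> A (fst \<omega>) \<and> B (snd \<omega>)} \<in> sets (X \<Otimes>\<^sub>M Z)"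
proof -
  have "{\<omega>\<in>space (X \<Otimes>\<^sub>M Z). near r (fst \<omega>) (proj (snd \<omega>))} \<in> sets (X \<Otimes>\<^sub>M Z)"
  proof (rule near_measurable)
    show "(\<lambda>\<omega>. gmat \<tau> (fst \<omega>) i r) \<in> borel_measurable (X \<Otimes>\<^sub>M Z)" if "i \<in> I" "r \<le> p" for i r
      by (rule measurable_compose[OF measurable_fst gmatX_measurable]) (use that pd in auto)
    show "(\<lambda>\<omega>. proj (snd \<omega>) i) \<in> borel_measurable (X \<Otimes>\<^sub>M Z)" if "i \<in> I" for i
      by (rule measurable_compose[OF measurable_snd proj_measurable[OF that]])
  qed
  moreover have "fst -` {x\<in>space X. A x} \<inter> space (X \<Otimes>\<^sub>M Z) \<in> sets (X \<Otimes>\<^sub>M Z)"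
    by (rule measurable_sets[OF measurable_fst assms(1)])
  moreover have "snd -` {z\<in>space Z. B z} \<inter> space (X \<Otimes>\<^sub>M Z) \<in> sets (X \<Otimes>\<^sub>M Z)"
    by (rule measurable_sets[OF measurable_snd assms(2)])
  ultimately have "{\<omega>\<in>space (X \<Otimes>\<^sub>M Z). near r (fst \<omega>) (proj (snd \<omega>))} \<inter>
      ((fst -` {x\<in>space X. A x} \<inter> space (X \<Otimes>\<^sub>M Z)) \<inter> (snd -` {z\<in>space Z. B z} \<inter> space (X \<Otimes>\<^sub>M Z))) \<in> sets (X \<Otimes>\<^sub>M Z)"
    by - (rule sets.Int, assumption, rule sets.Int)
  also have "{\<omega>\<in>space (X \<Otimes>\<^sub>M Z). near r (fst \<omega>) (proj (snd \<omega>))} \<inter>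
      ((fst -` {x\<in>space X. A x} \<inter> space (X \<Otimes>\<^sub>M Z)) \<inter> (snd -` {z\<in>space Z. B z} \<inter> space (X \<Otimes>\<^sub>M Z))) =
    {\<omega>\<in>space (X \<Otimes>\<^sub>M Z). near r (fst \<omega>) (proj (snd \<omega>)) \<and> A (fst \<omega>) \<and> B (snd \<omega>)}"
    by (auto simp: space_pair_measure)
  finally show ?thesis .
qed

lemma pair_exchange:
  assumes "{x\<in>space X. A x} \<in> sets X" "{z\<in>space Z. B z} \<in> sets Z"
  shows "(\<integral>\<^sup>+ x. emeasure Z {z\<in>space Z. near r x (proj z) \<and> A x \<and> B z} \<partial>X) =
    (\<integral>\<^sup>+ z. emeasure X {x\<in>space X. near r x (proj z) \<and> A x \<and> B z} \<partial>Z)"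
  by (rule emeasure_pair_sections[OF _ _ pair_sets[OF assms]])
    (use prob_spaces in \<open>auto intro: prob_space_imp_sigma_finite\<close>)

lemma near_setsX: "{x\<in>space X. near r x (proj z) \<and> A x \<and> b} \<in> sets X" if "{x\<in>space X. A x} \<in> sets X" for b
proof -
  have "{x\<in>space X. near r x (proj z) \<and> A x \<and> b} = (if b then {x\<in>space X. near r x (proj z)} \<inter> {x\<in>space X. A x} else {})"
    by auto
  then show ?thesis using hit_sets[of r "proj z"] that by auto
qed

lemma near_setsZ: "{z\<in>space Z. near r x (proj z) \<and> a \<and> B z} \<in> sets Z" if "{z\<in>space Z. B z} \<in> sets Z" for a
proof -
  have "{z\<in>space Z. near r x (proj z)} \<in> sets Z"
    by (rule near_measurable) (auto intro: proj_measurable)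
  moreover have "{z\<in>space Z. near r x (proj z) \<and> a \<and> B z} = (if a then {z\<in>space Z. near r x (proj z)} \<inter> {z\<in>space Z. B z} else {})"
    by auto
  ultimately show ?thesis using that by auto
qed

text \<open>Both numbers are the probability that \<open>x\<close> and \<open>z\<close> have close
  directions, computed by fixing \<open>x\<close> or by fixing \<open>z\<close>. Their equality lets
  this factor cancel in the margin estimates.\<close>

lemma cap_eq_hit: "cap r b0 = hit r b0"
proof -
  interpret X: prob_space X by (rule prob_spaces)
  interpret Z: prob_space Z by (rule prob_spaces)
  have "cap r b0 = (\<integral>\<^sup>+ x. cap r b0 \<partial>X)" by (simp add: X.emeasure_space_1)
  also have "\<dots> = (\<integral>\<^sup>+ x. emeasure Z {z\<in>space Z. near r x (proj z) \<and> True \<and> True} \<partial>X)"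
    by (rule nn_integral_cong_AE) (use AE_genposX section_x in auto)
  also have "\<dots> = (\<integral>\<^sup>+ z. emeasure X {x\<in>space X. near r x (proj z) \<and> True \<and> True} \<partial>Z)"
    by (rule pair_exchange) auto
  also have "\<dots> = (\<integral>\<^sup>+ z. hit r b0 \<partial>Z)"
    by (rule nn_integral_cong_AE) (use AE_proj_nonzero section_z[unfolded hit_def] in \<open>auto simp: hit_def\<close>)
  also have "\<dots> = hit r b0" by (simp add: Z.emeasure_space_1)
  finally show ?thesis .
qed

lemma cap_finite: "cap r b < top"
  using prob_spaces(2) unfolding cap_def
  by (metis (no_types, lifting) ennreal_less_top finite_measure.emeasure_eq_measure prob_space.finite_measure)

lemma close_scaled:
  assumes b: "ip b b = 1" and nz: "ip u u \<noteq> 0" and close: "(1 - \<delta>\<^sup>2 / 4) * ip u u \<le> (ip b u)\<^sup>2"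
  defines "s \<equiv> 1 / sqrt (ip u u)"
  shows "0 < s" "ip (\<lambda>i. s * u i) (\<lambda>i. s * u i) = 1" "1 - \<delta>\<^sup>2 / 4 \<le> (ip b (\<lambda>i. s * u i))\<^sup>2"
proof -
  have pos: "0 < ip u u" using nz ip_nonneg[of u] by (simp add: order_le_less)
  then show "0 < s" "ip (\<lambda>i. s * u i) (\<lambda>i. s * u i) = 1"
    unfolding ip_scale_left ip_scale_right by (simp_all add: s_def)
  have "(ip b (\<lambda>i. s * u i))\<^sup>2 = (ip b u)\<^sup>2 / ip u u"
    unfolding ip_scale_right using pos by (simp add: s_def power_mult_distrib power_divide)
  then show "1 - \<delta>\<^sup>2 / 4 \<le> (ip b (\<lambda>i. s * u i))\<^sup>2" using close pos by (simp add: pos_le_divide_eq)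
qed

text \<open>If the dependency of \<open>x\<close> has margin \<open>\<delta>\<close>, every close
  \<open>z\<close> has the signs of \<open>posz\<close>. Counting close pairs gives the cap
  probability times the left side as a lower bound, and the same factor times the right side as an
  upper bound.\<close>

lemma margin_x_le:
  assumes \<delta>: "0 < \<delta>" and pos: "0 < cap (\<delta>\<^sup>2 / 4) b0"
  shows "emeasure X {x\<in>space X. posx_margin \<delta> x} \<le> emeasure Z {z\<in>space Z. posz z}"
proof -
  let ?r = "\<delta>\<^sup>2 / 4"
  have "cap ?r b0 * emeasure X {x\<in>space X. posx_margin \<delta> x} =
      (\<integral>\<^sup>+ x. cap ?r b0 * indicator {x\<in>space X. posx_margin \<delta> x} x \<partial>X)"
    by (rule nn_integral_cmult_indicator[symmetric]) (rule posx_margin_sets)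
  also have "\<dots> \<le> (\<integral>\<^sup>+ x. emeasure Z {z\<in>space Z. near ?r x (proj z) \<and> True \<and> posz z} \<partial>X)"
  proof (rule nn_integral_mono_AE)
    show "AE x in X. cap ?r b0 * indicator {x\<in>space X. posx_margin \<delta> x} x \<le>
        emeasure Z {z\<in>space Z. near ?r x (proj z) \<and> True \<and> posz z}"
      using AE_genposX
    proof eventually_elim
      fix x assume gp: "genpos I (gmat \<tau> x) p"
      show "cap ?r b0 * indicator {x\<in>space X. posx_margin \<delta> x} x \<le>
        emeasure Z {z\<in>space Z. near ?r x (proj z) \<and> True \<and> posz z}"
      proof (cases "posx_margin \<delta> x")
        case True
        then obtain b where b: "uperp x b" "\<forall>i\<in>K. \<delta> \<le> b i" unfolding posx_margin_def by blast
        have "cap ?r b0 = emeasure Z {z\<in>space Z. near ?r x (proj z)}" by (rule section_x[OF gp, symmetric])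
        also have "\<dots> \<le> emeasure Z {z\<in>space Z. near ?r x (proj z) \<and> True \<and> posz z}"
        proof (rule emeasure_mono_AE)
          show "AE z in Z. z \<in> {z\<in>space Z. near ?r x (proj z)} \<longrightarrow> z \<in> {z\<in>space Z. near ?r x (proj z) \<and> True \<and> posz z}"
            using AE_proj_nonzero
          proof eventually_elim
            fix z assume nz: "ip (proj z) (proj z) \<noteq> 0"
            have "posz z" if "near ?r x (proj z)"
            proof -
              have cl: "(1 - ?r) * ip (proj z) (proj z) \<le> (ip b (proj z))\<^sup>2" using that near_iff[OF gp b(1)] by simp
              have b1: "ip b b = 1" using b(1) by (simp add: uperp_def)
              define s where "s = 1 / sqrt (ip (proj z) (proj z))"
              note c = close_scaled[OF b1 nz cl, folded s_def]
              from close_signs[OF b1 c(2,3) \<delta>] b(2) show ?thesis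
                using c(1) by (simp add: posz_def zero_less_mult_iff mult_less_0_iff)
            qed
            then show "z \<in> {z\<in>space Z. near ?r x (proj z)} \<longrightarrow> z \<in> {z\<in>space Z. near ?r x (proj z) \<and> True \<and> posz z}" by auto
          qed
        qed (rule near_setsZ[OF posz_sets])
        finally show ?thesis by (simp add: indicator_def)
      qed simp
    qed
  qed
  also have "\<dots> = (\<integral>\<^sup>+ z. emeasure X {x\<in>space X. near ?r x (proj z) \<and> True \<and> posz z} \<partial>Z)"
    by (rule pair_exchange) (auto intro: posz_sets)
  also have "\<dots> = (\<integral>\<^sup>+ z. hit ?r b0 * indicator {z\<in>space Z. posz z} z \<partial>Z)"
  proof (rule nn_integral_cong_AE)
    show "AE z in Z. emeasure X {x\<in>space X. near ?r x (proj z) \<and> True \<and> posz z} = hit ?r b0 * indicator {z\<in>space Z. posz z} z"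
      using AE_proj_nonzero AE_space
    proof eventually_elim
      fix z assume "ip (proj z) (proj z) \<noteq> 0" "z \<in> space Z"
      then show "emeasure X {x\<in>space X. near ?r x (proj z) \<and> True \<and> posz z} = hit ?r b0 * indicator {z\<in>space Z. posz z} z"
        using section_z[of z ?r] by (cases "posz z") (auto simp: hit_def)
    qed
  qed
  also have "\<dots> = cap ?r b0 * emeasure Z {z\<in>space Z. posz z}"
    unfolding cap_eq_hit by (rule nn_integral_cmult_indicator) (rule posz_sets)
  finally show ?thesis
    using pos cap_finite[of ?r b0] by (simp add: ennreal_mult_le_mult_iff less_top[symmetric])
qed

text \<open>The pair count of \<open>margin_x_le\<close> with the roles exchanged: now
  \<open>z\<close> has the margin, and close matrices inherit the signs up to negating the
  dependency.\<close>

lemma margin_z_le: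
  assumes \<delta>: "0 < \<delta>" and pos: "0 < cap (\<delta>\<^sup>2 / 4) b0"
  shows "emeasure Z {z\<in>space Z. posz_margin \<delta> z} \<le> emeasure X {x\<in>space X. posx x}"
proof -
  let ?r = "\<delta>\<^sup>2 / 4"
  have "cap ?r b0 * emeasure Z {z\<in>space Z. posz_margin \<delta> z} =
      (\<integral>\<^sup>+ z. cap ?r b0 * indicator {z\<in>space Z. posz_margin \<delta> z} z \<partial>Z)"
    by (rule nn_integral_cmult_indicator[symmetric]) (rule posz_margin_sets)
  also have "\<dots> \<le> (\<integral>\<^sup>+ z. emeasure X {x\<in>space X. near ?r x (proj z) \<and> posx x \<and> True} \<partial>Z)"
  proof (rule nn_integral_mono_AE)
    show "AE z in Z. cap ?r b0 * indicator {z\<in>space Z. posz_margin \<delta> z} z \<le>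
        emeasure X {x\<in>space X. near ?r x (proj z) \<and> posx x \<and> True}"
      using AE_proj_nonzero
    proof eventually_elim
      fix z assume nz: "ip (proj z) (proj z) \<noteq> 0"
      show "cap ?r b0 * indicator {z\<in>space Z. posz_margin \<delta> z} z \<le>
        emeasure X {x\<in>space X. near ?r x (proj z) \<and> posx x \<and> True}"
      proof (cases "posz_margin \<delta> z")
        case True
        have "cap ?r b0 = emeasure X {x\<in>space X. near ?r x (proj z)}"
          using section_z[OF nz, of ?r] by (simp add: cap_eq_hit hit_def)
        also have "\<dots> \<le> emeasure X {x\<in>space X. near ?r x (proj z) \<and> posx x \<and> True}"
        proof (rule emeasure_mono)
          have "posx x" if near: "near ?r x (proj z)" for x
          proof -
            from near obtain b where b: "uperp x b" "(1 - ?r) * ip (proj z) (proj z) \<le> (ip b (proj z))\<^sup>2"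
              unfolding near_def by blast
            then have b1: "ip b b = 1" by (simp add: uperp_def)
            define s where "s = 1 / sqrt (ip (proj z) (proj z))"
            note c = close_scaled[OF b1 nz b(2), folded s_def]
            have cl: "1 - ?r \<le> (ip (\<lambda>i. s * proj z i) b)\<^sup>2" using c(3) by (simp add: ip_commute[of _ b])
            have sq: "s * sqrt (ip (proj z) (proj z)) = 1" using c(1) by (simp add: s_def)
            have "(\<forall>i\<in>K. \<delta> \<le> s * proj z i) \<or> (\<forall>i\<in>K. s * proj z i \<le> - \<delta>)"
              using True unfolding posz_margin_def
            proof (elim disjE)
              assume le: "\<forall>i\<in>K. \<delta> * sqrt (ip (proj z) (proj z)) \<le> proj z i"
              have "\<delta> \<le> s * proj z i" if "i \<in> K" for i
              proof -
                have "s * (\<delta> * sqrt (ip (proj z) (proj z))) \<le> s * proj z i"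
                  using le that c(1) by (intro mult_left_mono) auto
                also have "s * (\<delta> * sqrt (ip (proj z) (proj z))) = \<delta> * (s * sqrt (ip (proj z) (proj z)))" by simp
                finally show ?thesis by (simp add: sq)
              qed
              then show ?thesis by blast
            next
              assume le: "\<forall>i\<in>K. proj z i \<le> - (\<delta> * sqrt (ip (proj z) (proj z)))"
              have "s * proj z i \<le> - \<delta>" if "i \<in> K" for i
              proof -
                have "s * proj z i \<le> s * - (\<delta> * sqrt (ip (proj z) (proj z)))"
                  using le that c(1) by (intro mult_left_mono) auto
                also have "s * - (\<delta> * sqrt (ip (proj z) (proj z))) = - (\<delta> * (s * sqrt (ip (proj z) (proj z))))" by simp
                finally show ?thesis by (simp add: sq)
              qed
              then show ?thesis by blast
            qed
            from close_signs[OF c(2) b1 cl \<delta> this] show ?thesis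
            proof
              assume "\<forall>i\<in>K. 0 < b i"
              then show ?thesis using b(1) unfolding posx_def uperp_def by blast
            next
              assume neg: "\<forall>i\<in>K. b i < 0"
              have "perp x (\<lambda>i. - b i)" using b(1) by (simp add: uperp_def perp_def sum_negf)
              then show ?thesis using neg unfolding posx_def by (intro exI[of _ "\<lambda>i. - b i"]) auto
            qed
          qed
          then show "{x\<in>space X. near ?r x (proj z)} \<subseteq> {x\<in>space X. near ?r x (proj z) \<and> posx x \<and> True}" by blast
        qed (rule near_setsX[OF posx_sets])
        finally show ?thesis by (simp add: indicator_def)
      qed simp
    qed
  qed
  also have "\<dots> = (\<integral>\<^sup>+ x. emeasure Z {z\<in>space Z. near ?r x (proj z) \<and> posx x \<and> True} \<partial>X)"
    by (rule pair_exchange[symmetric]) (auto intro: posx_sets)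
  also have "\<dots> = (\<integral>\<^sup>+ x. cap ?r b0 * indicator {x\<in>space X. posx x} x \<partial>X)"
  proof (rule nn_integral_cong_AE)
    show "AE x in X. emeasure Z {z\<in>space Z. near ?r x (proj z) \<and> posx x \<and> True} = cap ?r b0 * indicator {x\<in>space X. posx x} x"
      using AE_genposX AE_space
    proof eventually_elim
      fix x assume "genpos I (gmat \<tau> x) p" "x \<in> space X"
      then show "emeasure Z {z\<in>space Z. near ?r x (proj z) \<and> posx x \<and> True} = cap ?r b0 * indicator {x\<in>space X. posx x} x"
        using section_x[of x ?r] by (cases "posx x") auto
    qed
  qed
  also have "\<dots> = cap ?r b0 * emeasure X {x\<in>space X. posx x}"
    by (rule nn_integral_cmult_indicator) (rule posx_sets)
  finally show ?thesis
    using pos cap_finite[of ?r b0] by (simp add: ennreal_mult_le_mult_iff less_top[symmetric])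
qed

end

section \<open>Positive cap probability and removal of the margins\<close>

lemma std_normal_interval_pos:
  assumes "a < b"
  shows "0 < measure std_normal {a..b}"
proof -
  interpret prob_space std_normal by (rule prob_space_std_normal)
  have "emeasure std_normal {a..b} \<noteq> 0"
  proof
    assume "emeasure std_normal {a..b} = 0"
    then have "{a..b} \<in> null_sets std_normal" by (intro null_setsI) auto
    then have "AE x in lborel. x \<in> {a..b} \<longrightarrow> ennreal (std_normal_density x) = 0"
      by (subst (asm) null_sets_density_iff) auto
    then have "AE x in lborel. x \<notin> {a..b}"
    proof eventually_elim
      fix x assume "x \<in> {a..b} \<longrightarrow> ennreal (std_normal_density x) = 0"
      moreover have "0 < ennreal (std_normal_density x)" by (simp add: normal_density_pos)
      ultimately show "x \<notin> {a..b}" by (metis less_irrefl)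
    qed
    then have "emeasure lborel {a..b} = 0" by (subst (asm) AE_iff_null_sets[symmetric]) auto
    then show False using assms by simp
  qed
  then show ?thesis by (simp add: emeasure_eq_measure zero_less_measure_iff)
qed

lemma small_inverse:
  assumes "finite K" "\<And>i. i \<in> K \<Longrightarrow> 0 < v i"
  shows "\<exists>n. \<forall>i\<in>K. inverse (real (Suc n)) \<le> v i"
proof -
  have "\<forall>\<^sub>F n in sequentially. \<forall>i\<in>K. inverse (real (Suc n)) < v i"
    using assms by (intro eventually_ball_finite ballI order_tendstoD[OF LIMSEQ_inverse_real_of_nat]) auto
  then obtain n where "\<forall>i\<in>K. inverse (real (Suc n)) < v i"
    using eventually_happens' sequentially_bot by blast
  then show ?thesis by (intro exI[of _ n]) (auto intro: less_imp_le)
qed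

lemma emeasure_le_of_increasing_cover:
  assumes "\<And>n. A n \<in> sets M" "\<And>n. A n \<subseteq> A (Suc n)" "S \<subseteq> (\<Union>n. A n)" "\<And>n :: nat. emeasure M (A n) \<le> c"
  shows "emeasure M S \<le> c"
proof -
  have "emeasure M S \<le> emeasure M (\<Union>n. A n)" using assms(1,3) by (intro emeasure_mono) auto
  also have "\<dots> = (SUP n. emeasure M (A n))"
    using assms(1,2) by (intro SUP_emeasure_incseq[symmetric]) (auto simp: incseq_Suc_iff)
  also have "\<dots> \<le> c" using assms(4) by (intro SUP_least)
  finally show ?thesis .
qed

context sphere
begin

text \<open>A small coordinate box around \<open>b0\<close> has positive Gaussian measure and lies
  in the double cone over the cap.\<close>

lemma cap_pos:
  assumes r: "0 < r" "r \<le> 1"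
  shows "0 < cap r b0"
proof -
  define m where "m = real (card I)"
  have m: "1 \<le> m" using cI by (simp add: m_def)
  \<comment> \<open>With \<open>t = r / 5\<close> the errors of \<open>ip b0 z\<close> and
    \<open>ip e e\<close> are at most \<open>t\<close>. The constant 5 gives
    \<open>(1 - r) * (1 + 3 * t) \<le> 1 - 2 * t\<close>, and the right side is at most
    \<open>(1 - t)^2\<close>.\<close>
  define \<epsilon> where "\<epsilon> = r / (5 * m)"
  define t where "t = m * \<epsilon>"
  have t: "t = r / 5" "0 < \<epsilon>" using m r by (auto simp: t_def \<epsilon>_def)
  define B where "B = PiE I (\<lambda>i. {b0 i - \<epsilon>..b0 i + \<epsilon>})"
  have sub: "B \<subseteq> {z\<in>space Z. (1 - r) * ip (proj z) (proj z) \<le> (ip b0 (proj z))\<^sup>2}"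
  proof
    fix z assume z: "z \<in> B"
    define e where "e = (\<lambda>i. z i - b0 i)"
    have e: "\<bar>e i\<bar> \<le> \<epsilon>" if "i \<in> I" for i
      using z that by (force simp: B_def e_def PiE_iff abs_le_iff)
    have b1: "\<bar>b0 i\<bar> \<le> 1" if "i \<in> I" for i using square_le_ip[OF that, of b0] b0(1) by (simp add: abs_square_le_1)
    have "\<bar>ip b0 e\<bar> \<le> (\<Sum>i\<in>I. \<bar>b0 i * e i\<bar>)" unfolding ip_def by (rule sum_abs)
    also have "\<dots> \<le> (\<Sum>i\<in>I. \<epsilon>)"
    proof (rule sum_mono)
      fix i assume i: "i \<in> I"
      have "\<bar>b0 i\<bar> * \<bar>e i\<bar> \<le> 1 * \<epsilon>" using b1[OF i] e[OF i] by (intro mult_mono) auto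
      then show "\<bar>b0 i * e i\<bar> \<le> \<epsilon>" by (simp add: abs_mult)
    qed
    finally have be: "\<bar>ip b0 e\<bar> \<le> t" by (simp add: t_def m_def)
    have "ip e e \<le> (\<Sum>i\<in>I. \<epsilon> * \<epsilon>)"
      unfolding ip_def
    proof (rule sum_mono)
      fix i assume i: "i \<in> I"
      have "\<bar>e i\<bar> * \<bar>e i\<bar> \<le> \<epsilon> * \<epsilon>" using e[OF i] by (intro mult_mono) auto
      then show "e i * e i \<le> \<epsilon> * \<epsilon>" by simp
    qed
    also have "\<dots> = t * \<epsilon>" by (simp add: t_def m_def)
    also have "\<dots> \<le> t * 1"
    proof (rule mult_left_mono)
      have "\<epsilon> * 1 \<le> \<epsilon> * m" using m t(2) by (intro mult_left_mono) auto
      moreover have "\<epsilon> * m = r / 5" using t(1) by (simp add: t_def mult.commute)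
      ultimately show "\<epsilon> \<le> 1" using r(2) by linarith
    qed (use t r in simp)
    finally have ee: "ip e e \<le> t" by simp
    have be': "ip b0 e = ip b0 z - 1" and ee': "ip e e = ip z z - 2 * ip b0 z + 1"
      unfolding e_def ip_diff_right ip_diff_left b0 ip_commute[of z b0] by simp_all
    then have bz: "ip b0 z = 1 + ip b0 e" and zz: "ip z z = 1 + 2 * ip b0 e + ip e e" by linarith+
    have pz: "ip (proj z) (proj z) \<le> 1 + 3 * t"
    proof -
      have "ip (proj z) (proj z) \<le> ip z z" unfolding ip_proj_proj using T_pos by simp
      also have "\<dots> \<le> 1 + 3 * t" using zz be ee by (simp add: abs_le_iff)
      finally show ?thesis .
    qed
    have "(1 - r) * ip (proj z) (proj z) \<le> (1 - r) * (1 + 3 * t)" using pz r by (intro mult_left_mono) auto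
    also have "\<dots> \<le> 1 - 2 * t" using r t(1) by (simp add: algebra_simps)
    also have "\<dots> \<le> (1 - t)\<^sup>2" by (simp add: power2_eq_square algebra_simps)
    also have "\<dots> \<le> (ip b0 z)\<^sup>2"
      using be r t(1) by (intro power_mono) (auto simp: bz abs_le_iff)
    also have "ip b0 z = ip b0 (proj z)" by (rule ip_proj[OF b0(2), symmetric])
    finally show "z \<in> {z\<in>space Z. (1 - r) * ip (proj z) (proj z) \<le> (ip b0 (proj z))\<^sup>2}"
      using z by (auto simp: Z_def space_gauss B_def)
  qed
  interpret product_prob_space "\<lambda>_. std_normal" by (rule product_prob_std_normal)
  have "emeasure Z B = (\<Prod>i\<in>I. emeasure std_normal {b0 i - \<epsilon>..b0 i + \<epsilon>})"
    unfolding Z_def gauss_def B_def by (rule emeasure_PiM[OF fI]) auto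
  also have "\<dots> = ennreal (\<Prod>i\<in>I. measure std_normal {b0 i - \<epsilon>..b0 i + \<epsilon>})"
    by (simp add: finite_measure.emeasure_eq_measure[OF prob_space.finite_measure[OF prob_space_std_normal]] prod_ennreal)
  finally have "0 < emeasure Z B"
    using t(2) by (auto intro!: prod_pos std_normal_interval_pos)
  also have "emeasure Z B \<le> cap r b0"
    unfolding cap_def
  proof (rule emeasure_mono[OF sub])
    show "{z\<in>space Z. (1 - r) * ip (proj z) (proj z) \<le> (ip b0 (proj z))\<^sup>2} \<in> sets Z"
    proof -
      have "(\<lambda>z. ip b0 (proj z)) \<in> borel_measurable Z"
        unfolding ip_def by (intro borel_measurable_sum borel_measurable_times borel_measurable_const proj_measurable)
      then show ?thesis
        by (intro borel_measurable_le borel_measurable_times borel_measurable_power borel_measurable_const ip_projZ)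
    qed
  qed
  finally show ?thesis .
qed

lemma margin_inverse_pos: "0 < cap ((inverse (real (Suc n)))\<^sup>2 / 4) b0"
proof (rule cap_pos)
  have "(inverse (real (Suc n)))\<^sup>2 \<le> 1" by (simp add: power_le_one inverse_le_1_iff)
  then show "(inverse (real (Suc n)))\<^sup>2 / 4 \<le> 1" by simp
qed simp

lemma inverse_Suc_mono: "inverse (real (Suc (Suc n))) \<le> inverse (real (Suc n))"
  by (simp add: divide_simps)

text \<open>Strict signs on the finite set \<open>K\<close> have some margin
  \<open>1 / (n + 1)\<close> after normalization. The margin events increase to the sign events, and
  each is bounded by the other side through the pair count.\<close>

lemma posx_eq_posz: "emeasure X {x\<in>space X. posx x} = emeasure Z {z\<in>space Z. posz z}"
proof (rule order.antisym)
  show "emeasure X {x\<in>space X. posx x} \<le> emeasure Z {z\<in>space Z. posz z}"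
  proof (rule emeasure_le_of_increasing_cover[where A = "\<lambda>n. {x\<in>space X. posx_margin (inverse (real (Suc n))) x}"])
    show "{x\<in>space X. posx_margin (inverse (real (Suc n))) x} \<subseteq> {x\<in>space X. posx_margin (inverse (real (Suc (Suc n)))) x}" for n
      unfolding posx_margin_def using order.trans[OF inverse_Suc_mono[of n]] by blast
    show "{x\<in>space X. posx x} \<subseteq> (\<Union>n. {x\<in>space X. posx_margin (inverse (real (Suc n))) x})"
    proof
      fix x assume x: "x \<in> {x\<in>space X. posx x}"
      then obtain b where b: "perp x b" "\<And>i. i \<in> K \<Longrightarrow> 0 < b i" unfolding posx_def by blast
      obtain i where i: "i \<in> K" using KI by blast
      have "ip b b \<noteq> 0" using ip_eq_0[of b i] b(2)[OF i] i KI by auto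
      then have pos: "0 < ip b b" using ip_nonneg[of b] by (simp add: order_le_less)
      define s where "s = 1 / sqrt (ip b b)"
      have s: "0 < s" "s * (s * ip b b) = 1" using pos by (auto simp: s_def)
      have "(\<Sum>i\<in>I. s * b i * gmat \<tau> x i r) = 0" if "r \<le> p" for r
        using b(1) that by (simp add: perp_def mult.assoc sum_distrib_left[symmetric])
      then have "uperp x (\<lambda>i. s * b i)"
        unfolding uperp_def perp_def ip_scale_left ip_scale_right using s by simp
      moreover obtain n where "\<forall>i\<in>K. inverse (real (Suc n)) \<le> s * b i"
        using small_inverse[OF fK, of "\<lambda>i. s * b i"] b(2) s by auto
      ultimately have "posx_margin (inverse (real (Suc n))) x" unfolding posx_margin_def by blast
      then show "x \<in> (\<Union>n. {x\<in>space X. posx_margin (inverse (real (Suc n))) x})" using x by blast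
    qed
    show "emeasure X {x\<in>space X. posx_margin (inverse (real (Suc n))) x} \<le> emeasure Z {z\<in>space Z. posz z}" for n
      by (rule margin_x_le[OF _ margin_inverse_pos]) simp
  qed (rule posx_margin_sets)
  show "emeasure Z {z\<in>space Z. posz z} \<le> emeasure X {x\<in>space X. posx x}"
  proof (rule emeasure_le_of_increasing_cover[where A = "\<lambda>n. {z\<in>space Z. posz_margin (inverse (real (Suc n))) z}"])
    have le: "inverse (real (Suc (Suc n))) * sqrt (ip (proj z) (proj z)) \<le> inverse (real (Suc n)) * sqrt (ip (proj z) (proj z))" for n z
      using inverse_Suc_mono by (rule mult_right_mono) (simp add: ip_nonneg)
    show "{z\<in>space Z. posz_margin (inverse (real (Suc n))) z} \<subseteq> {z\<in>space Z. posz_margin (inverse (real (Suc (Suc n)))) z}" for n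
    proof
      fix z assume z: "z \<in> {z\<in>space Z. posz_margin (inverse (real (Suc n))) z}"
      then have "(\<forall>i\<in>K. inverse (real (Suc n)) * sqrt (ip (proj z) (proj z)) \<le> proj z i) \<or>
          (\<forall>i\<in>K. proj z i \<le> - (inverse (real (Suc n)) * sqrt (ip (proj z) (proj z))))"
        unfolding posz_margin_def by blast
      then have "posz_margin (inverse (real (Suc (Suc n)))) z"
      proof (elim disjE)
        assume "\<forall>i\<in>K. inverse (real (Suc n)) * sqrt (ip (proj z) (proj z)) \<le> proj z i"
        with le[of n z] show ?thesis unfolding posz_margin_def by (meson order.trans)
      next
        assume "\<forall>i\<in>K. proj z i \<le> - (inverse (real (Suc n)) * sqrt (ip (proj z) (proj z)))"
        with le[of n z] show ?thesis unfolding posz_margin_def by (meson neg_le_iff_le order.trans)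
      qed
      with z show "z \<in> {z\<in>space Z. posz_margin (inverse (real (Suc (Suc n)))) z}" by blast
    qed
    show "{z\<in>space Z. posz z} \<subseteq> (\<Union>n. {z\<in>space Z. posz_margin (inverse (real (Suc n))) z})"
    proof
      fix z assume z: "z \<in> {z\<in>space Z. posz z}"
      obtain i where i: "i \<in> K" using KI by blast
      have "proj z i \<noteq> 0" using z i by (force simp: posz_def)
      then have "ip (proj z) (proj z) \<noteq> 0" using ip_eq_0[of "proj z" i] i KI by auto
      then have pos: "0 < sqrt (ip (proj z) (proj z))" using ip_nonneg[of "proj z"] by (simp add: order_le_less)
      obtain n where "posz_margin (inverse (real (Suc n))) z"
        using z unfolding posz_def mem_Collect_eq
      proof (elim conjE disjE)
        assume "\<forall>i\<in>K. 0 < proj z i"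
        then obtain n where "\<forall>i\<in>K. inverse (real (Suc n)) \<le> proj z i / sqrt (ip (proj z) (proj z))"
          using small_inverse[OF fK, of "\<lambda>i. proj z i / sqrt (ip (proj z) (proj z))"] pos by auto
        then have "posz_margin (inverse (real (Suc n))) z"
          using pos unfolding posz_margin_def by (simp only: pos_le_divide_eq) blast
        then show thesis by (rule that)
      next
        assume "\<forall>i\<in>K. proj z i < 0"
        then obtain n where n: "\<forall>i\<in>K. inverse (real (Suc n)) \<le> - proj z i / sqrt (ip (proj z) (proj z))"
          using small_inverse[OF fK, of "\<lambda>i. - proj z i / sqrt (ip (proj z) (proj z))"] pos by (auto simp: divide_neg_pos)
        have "\<forall>i\<in>K. proj z i \<le> - (inverse (real (Suc n)) * sqrt (ip (proj z) (proj z)))"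
        proof
          fix i assume "i \<in> K"
          with n have "inverse (real (Suc n)) * sqrt (ip (proj z) (proj z)) \<le> - proj z i"
            using pos by (simp only: pos_le_divide_eq)
          then show "proj z i \<le> - (inverse (real (Suc n)) * sqrt (ip (proj z) (proj z)))" by linarith
        qed
        then have "posz_margin (inverse (real (Suc n))) z" unfolding posz_margin_def by blast
        then show thesis by (rule that)
      qed
      with z show "z \<in> (\<Union>n. {z\<in>space Z. posz_margin (inverse (real (Suc n))) z})" by blast
    qed
    show "emeasure Z {z\<in>space Z. posz_margin (inverse (real (Suc n))) z} \<le> emeasure X {x\<in>space X. posx x}" for n
      by (rule margin_z_le[OF _ margin_inverse_pos]) simp
  qed (rule posz_margin_sets)
qed

end

section \<open>The recursion in the number of coordinates\<close>

text \<open>Here \<open>K = I - A\<close>. The dependency is replaced by \<open>proj z\<close>,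
  whose coordinates divided by \<open>\<tau> i\<close> keep their signs and have covariance
  \<open>- 1 / T + \<delta> / \<tau>^2\<close>. The negative argument is thus realized by an actual
  Gaussian vector, which also yields nonnegativity.\<close>

lemma possol_prob:
  assumes fI: "finite I" and cI: "card I = Suc (Suc p)" and \<tau>: "\<And>i. i \<in> I \<Longrightarrow> 0 < \<tau> i"
    and pd: "p \<le> d" and A: "\<not> I \<subseteq> A"
  shows "emeasure (gauss (I \<times> {1..d})) {x\<in>space (gauss (I \<times> {1..d})). possol p (gmat \<tau> x) I A} =
    ennreal (2 * gauss_orthant (I - A) (- (\<Sum>i\<in>I. (\<tau> i)\<^sup>2)) (\<lambda>i. (\<tau> i)\<^sup>2))" (is ?P)
    and "0 \<le> gauss_orthant (I - A) (- (\<Sum>i\<in>I. (\<tau> i)\<^sup>2)) (\<lambda>i. (\<tau> i)\<^sup>2)" (is ?Q)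
proof -
  interpret sphere I \<tau> p d "I - A"
    by standard (use assms in auto)
  have T: "ip \<tau> \<tau> = (\<Sum>i\<in>I. (\<tau> i)\<^sup>2)" by (simp add: ip_def power2_eq_square)
  define L where "L i k = ((if k = i then 1 else 0) - \<tau> i / ip \<tau> \<tau> * \<tau> k) / \<tau> i" for i k
  have Lsum: "(\<Sum>k\<in>I. L i k * f k) = (f i - \<tau> i / ip \<tau> \<tau> * ip \<tau> f) / \<tau> i" if i: "i \<in> I" for i f
  proof -
    have "(\<Sum>k\<in>I. L i k * f k) = (\<Sum>k\<in>I. (if k = i then f i else 0) - \<tau> i / ip \<tau> \<tau> * (\<tau> k * f k)) / \<tau> i"
      unfolding sum_divide_distrib by (intro sum.cong) (auto simp: L_def algebra_simps diff_divide_distrib)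
    then show ?thesis
      unfolding sum_subtractf sum_distrib_left[symmetric] ip_def[symmetric] using i fI by simp
  qed
  have sgn: "(\<Sum>k\<in>I. L i k * z k) = proj z i / \<tau> i" if "i \<in> I" for i z
    using Lsum[OF that, of z] by (simp add: proj_def)
  have cov: "(\<Sum>k\<in>I. L i k * L j k) = 1 / - (\<Sum>i\<in>I. (\<tau> i)\<^sup>2) + (if i = j then 1 / (\<tau> i)\<^sup>2 else 0)"
    if ij: "i \<in> I - A" "j \<in> I - A" for i j
  proof -
    have "ip \<tau> (L j) = (\<Sum>k\<in>I. L j k * \<tau> k)" by (simp add: ip_def mult.commute)
    also have "\<dots> = 0" using Lsum[of j \<tau>] ij T_pos by simp
    finally have "(\<Sum>k\<in>I. L i k * L j k) = L j i / \<tau> i" using Lsum[of i "L j"] ij by simp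
    also have "\<dots> = 1 / - ip \<tau> \<tau> + (if i = j then 1 / (\<tau> i)\<^sup>2 else 0)"
      using \<tau>[of i] \<tau>[of j] ij T_pos by (auto simp: L_def field_simps power2_eq_square)
    finally show ?thesis unfolding T .
  qed
  have "possol p (gmat \<tau> x) I A = posx x" for x
    unfolding possol_def posx_def perp_def ..
  then have "emeasure (gauss (I \<times> {1..d})) {x\<in>space (gauss (I \<times> {1..d})). possol p (gmat \<tau> x) I A} =
      emeasure Z {z\<in>space Z. posz z}"
    using posx_eq_posz by (simp add: X_def)
  also have "{z\<in>space Z. posz z} = {z\<in>space (gauss I). (\<forall>i\<in>I - A. (\<Sum>k\<in>I. L i k * z k) < 0) \<or> (\<forall>i\<in>I - A. 0 < (\<Sum>k\<in>I. L i k * z k))}"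
  proof -
    have "posz z \<longleftrightarrow> (\<forall>i\<in>I - A. (\<Sum>k\<in>I. L i k * z k) < 0) \<or> (\<forall>i\<in>I - A. 0 < (\<Sum>k\<in>I. L i k * z k))" for z
    proof -
      have "(\<Sum>k\<in>I. L i k * z k) < 0 \<longleftrightarrow> proj z i < 0" "0 < (\<Sum>k\<in>I. L i k * z k) \<longleftrightarrow> 0 < proj z i" if "i \<in> I - A" for i
        using that \<tau>[of i] by (auto simp: sgn divide_less_0_iff zero_less_divide_iff)
      then show ?thesis unfolding posz_def by auto
    qed
    then show ?thesis by (simp add: Z_def)
  qed
  also have "emeasure Z \<dots> = ennreal (2 * gauss_orthant (I - A) (- (\<Sum>i\<in>I. (\<tau> i)\<^sup>2)) (\<lambda>i. (\<tau> i)\<^sup>2))"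
    unfolding Z_def by (rule orthant_pair_measure[OF fI _ _ cov]) (use fI A in auto)
  finally show ?P .
  show ?Q by (rule orthant_nonneg[OF fI _ _ cov]) (use fI A in auto)
qed

text \<open>The definite description is controlled only once a vector is exhibited: a common
  variable of variance \<open>1 / a\<close> plus independent ones of variance
  \<open>1 / l i\<close>, with the common one indexed by \<open>None\<close>.\<close>

lemma gauss_orthant_nonneg:
  assumes "finite J" "0 < a" "\<And>j. j \<in> J \<Longrightarrow> 0 < l j"
  shows "0 \<le> gauss_orthant J a l"
proof (cases "J = {}")
  case False
  define L :: "nat \<Rightarrow> nat option \<Rightarrow> real"
    where "L j q = (case q of None \<Rightarrow> 1 / sqrt a | Some i \<Rightarrow> if i = j then 1 / sqrt (l i) else 0)" for j q
  show ?thesis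
  proof (rule orthant_nonneg[of "insert None (Some ` J)" J L])
    fix i j assume ij: "i \<in> J" "j \<in> J"
    have "(\<Sum>k\<in>J. L i (Some k) * L j (Some k)) = (\<Sum>k\<in>J. if k = i then (if i = j then 1 / l i else 0) else 0)"
      using assms(3) by (intro sum.cong) (auto simp: L_def abs_of_pos)
    then show "(\<Sum>q\<in>insert None (Some ` J). L i q * L j q) = 1 / a + (if i = j then 1 / l i else 0)"
      using assms ij by (simp add: sum.reindex) (simp add: L_def)
  qed (use assms False in auto)
qed (simp add: gauss_orthant_def)

text \<open>The product of the external angle at \<open>I\<close> and the internal angle of \<open>I\<close> at \<open>A\<close>.\<close>

definition pair_prob :: "nat set \<Rightarrow> (nat \<Rightarrow> real) \<Rightarrow> nat set \<Rightarrow> nat set \<Rightarrow> real"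
  where "pair_prob N \<tau> I A = gauss_orthant (N - I) (\<Sum>i\<in>I. (\<tau> i)\<^sup>2) (\<lambda>j. (\<tau> j)\<^sup>2) *
    gauss_orthant (I - A) (- (\<Sum>i\<in>I. (\<tau> i)\<^sup>2)) (\<lambda>i. (\<tau> i)\<^sup>2)"

locale gaussian_rows =
  fixes N :: "nat set" and \<tau> :: "nat \<Rightarrow> real" and d :: nat
  assumes N: "finite N" "0 \<notin> N" and \<tau>: "\<And>i. i \<in> N \<Longrightarrow> 0 < \<tau> i" and dN: "d < card N"
begin

definition G :: "(nat \<times> nat \<Rightarrow> real) measure" where "G = gauss (N \<times> {1..d})"

lemma prob_space_G: "prob_space G"
  unfolding G_def by (rule prob_space_gauss)

lemma feas_sets:
  assumes "m \<le> d" "B \<subseteq> N" "C \<subseteq> N"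
  shows "{x\<in>space G. feas m (gmat \<tau> x) B C} \<in> sets G"
  unfolding G_def using assms finite_subset[OF _ N(1)]
  by (intro feas_measurable gmat_measurable) auto

lemma facet_event:
  assumes I: "I \<subseteq> N" "card I = m" "1 \<le> m" "m \<le> d"
  shows "measure G {x\<in>space G. feas m (gmat \<tau> x) I (N - I)} = 2 * pair_prob N \<tau> I I"
proof -
  have fI: "finite I" using I N finite_subset by blast
  have "I \<noteq> {}" using I by auto
  then have "0 < (\<Sum>i\<in>I. (\<tau> i)\<^sup>2)" using \<tau> I fI by (intro sum_pos) force+
  then have nn: "0 \<le> gauss_orthant (N - I) (\<Sum>i\<in>I. (\<tau> i)\<^sup>2) (\<lambda>j. (\<tau> j)\<^sup>2)"
    using N \<tau> by (intro gauss_orthant_nonneg) force+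
  \<comment> \<open>For \<open>A = I\<close> the sign condition is empty, so
    \<open>facet_prob\<close> reduces to the bare facet event; correspondingly the second factor of
    \<open>pair_prob N \<tau> I I\<close> is 1.\<close>
  have "possol 0 a I I" for a unfolding possol_def by (intro exI[of _ "\<lambda>_. 0"]) auto
  then have "emeasure G {x\<in>space G. feas m (gmat \<tau> x) I (N - I)} =
      ennreal (2 * gauss_orthant (N - I) (\<Sum>i\<in>I. (\<tau> i)\<^sup>2) (\<lambda>j. (\<tau> j)\<^sup>2))"
    using facet_prob[where \<tau> = \<tau> and p = 0 and A = I, OF N \<tau> I(1-3) _ I(4)] I dN unfolding G_def
    by (simp add: prob_space.emeasure_space_1[OF prob_space_gauss])
  then show ?thesis using nn by (simp add: measure_def pair_prob_def gauss_orthant_def[of "{}"])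
qed

lemma counted_event:
  assumes I: "I \<subseteq> N" "card I = Suc (Suc p)" "Suc (Suc p) \<le> d" and A: "A \<subseteq> I" "A \<noteq> I"
  shows "measure G {x\<in>space G. feas (Suc (Suc p)) (gmat \<tau> x) I (N - I) \<and> possol p (gmat \<tau> x) I A} =
    4 * pair_prob N \<tau> I A"
proof -
  have fI: "finite I" using I N finite_subset by blast
  have "I \<noteq> {}" using I by auto
  then have "0 < (\<Sum>i\<in>I. (\<tau> i)\<^sup>2)" using \<tau> I fI by (intro sum_pos) force+
  then have nn: "0 \<le> gauss_orthant (N - I) (\<Sum>i\<in>I. (\<tau> i)\<^sup>2) (\<lambda>j. (\<tau> j)\<^sup>2)"
    using N \<tau> by (intro gauss_orthant_nonneg) force+
  have \<tau>I: "\<And>i. i \<in> I \<Longrightarrow> 0 < \<tau> i" using \<tau> I by auto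
  have "p \<le> d" "\<not> I \<subseteq> A" using I A by auto
  note poss = possol_prob[OF fI I(2) \<tau>I this]
  have "emeasure G {x\<in>space G. feas (Suc (Suc p)) (gmat \<tau> x) I (N - I) \<and> possol p (gmat \<tau> x) I A} =
      ennreal (2 * gauss_orthant (N - I) (\<Sum>i\<in>I. (\<tau> i)\<^sup>2) (\<lambda>j. (\<tau> j)\<^sup>2)) *
      emeasure (gauss (I \<times> {1..d})) {x\<in>space (gauss (I \<times> {1..d})). possol p (gmat \<tau> x) I A}"
    unfolding G_def by (rule facet_prob[where \<tau> = \<tau>, OF N \<tau> I(1,2)]) (use I dN in auto)
  also note poss(1)
  finally have "emeasure G {x\<in>space G. feas (Suc (Suc p)) (gmat \<tau> x) I (N - I) \<and> possol p (gmat \<tau> x) I A} =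
      ennreal (2 * gauss_orthant (N - I) (\<Sum>i\<in>I. (\<tau> i)\<^sup>2) (\<lambda>j. (\<tau> j)\<^sup>2)) *
      ennreal (2 * gauss_orthant (I - A) (- (\<Sum>i\<in>I. (\<tau> i)\<^sup>2)) (\<lambda>i. (\<tau> i)\<^sup>2))" .
  then show ?thesis using nn poss(2) by (simp add: measure_def pair_prob_def ennreal_mult[symmetric])
qed

lemma AE_genpos_G: "m \<le> d \<Longrightarrow> AE x in G. genpos N (gmat \<tau> x) m"
  unfolding G_def by (rule AE_genpos[OF N(1)]) (use \<tau> in force)

definition hits :: "nat \<Rightarrow> nat set \<Rightarrow> real"
  where "hits m A = measure G {x\<in>space G. feas m (gmat \<tau> x) A (N - A)}"

text \<open>Expectation of \<open>card_counted\<close>. Faces persist when coordinates are added, so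
  twice the indicator of a new face is the number of counted \<open>I\<close>; each \<open>I\<close>
  contributes \<open>4 * pair_prob\<close>, and halving leaves 2.\<close>

lemma hits_step:
  assumes A: "A \<subseteq> N" "card A \<le> Suc p" and p: "Suc (Suc p) \<le> d"
  shows "hits (Suc (Suc p)) A = hits p A + (\<Sum>I | A \<subseteq> I \<and> I \<subseteq> N \<and> card I = Suc (Suc p). 2 * pair_prob N \<tau> I A)"
proof -
  interpret prob_space G by (rule prob_space_G)
  have pd: "p \<le> d" using p by simp
  define S where "S = {I. A \<subseteq> I \<and> I \<subseteq> N \<and> card I = Suc (Suc p)}"
  have fS: "finite S" by (rule finite_subset[of _ "Pow N"]) (use N in \<open>auto simp: S_def\<close>)
  define E where "E m = {x\<in>space G. feas m (gmat \<tau> x) A (N - A)}" for m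
  define C where "C I = {x\<in>space G. feas (Suc (Suc p)) (gmat \<tau> x) I (N - I) \<and> possol p (gmat \<tau> x) I A}" for I
  have E: "E m \<in> sets G" if "m \<le> d" for m
    unfolding E_def using that A by (intro feas_sets) auto
  have C: "C I \<in> sets G" if "I \<in> S" for I
  proof -
    have IN: "I \<subseteq> N" "finite I" using that N finite_subset[of I N] by (auto simp: S_def)
    have "{x\<in>space G. possol p (gmat \<tau> x) I A} \<in> sets G"
      unfolding G_def using IN p by (intro possol_measurable gmat_measurable) auto
    moreover have "{x\<in>space G. feas (Suc (Suc p)) (gmat \<tau> x) I (N - I)} \<in> sets G"
      using p IN by (intro feas_sets) auto
    ultimately have "{x\<in>space G. feas (Suc (Suc p)) (gmat \<tau> x) I (N - I)} \<inter> {x\<in>space G. possol p (gmat \<tau> x) I A} \<in> sets G"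
      by (rule sets.Int[rotated])
    also have "{x\<in>space G. feas (Suc (Suc p)) (gmat \<tau> x) I (N - I)} \<inter> {x\<in>space G. possol p (gmat \<tau> x) I A} = C I"
      by (auto simp: C_def)
    finally show ?thesis .
  qed
  have ind: "AE x in G. 2 * indicat_real (E (Suc (Suc p))) x = 2 * indicat_real (E p) x + (\<Sum>I\<in>S. indicat_real (C I) x)"
    using AE_genpos_G[OF p] AE_genpos_G[OF pd] AE_space
  proof eventually_elim
    case (elim x)
    have gp: "genpos N (gmat \<tau> x) (Suc (Suc p))" "genpos N (gmat \<tau> x) p" using elim p by auto
    have "(\<Sum>I\<in>S. indicat_real (C I) x) = real (card {I\<in>S. x \<in> C I})"
      using fS by (simp add: indicator_def sum.If_cases Int_def)
    also have "{I\<in>S. x \<in> C I} = counted N p (gmat \<tau> x) A"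
      using elim(3) by (auto simp: S_def C_def counted_def)
    also have "card \<dots> = (if feas (Suc (Suc p)) (gmat \<tau> x) A (N - A) \<and> \<not> feas p (gmat \<tau> x) A (N - A) then 2 else 0)"
      by (rule card_counted[OF N(1) _ A(2,1) gp]) (use p dN in simp)
    finally show ?case
      using elim(3) feas_mono[of p "Suc (Suc p)" "gmat \<tau> x" A "N - A"] by (auto simp: E_def indicator_def)
  qed
  have int: "integrable G (indicat_real B)" if "B \<in> sets G" for B
    using that by (intro integrable_real_indicator) (auto simp: emeasure_eq_measure)
  have "2 * measure G (E (Suc (Suc p))) = (LINT x|G. 2 * indicat_real (E (Suc (Suc p))) x)"
    using E[OF p] by simp
  also have "\<dots> = (LINT x|G. 2 * indicat_real (E p) x + (\<Sum>I\<in>S. indicat_real (C I) x))"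
    by (rule integral_cong_AE[OF _ _ ind])
      (use E[OF p] E[of p] C p in \<open>auto intro!: borel_measurable_add borel_measurable_times borel_measurable_sum borel_measurable_indicator\<close>)
  also have "\<dots> = (LINT x|G. 2 * indicat_real (E p) x) + (LINT x|G. (\<Sum>I\<in>S. indicat_real (C I) x))"
    using E[of p] C p by (intro Bochner_Integration.integral_add integrable_mult_right Bochner_Integration.integrable_sum int) auto
  also have "(LINT x|G. (\<Sum>I\<in>S. indicat_real (C I) x)) = (\<Sum>I\<in>S. LINT x|G. indicat_real (C I) x)"
    using C by (intro Bochner_Integration.integral_sum int)
  also have "\<dots> = (\<Sum>I\<in>S. measure G (C I))" using C by (intro sum.cong) auto
  also have "\<dots> = (\<Sum>I\<in>S. 4 * pair_prob N \<tau> I A)"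
  proof (rule sum.cong[OF refl])
    fix I assume "I \<in> S"
    then show "measure G (C I) = 4 * pair_prob N \<tau> I A"
      unfolding C_def using p A by (intro counted_event) (auto simp: S_def)
  qed
  also have "(LINT x|G. 2 * indicat_real (E p) x) = 2 * measure G (E p)" using E[of p] p by simp
  finally have "measure G (E (Suc (Suc p))) = measure G (E p) + (\<Sum>I\<in>S. 2 * pair_prob N \<tau> I A)"
    by (simp add: sum_distrib_left[symmetric])
  then show ?thesis by (simp add: hits_def E_def S_def)
qed

text \<open>In general position a functional vanishing on \<open>p + 1\<close> rows is trivial and
  cannot be negative on the remaining ones. This is the start of the recursion when
  \<open>m - k\<close> is even.\<close>

lemma hits_zero:
  assumes A: "A \<subseteq> N" "card A = Suc p" and p: "p < d"
  shows "hits p A = 0"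
proof -
  have "AE x in G. x \<notin> {x\<in>space G. feas p (gmat \<tau> x) A (N - A)}"
    using AE_genpos_G[OF less_imp_le[OF p]]
  proof eventually_elim
    case (elim x)
    have "\<not> feas p (gmat \<tau> x) A (N - A)"
    proof
      assume "feas p (gmat \<tau> x) A (N - A)"
      then obtain c where c: "\<forall>i\<in>A. comb p (gmat \<tau> x) c i = 0" "\<forall>i\<in>N - A. comb p (gmat \<tau> x) c i < 0"
        unfolding feas_def by blast
      with elim A have "\<forall>r\<le>p. c r = 0" unfolding genpos_def by blast
      then have 0: "comb p (gmat \<tau> x) c i = 0" for i by (simp add: comb_def)
      have "card A < card N" using A(2) p dN by simp
      then have "N - A \<noteq> {}" using A(1) by (metis Diff_eq_empty_iff less_irrefl subset_antisym)
      with c(2) 0 show False by auto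
    qed
    then show ?case by simp
  qed
  then have "{x\<in>space G. feas p (gmat \<tau> x) A (N - A)} \<in> null_sets G"
    by (subst AE_iff_null_sets) (rule feas_sets[OF less_imp_le[OF p] A(1)], auto)
  then show ?thesis unfolding hits_def by (simp add: measure_def null_setsD1)
qed

text \<open>The recursion keeps the parity of \<open>m\<close>, so there are two starts: at
  \<open>m = k + 1\<close> the set \<open>A\<close> is itself a facet, and at
  \<open>m = k + 2\<close> the previous stage has probability 0. A step adds the term
  \<open>s = 0\<close> and shifts the older terms by one.\<close>

lemma hits_formula:
  assumes A: "A \<subseteq> N" "card A = Suc k" and m: "Suc k \<le> m" "m \<le> d"
  shows "hits m A = 2 * (\<Sum>s | 2 * s + k + 1 \<le> m. \<Sum>I | A \<subseteq> I \<and> I \<subseteq> N \<and> card I = m - 2 * s. pair_prob N \<tau> I A)"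
  using m
proof (induction m rule: less_induct)
  case (less m)
  consider "m = Suc k" | "m = Suc (Suc k)" | "Suc (Suc (Suc k)) \<le> m" using less.prems by linarith
  then show ?case
  proof cases
    case 1
    have "{s. 2 * s + k + 1 \<le> m} = {0}" using 1 by auto
    moreover have "{I. A \<subseteq> I \<and> I \<subseteq> N \<and> card I = m} = {A}"
    proof (intro equalityI subsetI)
      fix I assume I: "I \<in> {I. A \<subseteq> I \<and> I \<subseteq> N \<and> card I = m}"
      then have "finite I" using N finite_subset by blast
      with I A 1 have "A = I" by (intro card_subset_eq) auto
      then show "I \<in> {A}" by simp
    qed (use A 1 in auto)
    ultimately show ?thesis
      using facet_event[OF A(1), of m] A 1 less.prems by (simp add: hits_def)
  next
    case 2
    have "{s. 2 * s + k + 1 \<le> m} = {0}" using 2 by auto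
    moreover have "hits m A = hits k A + (\<Sum>I | A \<subseteq> I \<and> I \<subseteq> N \<and> card I = m. 2 * pair_prob N \<tau> I A)"
      unfolding 2 using A less.prems 2 by (intro hits_step) auto
    moreover have "hits k A = 0" using A less.prems 2 by (intro hits_zero) auto
    ultimately show ?thesis by (simp add: sum_distrib_left)
  next
    case 3
    define p where "p = m - 2"
    have p: "m = Suc (Suc p)" "Suc k \<le> p" using 3 by (auto simp: p_def)
    define f where "f s = (\<Sum>I | A \<subseteq> I \<and> I \<subseteq> N \<and> card I = m - 2 * s. pair_prob N \<tau> I A)" for s
    have S: "{s. 2 * s + k + 1 \<le> m} = insert 0 (Suc ` {s. 2 * s + k + 1 \<le> p})"
    proof (intro equalityI subsetI)
      fix s assume "s \<in> {s. 2 * s + k + 1 \<le> m}"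
      then show "s \<in> insert 0 (Suc ` {s. 2 * s + k + 1 \<le> p})" using p by (cases s) auto
    qed (use p in auto)
    have fin: "finite {s. 2 * s + k + 1 \<le> p}" by (rule finite_subset[of _ "{..p}"]) auto
    have "hits m A = hits p A + (\<Sum>I | A \<subseteq> I \<and> I \<subseteq> N \<and> card I = m. 2 * pair_prob N \<tau> I A)"
      unfolding p(1) using A less.prems p by (intro hits_step) auto
    also have "(\<Sum>I | A \<subseteq> I \<and> I \<subseteq> N \<and> card I = m. 2 * pair_prob N \<tau> I A) = 2 * f 0"
      by (simp add: f_def sum_distrib_left)
    also have "hits p A = 2 * (\<Sum>s | 2 * s + k + 1 \<le> p. f (Suc s))"
      using less.IH[of p] p less.prems by (simp add: f_def)
    finally show ?thesis unfolding f_def[symmetric] S using fin by (simp add: sum.reindex)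
  qed
qed

end

section \<open>Expected face numbers\<close>

context gaussian_rows
begin

text \<open>A point is outside the affine hull of others iff a hyperplane through the others misses it, which
  makes the dimension measurable even at degenerate configurations.\<close>

definition affine_rank_gt :: "nat \<Rightarrow> (nat \<times> nat \<Rightarrow> real) \<Rightarrow> nat set \<Rightarrow> bool"
  where "affine_rank_gt k x S \<longleftrightarrow>
    (\<exists>T\<subseteq>S. card T = Suc k \<and> (\<forall>j\<in>T. feas d (gmat \<tau> x) (T - {j}) {j}))"

definition faces :: "nat \<Rightarrow> (nat \<times> nat \<Rightarrow> real) \<Rightarrow> nat set set"
  where "faces k x = {S. S \<subseteq> N \<and> feas d (gmat \<tau> x) S (N - S) \<and>
    affine_rank_gt k x S \<and> \<not> affine_rank_gt (Suc k) x S}"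

lemma affine_rank_sets:
  assumes "S \<subseteq> N"
  shows "{x\<in>space G. affine_rank_gt k x S} \<in> sets G"
proof -
  have fS: "finite S" using assms N finite_subset by blast
  have "{x\<in>space G. affine_rank_gt k x S} =
      (\<Union>T\<in>{T. T \<subseteq> S \<and> card T = Suc k}. {x\<in>space G. \<forall>j\<in>T. feas d (gmat \<tau> x) (T - {j}) {j}})"
    by (auto simp: affine_rank_gt_def)
  also have "\<dots> \<in> sets G"
  proof (intro sets.finite_UN)
    show "finite {T. T \<subseteq> S \<and> card T = Suc k}" using fS by simp
    fix T assume T: "T \<in> {T. T \<subseteq> S \<and> card T = Suc k}"
    then have "finite T" using fS finite_subset by blast
    then show "{x\<in>space G. \<forall>j\<in>T. feas d (gmat \<tau> x) (T - {j}) {j}} \<in> sets G"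
      using T assms by (intro sets.sets_Collect_finite_All feas_sets) auto
  qed
  finally show ?thesis .
qed

text \<open>Interpolation makes every index set of size at most \<open>d + 1\<close> affinely
  independent. As \<open>k < d\<close>, this decides the rank conditions for both \<open>k\<close>
  and \<open>k + 1\<close>, and dimension \<open>k\<close> becomes cardinality
  \<open>k + 1\<close>.\<close>

lemma faces_generic:
  assumes gp: "genpos N (gmat \<tau> x) d" and k: "k < d"
  shows "faces k x = {A. A \<subseteq> N \<and> card A = Suc k \<and> feas d (gmat \<tau> x) A (N - A)}"
proof -
  have rank: "affine_rank_gt j x S \<longleftrightarrow> Suc j \<le> card S" if S: "S \<subseteq> N" and j: "j \<le> d" for j S
  proof
    assume "affine_rank_gt j x S"
    then obtain T where "T \<subseteq> S" "card T = Suc j" unfolding affine_rank_gt_def by blast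
    then show "Suc j \<le> card S" using card_mono[of S T] S N finite_subset by metis
  next
    assume "Suc j \<le> card S"
    then obtain T where T: "T \<subseteq> S" "card T = Suc j" by (metis obtain_subset_with_card_n)
    have "feas d (gmat \<tau> x) (T - {i}) {i}" if "i \<in> T" for i
    proof -
      obtain c where "\<forall>l\<in>T. comb d (gmat \<tau> x) c l = (if l = i then -1 else 0)"
        using genpos_interpolate[OF gp N(1), of T "\<lambda>l. if l = i then -1 else 0"] T S j dN by auto
      then show ?thesis unfolding feas_def using that by (intro exI[of _ c]) auto
    qed
    with T show "affine_rank_gt j x S" unfolding affine_rank_gt_def by blast
  qed
  have "card S = Suc k \<longleftrightarrow> affine_rank_gt k x S \<and> \<not> affine_rank_gt (Suc k) x S" if "S \<subseteq> N" for S
    using rank[OF that, of k] rank[OF that, of "Suc k"] k by auto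
  then show ?thesis unfolding faces_def by blast
qed

lemma card_faces_indicator:
  assumes "x \<in> space G"
  shows "real (card (faces k x)) = (\<Sum>S\<in>Pow N. indicat_real {x\<in>space G. feas d (gmat \<tau> x) S (N - S) \<and>
    affine_rank_gt k x S \<and> \<not> affine_rank_gt (Suc k) x S} x)"
proof -
  define Q where "Q S \<longleftrightarrow> feas d (gmat \<tau> x) S (N - S) \<and> affine_rank_gt k x S \<and> \<not> affine_rank_gt (Suc k) x S" for S
  have "faces k x = {S\<in>Pow N. Q S}" by (auto simp: faces_def Q_def)
  then have "real (card (faces k x)) = (\<Sum>S\<in>Pow N. if Q S then 1 else 0)"
    using N(1) by (simp add: sum.If_cases Int_def)
  also have "\<dots> = (\<Sum>S\<in>Pow N. indicat_real {x\<in>space G. feas d (gmat \<tau> x) S (N - S) \<and>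
    affine_rank_gt k x S \<and> \<not> affine_rank_gt (Suc k) x S} x)"
    using assms by (intro sum.cong refl) (simp add: Q_def indicator_def)
  finally show ?thesis .
qed

lemma face_event_sets:
  assumes "S \<subseteq> N"
  shows "{x\<in>space G. feas d (gmat \<tau> x) S (N - S) \<and> affine_rank_gt k x S \<and> \<not> affine_rank_gt (Suc k) x S} \<in> sets G"
  using assms
  by (intro sets.sets_Collect_conj sets.sets_Collect_neg affine_rank_sets feas_sets) auto

lemma card_faces_measurable: "(\<lambda>x. real (card (faces k x))) \<in> borel_measurable G"
proof -
  have "(\<lambda>x. \<Sum>S\<in>Pow N. indicat_real {x\<in>space G. feas d (gmat \<tau> x) S (N - S) \<and>
    affine_rank_gt k x S \<and> \<not> affine_rank_gt (Suc k) x S} x) \<in> borel_measurable G"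
    by (intro borel_measurable_sum borel_measurable_indicator face_event_sets) auto
  then show ?thesis
    by (rule measurable_cong[THEN iffD1, rotated]) (use card_faces_indicator in simp)
qed

lemma integral_card_faces:
  assumes k: "k < d"
  shows "(LINT x|G. real (card (faces k x))) = (\<Sum>A | A \<subseteq> N \<and> card A = Suc k. hits d A)"
proof -
  interpret prob_space G by (rule prob_space_G)
  define S where "S = {A. A \<subseteq> N \<and> card A = Suc k}"
  have fS: "finite S" using N(1) by (simp add: S_def)
  define E where "E A = {x\<in>space G. feas d (gmat \<tau> x) A (N - A)}" for A
  have E: "E A \<in> sets G" if "A \<in> S" for A
    unfolding E_def using that by (intro feas_sets) (auto simp: S_def)
  have "(LINT x|G. real (card (faces k x))) = (LINT x|G. (\<Sum>A\<in>S. indicat_real (E A) x))"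
  proof (rule integral_cong_AE[OF card_faces_measurable])
    show "(\<lambda>x. \<Sum>A\<in>S. indicat_real (E A) x) \<in> borel_measurable G"
      by (intro borel_measurable_sum borel_measurable_indicator E)
    show "AE x in G. real (card (faces k x)) = (\<Sum>A\<in>S. indicat_real (E A) x)"
      using AE_genpos_G[OF order.refl] AE_space
    proof eventually_elim
      case (elim x)
      have "(\<Sum>A\<in>S. indicat_real (E A) x) = real (card {A\<in>S. x \<in> E A})"
        using fS by (simp add: indicator_def sum.If_cases Int_def)
      also have "{A\<in>S. x \<in> E A} = faces k x"
        using elim(2) unfolding faces_generic[OF elim(1) k] by (auto simp: S_def E_def)
      finally show ?case by simp
    qed
  qed
  also have "\<dots> = (\<Sum>A\<in>S. LINT x|G. indicat_real (E A) x)"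
    by (intro Bochner_Integration.integral_sum integrable_real_indicator E) (auto simp: emeasure_eq_measure)
  also have "\<dots> = (\<Sum>A\<in>S. hits d A)"
    using E by (intro sum.cong) (auto simp: hits_def E_def)
  finally show ?thesis by (simp add: S_def)
qed

text \<open>The order of summation is exchanged so that \<open>I\<close> comes first; the faces
  \<open>A\<close> inside \<open>I\<close> are then replaced by their complements
  \<open>K = I - A\<close>, of size \<open>(d - 2 * s) - (k + 1)\<close>.\<close>

lemma sum_hits:
  assumes k: "k < d"
  shows "(\<Sum>A | A \<subseteq> N \<and> card A = Suc k. hits d A) =
    2 * (\<Sum>s | 2 * s + k + 1 \<le> d. \<Sum>I | I \<subseteq> N \<and> card I = d - 2 * s.
      gauss_orthant (N - I) (\<Sum>i\<in>I. (\<tau> i)\<^sup>2) (\<lambda>j. (\<tau> j)\<^sup>2) *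
      (\<Sum>K | K \<subseteq> I \<and> card K = d - 2 * s - k - 1. gauss_orthant K (- (\<Sum>i\<in>I. (\<tau> i)\<^sup>2)) (\<lambda>i. (\<tau> i)\<^sup>2)))"
proof -
  define S where "S = {A. A \<subseteq> N \<and> card A = Suc k}"
  define J where "J s = {I. I \<subseteq> N \<and> card I = d - 2 * s}" for s
  have fin: "finite S" "finite (J s)" for s using N(1) by (simp_all add: S_def J_def)
  have inner: "(\<Sum>A | A \<in> S \<and> A \<subseteq> I. pair_prob N \<tau> I A) =
      gauss_orthant (N - I) (\<Sum>i\<in>I. (\<tau> i)\<^sup>2) (\<lambda>j. (\<tau> j)\<^sup>2) *
      (\<Sum>K | K \<subseteq> I \<and> card K = d - 2 * s - k - 1. gauss_orthant K (- (\<Sum>i\<in>I. (\<tau> i)\<^sup>2)) (\<lambda>i. (\<tau> i)\<^sup>2))"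
    if s: "2 * s + k + 1 \<le> d" and I: "I \<in> J s" for s I
  proof -
    have IN: "I \<subseteq> N" "card I = d - 2 * s" "finite I" using I N finite_subset[of I N] by (auto simp: J_def)
    have "(\<Sum>A | A \<in> S \<and> A \<subseteq> I. gauss_orthant (I - A) (- (\<Sum>i\<in>I. (\<tau> i)\<^sup>2)) (\<lambda>i. (\<tau> i)\<^sup>2)) =
        (\<Sum>K | K \<subseteq> I \<and> card K = d - 2 * s - k - 1. gauss_orthant K (- (\<Sum>i\<in>I. (\<tau> i)\<^sup>2)) (\<lambda>i. (\<tau> i)\<^sup>2))"
    proof (rule sum.reindex_bij_witness[of _ "\<lambda>K. I - K" "\<lambda>A. I - A"])
      fix A assume A: "A \<in> {A. A \<in> S \<and> A \<subseteq> I}"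
      show "I - (I - A) = A" using A by auto
      have "finite A" using A IN finite_subset by blast
      then show "I - A \<in> {K. K \<subseteq> I \<and> card K = d - 2 * s - k - 1}"
        using A IN by (auto simp: card_Diff_subset S_def)
    next
      fix K assume K: "K \<in> {K. K \<subseteq> I \<and> card K = d - 2 * s - k - 1}"
      show "I - (I - K) = K" using K by auto
      have "finite K" using K IN finite_subset by blast
      then show "I - K \<in> {A. A \<in> S \<and> A \<subseteq> I}"
        using K IN s by (auto simp: card_Diff_subset S_def)
    qed simp
    then show ?thesis unfolding pair_prob_def sum_distrib_left[symmetric] by (simp only:)
  qed
  have "(\<Sum>A\<in>S. hits d A) = (\<Sum>A\<in>S. 2 * (\<Sum>s | 2 * s + k + 1 \<le> d. \<Sum>I | I \<in> J s \<and> A \<subseteq> I. pair_prob N \<tau> I A))"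
  proof (rule sum.cong[OF refl])
    fix A assume "A \<in> S"
    then have "hits d A = 2 * (\<Sum>s | 2 * s + k + 1 \<le> d. \<Sum>I | A \<subseteq> I \<and> I \<subseteq> N \<and> card I = d - 2 * s. pair_prob N \<tau> I A)"
      using k by (intro hits_formula) (auto simp: S_def)
    then show "hits d A = 2 * (\<Sum>s | 2 * s + k + 1 \<le> d. \<Sum>I | I \<in> J s \<and> A \<subseteq> I. pair_prob N \<tau> I A)"
      by (simp add: J_def conj_ac)
  qed
  also have "\<dots> = 2 * (\<Sum>s | 2 * s + k + 1 \<le> d. \<Sum>A\<in>S. \<Sum>I | I \<in> J s \<and> A \<subseteq> I. pair_prob N \<tau> I A)"
    unfolding sum_distrib_left[symmetric] by (subst sum.swap) simp
  also have "\<dots> = 2 * (\<Sum>s | 2 * s + k + 1 \<le> d. \<Sum>I\<in>J s. \<Sum>A | A \<in> S \<and> A \<subseteq> I. pair_prob N \<tau> I A)"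
    by (simp only: sum.swap_restrict[OF fin])
  also have "\<dots> = 2 * (\<Sum>s | 2 * s + k + 1 \<le> d. \<Sum>I\<in>J s.
      gauss_orthant (N - I) (\<Sum>i\<in>I. (\<tau> i)\<^sup>2) (\<lambda>j. (\<tau> j)\<^sup>2) *
      (\<Sum>K | K \<subseteq> I \<and> card K = d - 2 * s - k - 1. gauss_orthant K (- (\<Sum>i\<in>I. (\<tau> i)\<^sup>2)) (\<lambda>i. (\<tau> i)\<^sup>2)))"
    by (intro arg_cong[where f = "(*) 2"] sum.cong refl inner) auto
  finally show ?thesis by (simp add: S_def J_def)
qed

text \<open>The supporting condition at \<open>v i / \<tau> i\<close>, multiplied by
  \<open>\<tau> i > 0\<close>, is a row condition in which coefficient 0 is minus the offset. The
  rank is translated by the same equivalence, so no genericity is required of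
  \<open>x\<close>.\<close>

lemma face_number_eq_card_faces:
  fixes v :: "nat \<Rightarrow> real ^ 'd" and e :: "nat \<Rightarrow> 'd"
  assumes e: "bij_betw e {1..d} UNIV" and x: "\<And>i r. i \<in> N \<Longrightarrow> r \<in> {1..d} \<Longrightarrow> x (i, r) = v i $ e r"
  shows "face_number k (convex hull ((\<lambda>i. v i /\<^sub>R \<tau> i) ` N)) = card (faces k x)"
proof -
  define y where "y i = v i /\<^sub>R \<tau> i" for i
  have comb: "comb d (gmat \<tau> x) c i = \<tau> i * (u \<bullet> y i + c 0)"
    if i: "i \<in> N" and u: "\<And>r. r \<in> {1..d} \<Longrightarrow> u $ e r = c r" for c u i
  proof -
    have "u \<bullet> v i = (\<Sum>j\<in>UNIV. u $ j * v i $ j)" by (simp add: inner_vec_def)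
    also have "\<dots> = (\<Sum>r\<in>{1..d}. u $ e r * v i $ e r)" by (rule sum.reindex_bij_betw[OF e, symmetric])
    also have "\<dots> = (\<Sum>r\<in>{1..d}. c r * gmat \<tau> x i r)"
      using i u x by (intro sum.cong) (auto simp: gmat_def)
    finally have "u \<bullet> v i = (\<Sum>r\<in>{1..d}. c r * gmat \<tau> x i r)" .
    moreover have "u \<bullet> v i = \<tau> i * (u \<bullet> y i)" using \<tau>[OF i] by (simp add: y_def)
    ultimately show ?thesis by (simp add: comb_0 gmat_def algebra_simps)
  qed
  have feas: "(\<exists>u c. (\<forall>i\<in>S. u \<bullet> y i = c) \<and> (\<forall>i\<in>T. u \<bullet> y i < c)) \<longleftrightarrow> feas d (gmat \<tau> x) S T"
    if ST: "S \<subseteq> N" "T \<subseteq> N" for S T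
  proof
    assume "\<exists>u c. (\<forall>i\<in>S. u \<bullet> y i = c) \<and> (\<forall>i\<in>T. u \<bullet> y i < c)"
    then obtain u c where uc: "\<forall>i\<in>S. u \<bullet> y i = c" "\<forall>i\<in>T. u \<bullet> y i < c" by blast
    define c' where "c' r = (if r = 0 then - c else u $ e r)" for r
    have "comb d (gmat \<tau> x) c' i = \<tau> i * (u \<bullet> y i - c)" if "i \<in> N" for i
      using comb[OF that, of u c'] by (simp add: c'_def)
    then show "feas d (gmat \<tau> x) S T"
      unfolding feas_def using uc ST \<tau> by (intro exI[of _ c']) (auto simp: subset_iff mult_pos_neg)
  next
    assume "feas d (gmat \<tau> x) S T"
    then obtain c where c: "\<forall>i\<in>S. comb d (gmat \<tau> x) c i = 0" "\<forall>i\<in>T. comb d (gmat \<tau> x) c i < 0"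
      unfolding feas_def by blast
    define u :: "real ^ 'd" where "u = (\<chi> j. c (the_inv_into {1..d} e j))"
    have "u $ e r = c r" if "r \<in> {1..d}" for r
      using that bij_betw_imp_inj_on[OF e] by (simp add: u_def the_inv_into_f_f)
    then have eq: "comb d (gmat \<tau> x) c i = \<tau> i * (u \<bullet> y i + c 0)" if "i \<in> N" for i
      using comb[OF that] by blast
    have "u \<bullet> y i = - c 0" if "i \<in> S" for i
    proof -
      have "i \<in> N" using that ST by blast
      then show ?thesis using eq[of i] c(1) that \<tau>[of i] by auto
    qed
    moreover have "u \<bullet> y i < - c 0" if "i \<in> T" for i
    proof -
      have "i \<in> N" using that ST by blast
      then have "\<tau> i * (u \<bullet> y i + c 0) < 0" "0 < \<tau> i" using eq[of i] c(2) that \<tau>[of i] by auto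
      then show ?thesis by (auto simp: mult_less_0_iff)
    qed
    ultimately show "\<exists>u c. (\<forall>i\<in>S. u \<bullet> y i = c) \<and> (\<forall>i\<in>T. u \<bullet> y i < c)" by blast
  qed
  have rank: "int j \<le> aff_dim (y ` S) \<longleftrightarrow> affine_rank_gt j x S" if S: "S \<subseteq> N" for j S
  proof -
    have "finite S" using S N finite_subset by blast
    have *: "(\<exists>u c. (\<forall>l\<in>T - {i}. u \<bullet> y l = c) \<and> u \<bullet> y i < c) \<longleftrightarrow> feas d (gmat \<tau> x) (T - {i}) {i}"
      if "T \<subseteq> S" "i \<in> T" for T i
      using feas[of "T - {i}" "{i}"] that S by auto
    show ?thesis
      unfolding aff_dim_image_ge_iff[OF \<open>finite S\<close>] affine_rank_gt_def using * by (intro ex_cong1) auto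
  qed
  have "N \<noteq> {}" using dN by auto
  have "face_number k (convex hull (y ` N)) =
    card {S. S \<subseteq> N \<and> (\<exists>u c. (\<forall>i\<in>S. u \<bullet> y i = c) \<and> (\<forall>i\<in>N - S. u \<bullet> y i < c)) \<and> aff_dim (y ` S) = int k}"
    by (rule face_number_image[OF N(1) \<open>N \<noteq> {}\<close>])
  also have "{S. S \<subseteq> N \<and> (\<exists>u c. (\<forall>i\<in>S. u \<bullet> y i = c) \<and> (\<forall>i\<in>N - S. u \<bullet> y i < c)) \<and> aff_dim (y ` S) = int k} = faces k x"
  proof -
    have "S \<subseteq> N \<and> (\<exists>u c. (\<forall>i\<in>S. u \<bullet> y i = c) \<and> (\<forall>i\<in>N - S. u \<bullet> y i < c)) \<and> aff_dim (y ` S) = int k \<longleftrightarrow>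
        S \<subseteq> N \<and> feas d (gmat \<tau> x) S (N - S) \<and> affine_rank_gt k x S \<and> \<not> affine_rank_gt (Suc k) x S" for S
    proof (cases "S \<subseteq> N")
      case True
      have "aff_dim (y ` S) = int k \<longleftrightarrow> affine_rank_gt k x S \<and> \<not> affine_rank_gt (Suc k) x S"
        using rank[OF True, of k] rank[OF True, of "Suc k"] by auto
      with feas[OF True Diff_subset[of N S]] show ?thesis by simp
    qed simp
    then show ?thesis unfolding faces_def by blast
  qed
  finally show ?thesis by (simp add: y_def)
qed

end

lemma standard_gaussian_box:
  fixes X :: "'w \<Rightarrow> real ^ 'd" and e :: "nat \<Rightarrow> 'd"
  assumes X: "standard_gaussian_vector M X" and e: "bij_betw e {1..d} UNIV"
    and B: "\<And>r. r \<in> {1..d} \<Longrightarrow> B r \<in> sets borel"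
  shows "emeasure M (X -` {v. \<forall>r\<in>{1..d}. v $ e r \<in> B r} \<inter> space M) = (\<Prod>r\<in>{1..d}. emeasure std_normal (B r))"
proof -
  \<comment> \<open>The density is a product over basis vectors, so the box is reindexed from the
    numbers \<open>1, ..., d\<close> to the axes before the integral factorizes.\<close>
  define B' where "B' b = B (the_inv_into {1..d} e (axis_index b))" for b :: "real ^ 'd"
  have inv: "the_inv_into {1..d} e (e r) = r" if "r \<in> {1..d}" for r
    using that bij_betw_imp_inj_on[OF e] by (simp add: the_inv_into_f_f)
  have Basis: "bij_betw (\<lambda>r. axis (e r) (1 :: real)) {1..d} (Basis :: (real ^ 'd) set)"
  proof -
    have "bij_betw (\<lambda>j. axis j (1 :: real)) UNIV (Basis :: (real ^ 'd) set)"
      unfolding bij_betw_def by (auto simp: Basis_vec_def inj_on_def axis_eq_axis)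
    from bij_betw_trans[OF e this] show ?thesis by (simp add: o_def)
  qed
  have B'B: "B' (axis (e r) 1) = B r" if "r \<in> {1..d}" for r
    using inv[OF that] by (simp add: B'_def)
  have B'm: "B' b \<in> sets borel" if b: "b \<in> Basis" for b
  proof -
    have "b \<in> (\<lambda>r. axis (e r) (1 :: real)) ` {1..d}" using b Basis by (simp add: bij_betw_def)
    then obtain r where "r \<in> {1..d}" "b = axis (e r) 1" by blast
    then show ?thesis using B'B B by simp
  qed
  define C where "C = {v :: real ^ 'd. \<forall>b\<in>Basis. v \<bullet> b \<in> B' b}"
  have C: "{v. \<forall>r\<in>{1..d}. v $ e r \<in> B r} = C"
  proof -
    have "(\<forall>b\<in>Basis. v \<bullet> b \<in> B' b) \<longleftrightarrow> (\<forall>r\<in>{1..d}. v $ e r \<in> B r)" for v :: "real ^ 'd"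
    proof -
      have "(\<forall>b\<in>(\<lambda>r. axis (e r) (1 :: real)) ` {1..d}. v \<bullet> b \<in> B' b) \<longleftrightarrow> (\<forall>r\<in>{1..d}. v $ e r \<in> B r)"
        using B'B by (simp add: inner_axis)
      then show ?thesis unfolding bij_betw_imp_surj_on[OF Basis] .
    qed
    then show ?thesis unfolding C_def by auto
  qed
  have [measurable]: "\<And>b. b \<in> Basis \<Longrightarrow> B' b \<in> sets borel" by (rule B'm)
  have Cm: "C \<in> sets lborel"
  proof -
    have "C = (\<Inter>b\<in>Basis. (\<lambda>v. v \<bullet> b) -` B' b \<inter> space borel)" by (auto simp: C_def)
    also have "\<dots> \<in> sets borel"
      using B'm by (intro sets.finite_INT measurable_sets[of _ borel borel]) auto
    finally show ?thesis by simp
  qed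
  define f where "f b t = std_normal_density t * indicat_real (B' b) t" for b and t :: real
  have "emeasure M (X -` C \<inter> space M) = (\<integral>\<^sup>+ v. ennreal (\<Prod>b\<in>Basis. std_normal_density (v \<bullet> b)) * indicator C v \<partial>lborel)"
    using X Cm unfolding standard_gaussian_vector_def by (intro distributed_emeasure)
  also have "\<dots> = (\<integral>\<^sup>+ v. (\<Prod>b\<in>Basis. ennreal (f b (v \<bullet> b))) \<partial>lborel)"
  proof (rule nn_integral_cong)
    fix v :: "real ^ 'd"
    have "indicator C v = (\<Prod>b\<in>Basis. indicat_real (B' b) (v \<bullet> b))"
      by (auto simp: C_def indicator_def)
    then have "(\<Prod>b\<in>Basis. f b (v \<bullet> b)) = (\<Prod>b\<in>Basis. std_normal_density (v \<bullet> b)) * indicator C v"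
      by (simp add: f_def prod.distrib)
    moreover have "(\<Prod>b\<in>Basis. ennreal (f b (v \<bullet> b))) = ennreal (\<Prod>b\<in>Basis. f b (v \<bullet> b))"
      by (rule prod_ennreal) (simp add: f_def)
    ultimately show "ennreal (\<Prod>b\<in>Basis. std_normal_density (v \<bullet> b)) * indicator C v = (\<Prod>b\<in>Basis. ennreal (f b (v \<bullet> b)))"
      by (simp add: indicator_def)
  qed
  also have "\<dots> = (\<Prod>b\<in>Basis. \<integral>\<^sup>+ t. ennreal (f b t) \<partial>lborel)"
    by (rule nn_integral_lborel_prod) (use B'm in \<open>auto simp: f_def\<close>)
  also have "\<dots> = (\<Prod>b\<in>Basis. emeasure std_normal (B' b))"
  proof (rule prod.cong[OF refl])
    fix b :: "real ^ 'd" assume "b \<in> Basis"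
    then show "(\<integral>\<^sup>+ t. ennreal (f b t) \<partial>lborel) = emeasure std_normal (B' b)"
      using B'm by (subst emeasure_density) (auto simp: f_def indicator_def intro!: nn_integral_cong)
  qed
  also have "\<dots> = (\<Prod>r\<in>{1..d}. emeasure std_normal (B' (axis (e r) 1)))"
    by (rule prod.reindex_bij_betw[OF Basis, symmetric])
  also have "\<dots> = (\<Prod>r\<in>{1..d}. emeasure std_normal (B r))"
    using B'B by (intro prod.cong) auto
  finally show ?thesis unfolding C .
qed

text \<open>On boxes, independence of the vectors gives a product over \<open>N\<close>, and each
  factor splits into coordinates by the product density. Boxes determine the law of the
  matrix.\<close>

lemma gaussian_entries_law:
  fixes g :: "nat \<Rightarrow> 'w \<Rightarrow> real ^ 'd" and e :: "nat \<Rightarrow> 'd"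
  assumes M: "prob_space M" and N: "finite N" "N \<noteq> {}"
    and g: "\<And>i. i \<in> N \<Longrightarrow> standard_gaussian_vector M (g i)"
    and indep: "prob_space.indep_vars M (\<lambda>_. borel) g N"
    and e: "bij_betw e {1..d} UNIV"
  shows "distr M (PiM (N \<times> {1..d}) (\<lambda>_. borel)) (\<lambda>\<omega>. \<lambda>q\<in>N \<times> {1..d}. g (fst q) \<omega> $ e (snd q)) =
    gauss (N \<times> {1..d})"
proof -
  interpret prob_space M by fact
  interpret P: product_prob_space "\<lambda>_. std_normal" by (rule product_prob_std_normal)
  have gm: "g i \<in> borel_measurable M" if "i \<in> N" for i
    using g[OF that] unfolding standard_gaussian_vector_def distributed_def by simp
  define \<Phi> where "\<Phi> = (\<lambda>\<omega>. \<lambda>q\<in>N \<times> {1..d}. g (fst q) \<omega> $ e (snd q))"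
  have \<Phi>: "\<Phi> \<in> measurable M (PiM (N \<times> {1..d}) (\<lambda>_. borel))"
    unfolding \<Phi>_def
  proof (rule measurable_restrict)
    fix q assume "q \<in> N \<times> {1..d}"
    then have "g (fst q) \<in> borel_measurable M" using gm by auto
    then show "(\<lambda>\<omega>. g (fst q) \<omega> $ e (snd q)) \<in> borel_measurable M"
      by (rule measurable_compose) (simp add: borel_measurable_continuous_onI continuous_on_component)
  qed
  have "gauss (N \<times> {1..d}) = distr M (PiM (N \<times> {1..d}) (\<lambda>_. borel)) \<Phi>"
    unfolding gauss_def
  proof (rule P.PiM_eqI[symmetric])
    show "finite (N \<times> {1..d})" using N by simp
    show "sets (distr M (PiM (N \<times> {1..d}) (\<lambda>_. borel)) \<Phi>) = sets (PiM (N \<times> {1..d}) (\<lambda>_. std_normal))"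
      unfolding sets_distr by (rule sets_PiM_cong) auto
    fix A :: "nat \<times> nat \<Rightarrow> real set" assume A: "\<And>q. q \<in> N \<times> {1..d} \<Longrightarrow> A q \<in> sets std_normal"
    define B where "B i = {v :: real ^ 'd. \<forall>r\<in>{1..d}. v $ e r \<in> A (i, r)}" for i
    have B: "B i \<in> sets borel" if "i \<in> N" for i
    proof -
      have "B i = (\<Inter>r\<in>{1..d}. (\<lambda>v. v $ e r) -` A (i, r) \<inter> space borel) \<inter> space borel" by (auto simp: B_def)
      also have "\<dots> \<in> sets borel"
      proof (cases "{1..d} = {}")
        case False
        have "(\<lambda>v :: real ^ 'd. v $ e r) -` A (i, r) \<inter> space borel \<in> sets borel" if "r \<in> {1..d}" for r
          by (rule measurable_sets[of _ borel borel])
            (use A[of "(i, r)"] \<open>i \<in> N\<close> that in \<open>auto intro!: borel_measurable_continuous_onI continuous_on_component\<close>)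
        then show ?thesis using False by (intro sets.Int sets.finite_INT) auto
      qed simp
      finally show ?thesis .
    qed
    have PA: "PiE (N \<times> {1..d}) A \<in> sets (PiM (N \<times> {1..d}) (\<lambda>_. borel))"
      using N A by (intro sets_PiM_I_finite) auto
    have "emeasure (distr M (PiM (N \<times> {1..d}) (\<lambda>_. borel)) \<Phi>) (PiE (N \<times> {1..d}) A) =
        emeasure M (\<Phi> -` PiE (N \<times> {1..d}) A \<inter> space M)"
      by (rule emeasure_distr[OF \<Phi> PA])
    also have "\<Phi> -` PiE (N \<times> {1..d}) A \<inter> space M = (\<Inter>i\<in>N. g i -` B i \<inter> space M)"
      using N(2) by (auto simp: \<Phi>_def B_def PiE_iff)
    also have "emeasure M \<dots> = ennreal (\<Prod>i\<in>N. prob (g i -` B i \<inter> space M))"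
      unfolding emeasure_eq_measure using indep_varsD[OF indep N(2,1) order.refl B] by simp
    also have "\<dots> = (\<Prod>i\<in>N. emeasure M (g i -` B i \<inter> space M))"
      by (simp add: emeasure_eq_measure prod_ennreal)
    also have "\<dots> = (\<Prod>i\<in>N. \<Prod>r\<in>{1..d}. emeasure std_normal (A (i, r)))"
      unfolding B_def using A by (intro prod.cong refl standard_gaussian_box[OF g e]) auto
    also have "\<dots> = (\<Prod>q\<in>N \<times> {1..d}. emeasure std_normal (A q))"
      by (simp add: prod.cartesian_product case_prod_unfold)
    finally show "emeasure (distr M (PiM (N \<times> {1..d}) (\<lambda>_. borel)) \<Phi>) (PiE (N \<times> {1..d}) A) =
        (\<Prod>q\<in>N \<times> {1..d}. emeasure std_normal (A q))" .
  qed
  then show ?thesis unfolding \<Phi>_def by (rule sym)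
qed

theorem theorem6p3:
  fixes M :: "'w measure"
    and g :: "nat \<Rightarrow> 'w \<Rightarrow> real ^ 'd"
    and \<tau> :: "nat \<Rightarrow> real"
    and d n k :: nat
  assumes "d = CARD('d)"
    and "n \<ge> d + 1"
    and "\<And>i. i \<in> {1..n} \<Longrightarrow> \<tau> i > 0"
    and "prob_space M"
    and "\<And>i. i \<in> {1..n} \<Longrightarrow> standard_gaussian_vector M (g i)"
    and "prob_space.indep_vars M (\<lambda>_. borel) g {1..n}"
    and "k \<le> d - 1"
  shows "(LINT \<omega>|M. real (face_number k (convex hull ((\<lambda>i. g i \<omega> /\<^sub>R \<tau> i) ` {1..n})))) =
    2 * (\<Sum>s | 2 * s + k + 1 \<le> d.
           \<Sum>I | I \<subseteq> {1..n} \<and> card I = d - 2 * s.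
             gauss_orthant ({1..n} - I) (\<Sum>i\<in>I. (\<tau> i)\<^sup>2) (\<lambda>j. (\<tau> j)\<^sup>2) *
             (\<Sum>K | K \<subseteq> I \<and> card K = d - 2 * s - k - 1.
                gauss_orthant K (- (\<Sum>i\<in>I. (\<tau> i)\<^sup>2)) (\<lambda>i. (\<tau> i)\<^sup>2)))"
proof -
  \<comment> \<open>Numbering from 1 leaves the index 0 free for the auxiliary Gaussian row.\<close>
  interpret gaussian_rows "{1..n}" \<tau> d
    by standard (use assms in auto)
  \<comment> \<open>Positivity of \<open>d\<close> makes the truncated difference in
    \<open>k \<le> d - 1\<close> harmless.\<close>
  have "0 < d" using assms(1) by simp
  then have k: "k < d" using assms(7) by simp
  have "card {1..d} = card (UNIV :: 'd set)" using assms(1) by simp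
  then obtain e :: "nat \<Rightarrow> 'd" where e: "bij_betw e {1..d} UNIV"
    using finite_same_card_bij[of "{1..d}" "UNIV :: 'd set"] by auto
  define \<Phi> where "\<Phi> = (\<lambda>\<omega>. \<lambda>q\<in>{1..n} \<times> {1..d}. g (fst q) \<omega> $ e (snd q))"
  have law: "distr M (PiM ({1..n} \<times> {1..d}) (\<lambda>_. borel)) \<Phi> = G"
    unfolding \<Phi>_def G_def by (rule gaussian_entries_law[OF assms(4) _ _ assms(5,6) e]) (use assms(2) in auto)
  have \<Phi>: "\<Phi> \<in> measurable M (PiM ({1..n} \<times> {1..d}) (\<lambda>_. borel))"
    unfolding \<Phi>_def
  proof (rule measurable_restrict)
    fix q assume "q \<in> {1..n} \<times> {1..d}"
    then have "g (fst q) \<in> borel_measurable M"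
      using assms(5)[of "fst q"] unfolding standard_gaussian_vector_def distributed_def by auto
    then show "(\<lambda>\<omega>. g (fst q) \<omega> $ e (snd q)) \<in> borel_measurable M"
      by (rule measurable_compose) (simp add: borel_measurable_continuous_onI continuous_on_component)
  qed
  \<comment> \<open>The two counts agree for every outcome, degenerate configurations included, so
    the integrands are equal everywhere and measurability carries over from
    \<open>faces\<close>.\<close>
  have "(LINT \<omega>|M. real (face_number k (convex hull ((\<lambda>i. g i \<omega> /\<^sub>R \<tau> i) ` {1..n})))) =
      (LINT \<omega>|M. real (card (faces k (\<Phi> \<omega>))))"
    by (intro Bochner_Integration.integral_cong refl arg_cong[where f = real] face_number_eq_card_faces[OF e])
      (auto simp: \<Phi>_def)
  also have "\<dots> = (LINT x|distr M (PiM ({1..n} \<times> {1..d}) (\<lambda>_. borel)) \<Phi>. real (card (faces k x)))"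
  proof (rule integral_distr[OF \<Phi>, symmetric])
    have "sets G = sets (PiM ({1..n} \<times> {1..d}) (\<lambda>_. borel))"
      unfolding G_def by (rule sets_gauss)
    from measurable_cong_sets[OF this refl] card_faces_measurable[of k]
    show "(\<lambda>x. real (card (faces k x))) \<in> borel_measurable (PiM ({1..n} \<times> {1..d}) (\<lambda>_. borel))" by blast
  qed
  also have "\<dots> = (LINT x|G. real (card (faces k x)))" by (simp only: law)
  also have "\<dots> = (\<Sum>A | A \<subseteq> {1..n} \<and> card A = Suc k. hits d A)" by (rule integral_card_faces[OF k])
  also note sum_hits[OF k]
  finally show ?thesis .
qed

end
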